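(* Let $k$ be a field with $\operatorname{char}(k)\neq 2,3$. Each orbit in $V^{ss}_k/G_k$ represents exactly one isomorphism class of reduced Freudenthal algebras of dimension $6$ over $k$, and every reduced Freudenthal algebra of dimension $6$ over $k$ is, up to isomorphism, represented by some orbit in $V^{ss}_k/G_k$.
   Context: Setting. $V_6$ is the $6$-dimensional space of column vectors over $k$ with standard basis $e_1,\dots,e_6$; $J$ is the alternating bilinear form on $V_6$ with matrix $M_J=\begin{pmatrix}0&I_3\\-I_3&0\end{pmatrix}$; $G=Sp_6=\{g\in GL_6: gM_Jg^t=M_J\}$. $G$ acts on $V=\wedge^3V_6$; write $e_ie_j=e_i\wedge e_j$, etc. Let $\psi:\wedge^3V_6\to V_6$, $\psi(v_1\wedge v_2\wedge v_3)=J(v_2,v_3)v_1-J(v_1,v_3)v_2+J(v_1,v_2)v_3$, and $X=\ker\psi$ (dimension $14$). The subspace $W=\{v\wedge(e_1e_4+e_2e_5+e_3e_6):v\in V_6\}$ is $G$-stable, $\wedge^3V_6=X\oplus W$, and $\psi|_W:W\to V_6$ is a $G$-isomorphism; through it write $V=X\oplus V_6$, with elements $\tilde x=(x,v)$ and $g.(x,v)=(gx,gv)$. Invariants. Let $\partial/\partial e_m$ be the operator with $\frac{\partial}{\partial e_m}(e_i\wedge e_j\wedge e_l)=\delta_{im}e_j\wedge e_l-\delta_{jm}e_i\wedge e_l+\delta_{lm}e_i\wedge e_j$, let $\tau=e_1\wedge\cdots\wedge e_6$, and for $w\in\wedge^3V_6$ define $\phi(w)=(\phi_{ij}(w))_{6\times6}$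 by $w\wedge\frac{\partial}{\partial e_i}(w)\wedge e_j=\phi_{ij}(w)\tau$. Then $\phi(w)^2=f(w)I_6$ for a quartic form $f$. Put $f_1=-\frac14 f|_X$ and $f_2((x,v))=-\frac12 v^tM_J\phi(x)v$; both are $G$-invariant. $V^{ss}=\{(x,v): f_1(x)\ne0,\ f_2((x,v))\neq0\}$. A subscript $k$ denotes $k$-rational points; $V^{ss}_k/G_k$ is the set of $G_k$-orbits in $V^{ss}_k$. Freudenthal algebras. For a composition algebra $(C,N_C)$ over $k$ with conjugation $x\mapsto\overline x$ and $\Gamma=\operatorname{diag}(\gamma_1,\gamma_2,\gamma_3)\in GL_3(k)$, let $\mathcal H_3(C,\Gamma)=\{Y\in M_3(C):\Gamma^{-1}\overline Y^{t}\Gamma=Y\}$ with product $Y\cdot Z=\frac12(YZ+ZY)$. These are the reduced Freudenthal algebras; $\dim\mathcal H_3(C,\Gamma)=3(\dim C+1)$, so those of dimension $6$ are the $\mathcal H_3(k,\Gamma)$. "Represents". For $\tilde x\in V^{ss}_k$, the stabilizer of $\tilde x$ in $G=Sp_6$ is isomorphic over $k$ to $SL_1(Q)$ (norm-one elements) for a quaternion algebra $Q$ over $k$, unique up to isomorphism; let $N_Q$ be its norm form. The orbit of $\tilde x$ represents the isomorphism class of $\mathcal H_3(k,\Gamma)$ if the quadratic form $\langle 1,\gamma_2\gamma_3,\gamma_1\gamma_3,\gamma_1\gamma_2\rangle$ is isometric to $N_Q$. (Equivalently, writing $N_Q\simeq\langle1,-c\rangle\otimes\langle1,-d\rangle$,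 one has $\langle\gamma_3^{-1}\gamma_2,\gamma_1^{-1}\gamma_3,\gamma_2^{-1}\gamma_1\rangle\simeq\langle-c,-d,cd\rangle$.) *)

theory Defs
  imports
    "HOL-Analysis.Cartesian_Space"
    "HOL-Algebra.Algebraic_Closure_Type"
    "HOL-Library.Function_Algebras"
begin

(* otherwise "$" is ambiguous *)
no_notation fps_nth (infixl \<open>$\<close> 75)

section \<open>Exterior algebra\<close>

text \<open>
  The exterior algebra of \<open>'a^'n\<close> has basis \<open>e\<^sub>S\<close> for \<open>S\<close> a set of indices, where
  \<open>e\<^sub>S = e\<^sub>i \<and> e\<^sub>j \<and> ...\<close> with \<open>i < j < ...\<close> the elements of \<open>S\<close>; an element is given by its
  coefficients. The sign below counts the inversions needed to sort \<open>e\<^sub>S \<and> e\<^sub>T\<close>.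
\<close>

definition shuffle_sign :: "'n::{finite,linorder} set \<Rightarrow> 'n set \<Rightarrow> 'a::comm_ring_1" where
  "shuffle_sign S T = (-1) ^ card {(s, t). s \<in> S \<and> t \<in> T \<and> t < s}"

definition wedge ::
    "'a::comm_ring_1 ^ ('n::{finite,linorder} set) \<Rightarrow> 'a ^ ('n set) \<Rightarrow> 'a ^ ('n set)"
    (infixl \<open>\<and>\<^sub>e\<close> 70) where
  "u \<and>\<^sub>e w = (\<chi> S. \<Sum>T\<in>Pow S. shuffle_sign T (S - T) * u $ T * w $ (S - T))"

definition ext_vec :: "'a::comm_ring_1 ^ 'n::{finite,linorder} \<Rightarrow> 'a ^ ('n set)" where
  "ext_vec v = (\<Sum>i\<in>UNIV. v $ i *s axis {i} 1)"

definition ext_power :: "nat \<Rightarrow> ('a::comm_ring_1 ^ ('n::{finite,linorder} set)) set" where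
  "ext_power p = {w. \<forall>S. w $ S \<noteq> 0 \<longrightarrow> card S = p}"

text \<open>The linear map on the third exterior power with \<open>e\<^sub>i \<and> e\<^sub>j \<and> e\<^sub>l \<mapsto> h i j l\<close> for \<open>i < j < l\<close>.\<close>

definition linear_ext3 ::
    "('n::{finite,linorder} \<Rightarrow> 'n \<Rightarrow> 'n \<Rightarrow> 'a::comm_ring_1 ^ 'm) \<Rightarrow> 'a ^ ('n set) \<Rightarrow> 'a ^ 'm" where
  "linear_ext3 h w = (\<Sum>(i, j, l) \<in> {(i, j, l). i < j \<and> j < l}. w $ {i, j, l} *s h i j l)"


section \<open>The group \<open>Sp\<^sub>6\<close> and its representation\<close>

text \<open>
  The elements of the type \<open>6\<close> are \<open>0 < 1 < ... < 5\<close>, so the basis vector \<open>e\<^sub>m\<close> of the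
  mathematical notation (\<open>m = 1, ..., 6\<close>) has index \<open>m - 1\<close> here.
\<close>

definition MJ :: "'a::comm_ring_1 ^ 6 ^ 6" where
  "MJ = (\<chi> i j. if (i, j) \<in> {(0, 3), (1, 4), (2, 5)} then 1
                else if (i, j) \<in> {(3, 0), (4, 1), (5, 2)} then -1 else 0)"

definition form_J :: "'a::comm_ring_1 ^ 6 \<Rightarrow> 'a ^ 6 \<Rightarrow> 'a" where
  "form_J v w = scalar_product v (MJ *v w)"

definition Sp6 :: "('a::comm_ring_1 ^ 6 ^ 6) set" where
  "Sp6 = {g. invertible g \<and> g ** MJ ** transpose g = MJ}"

definition ext3_act :: "'a::comm_ring_1 ^ 6 ^ 6 \<Rightarrow> 'a ^ (6 set) \<Rightarrow> 'a ^ (6 set)" where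
  "ext3_act g = linear_ext3 (\<lambda>i j l.
     ext_vec (g *v axis i 1) \<and>\<^sub>e ext_vec (g *v axis j 1) \<and>\<^sub>e ext_vec (g *v axis l 1))"

definition psi :: "'a::comm_ring_1 ^ (6 set) \<Rightarrow> 'a ^ 6" where
  "psi = linear_ext3 (\<lambda>i j l.
     form_J (axis j 1) (axis l 1) *s axis i 1 - form_J (axis i 1) (axis l 1) *s axis j 1
     + form_J (axis i 1) (axis j 1) *s axis l 1)"

definition X_space :: "('a::comm_ring_1 ^ (6 set)) set" where
  "X_space = {w \<in> ext_power 3. psi w = 0}"

text \<open>
  The representation space is \<open>X \<oplus> V\<^sub>6\<close>; the pairs \<open>(x, v)\<close> of this type still have to be
  restricted to \<open>x \<in> X_space\<close>.
\<close>

type_synonym 'a rep = "('a ^ (6 set)) \<times> ('a ^ 6)"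

definition rep_act :: "'a::comm_ring_1 ^ 6 ^ 6 \<Rightarrow> 'a rep \<Rightarrow> 'a rep" where
  "rep_act g = (\<lambda>(x, v). (ext3_act g x, g *v v))"

definition ext_deriv :: "6 \<Rightarrow> 'a::comm_ring_1 ^ (6 set) \<Rightarrow> 'a ^ (6 set)" where
  "ext_deriv m = linear_ext3 (\<lambda>i j l.
     of_bool (i = m) *s (axis {j} 1 \<and>\<^sub>e axis {l} 1)
     - of_bool (j = m) *s (axis {i} 1 \<and>\<^sub>e axis {l} 1)
     + of_bool (l = m) *s (axis {i} 1 \<and>\<^sub>e axis {j} 1))"

text \<open>Taking the coefficient at \<open>UNIV\<close> is taking the coefficient of \<open>\<tau> = e\<^sub>1 \<and> ... \<and> e\<^sub>6\<close>.\<close>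

definition phi :: "'a::comm_ring_1 ^ (6 set) \<Rightarrow> 'a ^ 6 ^ 6" where
  "phi w = (\<chi> i j. (w \<and>\<^sub>e ext_deriv i w \<and>\<^sub>e axis {j} 1) $ UNIV)"

text \<open>Note that \<open>mat c\<close> is the scalar matrix with diagonal entry \<open>c\<close>.\<close>

definition f_quartic :: "'a::field ^ (6 set) \<Rightarrow> 'a" where
  "f_quartic w = (THE c. phi w ** phi w = mat c)"

definition f1 :: "'a::field ^ (6 set) \<Rightarrow> 'a" where
  "f1 x = - (1/4) * f_quartic x"

definition f2 :: "'a::field rep \<Rightarrow> 'a" where
  "f2 = (\<lambda>(x, v). - (1/2) * scalar_product v ((MJ ** phi x) *v v))"

definition Vss :: "('a::field rep) set" where
  "Vss = {(x, v). x \<in> X_space \<and> f1 x \<noteq> 0 \<and> f2 (x, v) \<noteq> 0}"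

definition Vss_orbits :: "('a::field rep) set set" where
  "Vss_orbits = {{rep_act g y | g. g \<in> Sp6} | y. y \<in> Vss}"

definition stabilizer :: "'a::comm_ring_1 rep \<Rightarrow> ('a ^ 6 ^ 6) set" where
  "stabilizer y = {g \<in> Sp6. rep_act g y = y}"


section \<open>Isomorphism of algebraic groups over \<open>k\<close>\<close>

text \<open>
  An affine algebraic group over \<open>k = 'a\<close> is given by its points over the algebraic closure, with
  a set of coordinate functions. A morphism over \<open>k\<close> is a group homomorphism that is given, in
  coordinates, by polynomials with coefficients in \<open>k\<close>. As usual for groups defined over \<open>k\<close> in
  this classical sense, the groups are understood to be smooth (stabilizers of points of \<open>V\<^sup>s\<^sup>s\<close> and
  \<open>SL\<^sub>1\<close> of a quaternion algebra are), so this is isomorphism of group schemes over \<open>k\<close>.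
\<close>

inductive k_polynomial ::
    "('x \<Rightarrow> 'a::field alg_closure) set \<Rightarrow> ('x \<Rightarrow> 'a alg_closure) \<Rightarrow> bool" for coords where
  const: "k_polynomial coords (\<lambda>x. to_ac c)"
| coord: "p \<in> coords \<Longrightarrow> k_polynomial coords p"
| add: "k_polynomial coords p \<Longrightarrow> k_polynomial coords q \<Longrightarrow> k_polynomial coords (\<lambda>x. p x + q x)"
| mult: "k_polynomial coords p \<Longrightarrow> k_polynomial coords q \<Longrightarrow> k_polynomial coords (\<lambda>x. p x * q x)"

definition k_morphism ::
    "('x \<Rightarrow> 'a::field alg_closure) set \<Rightarrow> 'x set \<Rightarrow> ('y \<Rightarrow> 'a alg_closure) set \<Rightarrow> 'y set
      \<Rightarrow> ('x \<Rightarrow> 'y) \<Rightarrow> bool" where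
  "k_morphism cx G cy H F \<longleftrightarrow> F ` G \<subseteq> H \<and>
     (\<forall>c\<in>cy. \<exists>p. k_polynomial cx p \<and> (\<forall>g\<in>G. c (F g) = p g))"

definition k_isomorphic ::
    "('x \<Rightarrow> 'a::field alg_closure) set \<Rightarrow> ('x \<Rightarrow> 'x \<Rightarrow> 'x) \<Rightarrow> 'x set \<Rightarrow>
     ('y \<Rightarrow> 'a alg_closure) set \<Rightarrow> ('y \<Rightarrow> 'y \<Rightarrow> 'y) \<Rightarrow> 'y set \<Rightarrow> bool" where
  "k_isomorphic cx mx G cy my H \<longleftrightarrow> (\<exists>F. bij_betw F G H \<and>
     (\<forall>g\<in>G. \<forall>h\<in>G. F (mx g h) = my (F g) (F h)) \<and>
     k_morphism cx G cy H F \<and> k_morphism cy H cx G (inv_into G F))"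

definition matrix_coords :: "('a ^ 'n ^ 'm \<Rightarrow> 'a) set" where
  "matrix_coords = {\<lambda>g. g $ i $ j | i j. True}"

definition vector_coords :: "('a ^ 'n \<Rightarrow> 'a) set" where
  "vector_coords = {\<lambda>v. v $ i | i. True}"


section \<open>Quaternion algebras and quadratic forms\<close>

text \<open>
  The quaternion algebra \<open>(c, d)\<close> has basis \<open>1, i, j, ij\<close> with \<open>i\<^sup>2 = c\<close>, \<open>j\<^sup>2 = d\<close>,
  \<open>ij = -ji\<close>; these have the coordinates \<open>1, 2, 3, 4\<close> in that order. Away from characteristic 2
  every quaternion algebra has this form with \<open>c, d \<noteq> 0\<close>. The same formulas, with the images of \<open>c\<close>
  and \<open>d\<close>, describe its base change.
\<close>

definition quat_mult :: "'a::comm_ring_1 \<Rightarrow> 'a \<Rightarrow> 'a ^ 4 \<Rightarrow> 'a ^ 4 \<Rightarrow> 'a ^ 4" where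
  "quat_mult c d x y = vector
     [x$1 * y$1 + c * x$2 * y$2 + d * x$3 * y$3 - c * d * x$4 * y$4,
      x$1 * y$2 + x$2 * y$1 - d * x$3 * y$4 + d * x$4 * y$3,
      x$1 * y$3 + x$3 * y$1 + c * x$2 * y$4 - c * x$4 * y$2,
      x$1 * y$4 + x$4 * y$1 + x$2 * y$3 - x$3 * y$2]"

definition quat_norm :: "'a::comm_ring_1 \<Rightarrow> 'a \<Rightarrow> 'a ^ 4 \<Rightarrow> 'a" where
  "quat_norm c d x = (x$1)^2 - c * (x$2)^2 - d * (x$3)^2 + c * d * (x$4)^2"

definition SL1 :: "'a::comm_ring_1 \<Rightarrow> 'a \<Rightarrow> ('a ^ 4) set" where
  "SL1 c d = {x. quat_norm c d x = 1}"

definition diag_form :: "'a::comm_ring_1 ^ 'n \<Rightarrow> 'a ^ 'n \<Rightarrow> 'a" where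
  "diag_form a x = (\<Sum>i\<in>UNIV. a $ i * (x $ i)^2)"

definition isometric :: "('a::field ^ 'n \<Rightarrow> 'a) \<Rightarrow> ('a ^ 'n \<Rightarrow> 'a) \<Rightarrow> bool" where
  "isometric q q' \<longleftrightarrow> (\<exists>T :: 'a ^ 'n ^ 'n. invertible T \<and> (\<forall>x. q' (T *v x) = q x))"


section \<open>Composition algebras and reduced Freudenthal algebras\<close>

text \<open>
  Carriers are subspaces of a vector space whose addition is that of the type; the operations are
  irrelevant outside the carrier. The norm form is required to be nondegenerate in the sense of its
  polar form, and conjugation is \<open>x \<mapsto> b(x, 1) 1 - x\<close> for the polar form \<open>b\<close>.
\<close>

record ('k, 'c) comp_alg =
  ccarrier :: "'c set"
  cscale :: "'k \<Rightarrow> 'c \<Rightarrow> 'c"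
  cmult :: "'c \<Rightarrow> 'c \<Rightarrow> 'c"
  cunit :: 'c
  cnorm :: "'c \<Rightarrow> 'k"

definition cpolar :: "('k::field, 'c::ab_group_add) comp_alg \<Rightarrow> 'c \<Rightarrow> 'c \<Rightarrow> 'k" where
  "cpolar C x y = cnorm C (x + y) - cnorm C x - cnorm C y"

definition cconj :: "('k::field, 'c::ab_group_add) comp_alg \<Rightarrow> 'c \<Rightarrow> 'c" where
  "cconj C x = cscale C (cpolar C x (cunit C)) (cunit C) - x"

definition composition_algebra :: "('k::field, 'c::ab_group_add) comp_alg \<Rightarrow> bool" where
  "composition_algebra C \<longleftrightarrow>
     vector_space (cscale C) \<and> module.subspace (cscale C) (ccarrier C) \<and>
     cunit C \<in> ccarrier C \<and> cunit C \<noteq> 0 \<and>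
     (\<forall>x\<in>ccarrier C. \<forall>y\<in>ccarrier C. cmult C x y \<in> ccarrier C) \<and>
     (\<forall>x\<in>ccarrier C. \<forall>y\<in>ccarrier C. \<forall>z\<in>ccarrier C.
        cmult C (x + y) z = cmult C x z + cmult C y z \<and>
        cmult C z (x + y) = cmult C z x + cmult C z y \<and>
        cpolar C (x + y) z = cpolar C x z + cpolar C y z) \<and>
     (\<forall>a. \<forall>x\<in>ccarrier C. \<forall>y\<in>ccarrier C.
        cmult C (cscale C a x) y = cscale C a (cmult C x y) \<and>
        cmult C x (cscale C a y) = cscale C a (cmult C x y) \<and>
        cpolar C (cscale C a x) y = a * cpolar C x y) \<and>
     (\<forall>x\<in>ccarrier C. cmult C (cunit C) x = x \<and> cmult C x (cunit C) = x) \<and>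
     (\<forall>a. \<forall>x\<in>ccarrier C. cnorm C (cscale C a x) = a^2 * cnorm C x) \<and>
     (\<forall>x\<in>ccarrier C. (\<forall>y\<in>ccarrier C. cpolar C x y = 0) \<longrightarrow> x = 0) \<and>
     (\<forall>x\<in>ccarrier C. \<forall>y\<in>ccarrier C. cnorm C (cmult C x y) = cnorm C x * cnorm C y)"

definition base_comp_alg :: "('k::field, 'k) comp_alg" where
  "base_comp_alg = \<lparr>ccarrier = UNIV, cscale = (*), cmult = (*), cunit = 1, cnorm = (\<lambda>x. x^2)\<rparr>"

record ('k, 'v) algebra =
  acarrier :: "'v set"
  ascale :: "'k \<Rightarrow> 'v \<Rightarrow> 'v"
  amult :: "'v \<Rightarrow> 'v \<Rightarrow> 'v"

definition alg_iso ::
    "('k, 'v::ab_group_add) algebra \<Rightarrow> ('k, 'w::ab_group_add) algebra \<Rightarrow> bool" where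
  "alg_iso A B \<longleftrightarrow> (\<exists>h. bij_betw h (acarrier A) (acarrier B) \<and>
     (\<forall>x\<in>acarrier A. \<forall>y\<in>acarrier A. h (x + y) = h x + h y \<and>
        h (amult A x y) = amult B (h x) (h y)) \<and>
     (\<forall>a. \<forall>x\<in>acarrier A. h (ascale A a x) = ascale B a (h x)))"

definition mat3_scale :: "('k, 'c) comp_alg \<Rightarrow> 'k \<Rightarrow> 'c ^ 3 ^ 3 \<Rightarrow> 'c ^ 3 ^ 3" where
  "mat3_scale C a Y = (\<chi> i j. cscale C a (Y $ i $ j))"

definition mat3_mult ::
    "('k, 'c::ab_group_add) comp_alg \<Rightarrow> 'c ^ 3 ^ 3 \<Rightarrow> 'c ^ 3 ^ 3 \<Rightarrow> 'c ^ 3 ^ 3" where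
  "mat3_mult C Y Z = (\<chi> i j. \<Sum>l\<in>UNIV. cmult C (Y $ i $ l) (Z $ l $ j))"

text \<open>
  \<open>\<Gamma> = diag(\<gamma>\<^sub>1, \<gamma>\<^sub>2, \<gamma>\<^sub>3)\<close> is given by the vector \<open>\<gamma>\<close>. The \<open>(i, j)\<close> entry of \<open>\<Gamma>\<inverse> Y\<^sup>* \<Gamma>\<close>, with \<open>Y\<^sup>*\<close> the
  conjugate transpose, is \<open>\<gamma>\<^sub>i\<inverse> \<gamma>\<^sub>j\<close> times the conjugate of \<open>Y\<^sub>j\<^sub>i\<close>.
\<close>

definition H3 :: "('k::field, 'c::ab_group_add) comp_alg \<Rightarrow> 'k ^ 3 \<Rightarrow> ('k, 'c ^ 3 ^ 3) algebra" where
  "H3 C \<gamma> = \<lparr>acarrier = {Y. \<forall>i j. Y $ i $ j \<in> ccarrier C \<and>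
                Y $ i $ j = cscale C (inverse (\<gamma> $ i) * \<gamma> $ j) (cconj C (Y $ j $ i))},
             ascale = mat3_scale C,
             amult = (\<lambda>Y Z. mat3_scale C (1/2) (mat3_mult C Y Z + mat3_mult C Z Y))\<rparr>"

text \<open>
  Composition algebras have dimension at most 8, so up to isomorphism all of them live on
  subspaces of \<open>nat \<Rightarrow> 'k\<close>. Fixing this ambient type makes the isomorphism classes of reduced
  Freudenthal algebras of dimension 6 the elements of a quotient set.
\<close>

type_synonym 'k freudenthal = "('k, (nat \<Rightarrow> 'k) ^ 3 ^ 3) algebra"

definition reduced_freudenthal :: "('k::field freudenthal) set" where
  "reduced_freudenthal = {H3 C \<gamma> | C \<gamma>. composition_algebra C \<and> (\<forall>i. \<gamma> $ i \<noteq> 0)}"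

definition reduced_freudenthal6 :: "('k::field freudenthal) set" where
  "reduced_freudenthal6 =
     {A \<in> reduced_freudenthal. vector_space.dim (ascale A) (acarrier A) = 6}"

definition freudenthal6_iso :: "('k::field freudenthal \<times> 'k freudenthal) set" where
  "freudenthal6_iso =
     {(A, B). A \<in> reduced_freudenthal6 \<and> B \<in> reduced_freudenthal6 \<and> alg_iso A B}"


section \<open>Orbits representing isomorphism classes\<close>

definition rep_to_ac :: "'a::field rep \<Rightarrow> 'a alg_closure rep" where
  "rep_to_ac = (\<lambda>(x, v). (\<chi> S. to_ac (x $ S), \<chi> i. to_ac (v $ i)))"

definition stabilizer_is_SL1 :: "'a::field rep \<Rightarrow> 'a \<Rightarrow> 'a \<Rightarrow> bool" where
  "stabilizer_is_SL1 y c d \<longleftrightarrow>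
     k_isomorphic matrix_coords (**) (stabilizer (rep_to_ac y))
                  vector_coords (quat_mult (to_ac c) (to_ac d)) (SL1 (to_ac c) (to_ac d))"

definition represents :: "('a::field rep) set \<Rightarrow> ('a freudenthal) set \<Rightarrow> bool" where
  "represents orb K \<longleftrightarrow> (\<exists>y\<in>orb. \<exists>c d. \<exists>\<gamma> :: 'a ^ 3.
     c \<noteq> 0 \<and> d \<noteq> 0 \<and> stabilizer_is_SL1 y c d \<and>
     (\<forall>i. \<gamma> $ i \<noteq> 0) \<and> (\<exists>A\<in>K. alg_iso A (H3 base_comp_alg \<gamma>)) \<and>
     isometric (diag_form (vector [1, \<gamma>$2 * \<gamma>$3, \<gamma>$1 * \<gamma>$3, \<gamma>$1 * \<gamma>$2] :: 'a ^ 4)) (quat_norm c d))"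

end

(*
  Let A = phi(x), J the symplectic form, and let B_v be the endomorphism obtained by contracting x
  with J(v, -) and lowering an index. Everything rests on one identity, valid for x in X:
    2 B_v B_v w = J(w, Av) v - J(v, Av) w - J(w, v) Av.
  It implies B_v A v = 0, hence B_v A = B_{Av} = - A B_v, and that A^2 is a scalar as soon as
  J(v, Av) is not 0. If both invariants of (x, v) are nonzero, there is w in the image of B_v with
  J(w, Aw) nonzero, and v, Av, w, Aw, B_v w, A B_v w is up to scaling a symplectic basis. In this
  basis x becomes a e1 e2 e3 + b e1 e5 e6 + c e2 e4 e6 + d e3 e4 e5 and v becomes e1.

  An element of the stabilizer of such a normal form fixes e1 and e4 and commutes on the span of
  e2, e3, e5, e6 with B_{e1} and B_{e4}, which generate the quaternion algebra (cd, ab); the span is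
  free of rank one over it, so the stabilizer is SL_1 of that algebra.

  For uniqueness, an isomorphism SL_1(Q) -> SL_1(Q') over k has a differential over k. It is computed
  along the polynomial curves 1 + t n, n a nilpotent pure quaternion over the algebraic closure; such
  n span the pure quaternions. The differential respects commutators, and since
  [x, [x, [x, y]]] = -4 N(x) [x, y] it respects the norm. Witt cancellation then shows that the forms
  given by two matrices Gamma are similar, so that the corresponding Jordan algebras are conjugate.
*)

theory Submission
  imports Defs
begin

section \<open>Coordinates of the exterior algebra\<close>

text \<open>\<open>represents\<close> asks for some point of the orbit, some quaternion algebra and
  some Gamma, so uniqueness has to compare arbitrary choices. All that links two of them is an
  isomorphism of point groups given by polynomials over k; this is why the norm form must be
  recovered from the group SL_1(Q) itself. Since N(1 + t n) = 1 + t^2 N(n) for pure n, the nilpotent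
  directions are the ones that give such lines. The differential has entries in k because the base
  point 1 is rational over k, so the isometry descends to k.

  The quadratic identity is a polynomial identity in the fourteen coordinates of X; polarized in v
  it becomes a finite check on basis vectors. For the normal form the two invariants are abcd and
  cd. The norm form of (cd, ab) is matched with Gamma through cd = -\<gamma>2 \<gamma>3 and ab =
  -\<gamma>1 \<gamma>3.\<close>

lemma less6_numeral [simp]:
  "(0::6) < 1" "(0::6) < 2" "(0::6) < 3" "(0::6) < 4" "(0::6) < 5"
  "(1::6) < 2" "(1::6) < 3" "(1::6) < 4" "(1::6) < 5"
  "(2::6) < 3" "(2::6) < 4" "(2::6) < 5" "(3::6) < 4" "(3::6) < 5" "(4::6) < 5"
  by (simp_all add: less_bit0_def Abs_bit0'_def bit0.Rep_numeral bit0.Rep_0 bit0.Rep_1)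

lemma not_less6_numeral [simp]:
  "\<not> (1::6) < 0" "\<not> (2::6) < 0" "\<not> (3::6) < 0" "\<not> (4::6) < 0" "\<not> (5::6) < 0"
  "\<not> (2::6) < 1" "\<not> (3::6) < 1" "\<not> (4::6) < 1" "\<not> (5::6) < 1"
  "\<not> (3::6) < 2" "\<not> (4::6) < 2" "\<not> (5::6) < 2" "\<not> (4::6) < 3" "\<not> (5::6) < 3"
    "\<not> (5::6) < 4"
  by (simp_all add: less_bit0_def Abs_bit0'_def bit0.Rep_numeral bit0.Rep_0 bit0.Rep_1)

lemma UNIV_6: "(UNIV :: 6 set) = {0, 1, 2, 3, 4, 5}"
proof -
  have "card {0, 1, 2, 3, 4, 5 :: 6} = CARD(6)" by simp
  from card_subset_eq[OF finite subset_UNIV this] show ?thesis by simp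
qed

lemma sum_6: "(\<Sum>i\<in>UNIV. f (i::6)) = f 0 + f 1 + f 2 + f 3 + f 4 + f 5"
  unfolding UNIV_6 by (simp add: ac_simps)

lemma forall_6: "(\<forall>i::6. P i) \<longleftrightarrow> P 0 \<and> P 1 \<and> P 2 \<and> P 3 \<and> P 4 \<and> P 5"
proof -
  have "(\<forall>i::6. P i) \<longleftrightarrow> (\<forall>i\<in>UNIV. P i)" by simp
  then show ?thesis unfolding UNIV_6 by simp
qed

lemma shuffle_sign_empty [simp]: "shuffle_sign {} T = 1" "shuffle_sign S {} = 1"
  by (simp_all add: shuffle_sign_def)

text \<open>Inversions are pairs, so those of a disjoint union on the left split into two disjoint
  sets, and the signs multiply.\<close>

lemma shuffle_sign_insert_left:
  assumes "a \<notin> S"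
  shows "shuffle_sign (insert a S) T = shuffle_sign {a} T * shuffle_sign S T"
proof -
  have "{(s, t). s \<in> insert a S \<and> t \<in> T \<and> t < s} =
        {(s, t). s \<in> {a} \<and> t \<in> T \<and> t < s} \<union> {(s, t). s \<in> S \<and> t \<in> T \<and> t < s}" by auto
  moreover have "{(s, t). s \<in> {a} \<and> t \<in> T \<and> t < s} \<inter> {(s, t). s \<in> S \<and> t \<in> T \<and> t < s} = {}"
    using assms by auto
  ultimately show ?thesis
    by (simp only: shuffle_sign_def card_Un_disjoint[OF finite finite] power_add)
qed

lemma shuffle_sign_insert_right:
  assumes "b \<notin> T"
  shows "shuffle_sign {a} (insert b T) = (if b < a then - 1 else 1) * shuffle_sign {a} T"
proof -
  have eq: "{(s, t). s \<in> {a} \<and> t \<in> insert b T \<and> t < s} =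
        (if b < a then {(a, b)} else {}) \<union> {(s, t). s \<in> {a} \<and> t \<in> T \<and> t < s}" by auto
  have "(if b < a then {(a, b)} else {}) \<inter> {(s, t). s \<in> {a} \<and> t \<in> T \<and> t < s} = {}"
    using assms by auto
  then show ?thesis
    unfolding shuffle_sign_def eq by (simp add: card_Un_disjoint[OF finite finite] power_add)
qed

lemma wedge_axis:
  "axis S 1 \<and>\<^sub>e axis T 1 = (if S \<inter> T = {} then shuffle_sign S T *s axis (S \<union> T) 1 else 0)"
  (is "?l = ?r")
proof -
  have "?l $ U = ?r $ U" for U
  proof -
    have "?l $ U = (\<Sum>R\<in>Pow U. if R = S then (if U - S = T then shuffle_sign S T else 0) else 0)"
      unfolding wedge_def vec_lambda_beta by (rule sum.cong) (auto simp: axis_def)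
    also have "\<dots> = (if S \<subseteq> U \<and> U - S = T then shuffle_sign S T else 0)"
      by (subst sum.delta) auto
    also have "S \<subseteq> U \<and> U - S = T \<longleftrightarrow> S \<inter> T = {} \<and> U = S \<union> T" by auto
    also have "(if S \<inter> T = {} \<and> U = S \<union> T then shuffle_sign S T else 0) = ?r $ U"
      by (simp add: axis_def)
    finally show ?thesis .
  qed
  then show ?thesis by (simp add: vec_eq_iff)
qed

lemma wedge_sum_left: "(\<Sum>i\<in>A. u i) \<and>\<^sub>e w = (\<Sum>i\<in>A. u i \<and>\<^sub>e w)"
  unfolding wedge_def vec_eq_iff
  by (simp only: vec_lambda_beta sum_component sum_distrib_left sum_distrib_right sum.swap[of _ A "Pow _"]) simp

lemma wedge_sum_right: "u \<and>\<^sub>e (\<Sum>i\<in>A. w i) = (\<Sum>i\<in>A. u \<and>\<^sub>e w i)"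
  unfolding wedge_def vec_eq_iff
  by (simp only: vec_lambda_beta sum_component sum_distrib_left sum_distrib_right sum.swap[of _ A "Pow _"]) simp

lemma wedge_scale_left: "(c *s u) \<and>\<^sub>e w = c *s (u \<and>\<^sub>e w)"
  unfolding wedge_def by (subst vec_eq_iff) (simp add: sum_distrib_left mult_ac)

lemma wedge_scale_right: "u \<and>\<^sub>e (c *s w) = c *s (u \<and>\<^sub>e w)"
  unfolding wedge_def by (subst vec_eq_iff) (simp add: sum_distrib_left mult_ac)

section \<open>Elements of the third exterior power as alternating functions of three
  indices\<close>

definition sgn3 :: "'n::linorder \<Rightarrow> 'n \<Rightarrow> 'n \<Rightarrow> 'a::comm_ring_1" where
  "sgn3 a b c = (if b < a then - 1 else 1) * (if c < a then - 1 else 1) * (if c < b then - 1 else 1)"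

text \<open>Elements are stored by subsets; this recovers the antisymmetric coefficient tensor. Sums
  can then run over all index triples, and sign bookkeeping reduces to exchanging two
  arguments.\<close>

definition tri :: "'a::comm_ring_1 ^ ('n::{finite,linorder} set) \<Rightarrow> 'n \<Rightarrow> 'n
  \<Rightarrow> 'n \<Rightarrow> 'a" where
  "tri w a b c = (if a = b \<or> a = c \<or> b = c then 0 else sgn3 a b c * w $ {a, b, c})"

lemma tri_swap12: "tri w b a c = - tri w a b c"
proof -
  have eq: "{b, a, c} = {a, b, c}" by auto
  show ?thesis by (cases a b rule: linorder_cases) (auto simp: tri_def sgn3_def eq dest: order.asym)
qed

lemma tri_swap23: "tri w a c b = - tri w a b c"
proof -
  have eq: "{a, c, b} = {a, b, c}" by auto
  show ?thesis by (cases b c rule: linorder_cases) (auto simp: tri_def sgn3_def eq dest: order.asym)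
qed

lemma tri_sorted: "a < b \<Longrightarrow> b < c \<Longrightarrow> tri w a b c = w $ {a, b, c}"
  by (auto simp: tri_def sgn3_def)

lemma wedge_zero_left [simp]: "0 \<and>\<^sub>e w = 0"
  by (simp add: wedge_def vec_eq_iff)

lemma wedge3_axis:
  fixes a b c :: "'n::{finite,linorder}"
  shows "axis {a} (1::'a::comm_ring_1) \<and>\<^sub>e axis {b} 1 \<and>\<^sub>e axis {c} 1 =
     (if a = b \<or> a = c \<or> b = c then 0 else sgn3 a b c *s axis {a, b, c} 1)"
proof (cases "a = b")
  case True
  then show ?thesis by (simp add: wedge_axis)
next
  case False
  have "axis {a} (1::'a) \<and>\<^sub>e axis {b} 1 = shuffle_sign {a} {b} *s axis ({a} \<union> {b}) 1"
    unfolding wedge_axis using False by simp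
  then have ab: "axis {a} (1::'a) \<and>\<^sub>e axis {b} 1 = shuffle_sign {a} {b} *s axis {a, b} 1"
    by (simp only: insert_is_Un[of a "{b}"])
  show ?thesis
  proof (cases "a = c \<or> b = c")
    case True
    then have "{a, b} \<inter> {c} \<noteq> {}" by auto
    then have "axis {a, b} (1::'a) \<and>\<^sub>e axis {c} 1 = 0" by (simp only: wedge_axis if_False)
    with True show ?thesis unfolding ab wedge_scale_left by simp
  next
    case neq: False
    then have "{a, b} \<inter> {c} = {}" by auto
    then have abc: "axis {a, b} (1::'a) \<and>\<^sub>e axis {c} 1 = shuffle_sign {a, b} {c} *s axis ({a, b} \<union> {c}) 1"
      unfolding wedge_axis by (simp only: if_True refl)
    have "{a, b} \<union> {c} = {a, b, c}" by auto
    moreover have "shuffle_sign {a} {b} * shuffle_sign {a, b} {c} = (sgn3 a b c :: 'a)"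
      using False neq
      by (simp add: shuffle_sign_insert_left[of a "{b}"] shuffle_sign_insert_right[of _ "{}"] sgn3_def)
    ultimately show ?thesis using False neq
      unfolding ab wedge_scale_left abc by (simp add: vector_smult_assoc)
  qed
qed

text \<open>Unrolls the sum in \<open>wedge\<close> over the subsets of an explicit set, one element
  at a time.\<close>

lemma sum_Pow_insert:
  assumes "a \<notin> S" "finite S"
  shows "(\<Sum>T\<in>Pow (insert a S). f T) = (\<Sum>T\<in>Pow S. f T) + (\<Sum>T\<in>Pow S. f (insert a T))"
proof -
  have "inj_on (insert a) (Pow S)" using assms(1) by (fastforce simp: inj_on_def)
  moreover have "Pow S \<inter> insert a ` Pow S = {}" using assms(1) by auto
  ultimately show ?thesis using assms(2)
    by (simp add: Pow_insert sum.union_disjoint sum.reindex)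
qed

text \<open>The triples with distinct indices are the six rearrangements of the increasing ones.
  These six images are disjoint, and all other terms are zero.\<close>

lemma sum_triples:
  fixes F :: "'n::{finite,linorder} \<Rightarrow> 'n \<Rightarrow> 'n \<Rightarrow> 'a::comm_monoid_add"
  assumes "\<And>i j l. i = j \<or> i = l \<or> j = l \<Longrightarrow> F i j l = 0"
  shows "(\<Sum>i\<in>UNIV. \<Sum>j\<in>UNIV. \<Sum>l\<in>UNIV. F i j l) =
    (\<Sum>(i, j, l)\<in>{(i, j, l). i < j \<and> j < l}.
        F i j l + F i l j + F j i l + F j l i + F l i j + F l j i)"
proof -
  define T :: "('n \<times> 'n \<times> 'n) set" where "T = {(i, j, l). i < j \<and> j < l}"
  define G where "G = (\<lambda>(i, j, l). F i j l)"
  have im: "(\<Sum>z\<in>f ` T. G z) = (\<Sum>z\<in>T. G (f z))" if "inj f" for f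
    using that by (simp add: sum.reindex inj_on_subset)
  let ?f2 = "\<lambda>(i, j, l). (i, l, j)" and ?f3 = "\<lambda>(i, j, l). (j, i, l)"
  let ?f4 = "\<lambda>(i, j, l). (j, l, i)" and ?f5 = "\<lambda>(i, j, l). (l, i, j)"
  let ?f6 = "\<lambda>(i, j, l). (l, j, i)"
  let ?U = "T \<union> ?f2 ` T \<union> ?f3 ` T \<union> ?f4 ` T \<union> ?f5 ` T \<union> ?f6 ` T"
  have "(\<Sum>i\<in>UNIV. \<Sum>j\<in>UNIV. \<Sum>l\<in>UNIV. F i j l) = (\<Sum>z\<in>UNIV. G z)"
    by (simp add: sum.cartesian_product G_def split_def)
  also have "\<dots> = (\<Sum>z\<in>?U. G z)"
  proof (rule sum.mono_neutral_right)
    show "\<forall>z\<in>UNIV - ?U. G z = 0"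
    proof
      fix z assume z: "z \<in> UNIV - ?U"
      obtain i j l where [simp]: "z = (i, j, l)" by (cases z)
      have "i = j \<or> i = l \<or> j = l"
      proof (rule ccontr)
        assume "\<not> (i = j \<or> i = l \<or> j = l)"
        then consider "i < j" "j < l" | "i < l" "l < j" | "j < i" "i < l" | "j < l" "l < i"
          | "l < i" "i < j" | "l < j" "j < i" by (metis linorder_neqE)
        then have "z \<in> ?U" by cases (auto simp: T_def image_iff)
        with z show False by blast
      qed
      with assms show "G z = 0" by (auto simp: G_def)
    qed
  qed auto
  also have "\<dots> = (\<Sum>z\<in>T. G z) + (\<Sum>z\<in>?f2 ` T. G z) + (\<Sum>z\<in>?f3 ` T. G z)
     + (\<Sum>z\<in>?f4 ` T. G z) + (\<Sum>z\<in>?f5 ` T. G z) + (\<Sum>z\<in>?f6 ` T. G z)"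
    by (subst sum.union_disjoint; (simp; fail)?; (force simp: T_def)?)+
  also have "\<dots> = (\<Sum>z\<in>T. G z + G (?f2 z) + G (?f3 z) + G (?f4 z) + G (?f5 z) + G (?f6 z))"
    by (subst im, force simp: inj_on_def)+ (simp add: sum.distrib)
  finally show ?thesis by (simp add: T_def G_def split_def)
qed

lemma tri_add: "tri (u + w) a b c = tri u a b c + tri w a b c"
  by (simp add: tri_def algebra_simps)

lemma tri_zero [simp]: "tri 0 a b c = 0"
  by (simp add: tri_def)

lemma tri_scale: "tri (k *s w) a b c = k * tri w a b c"
  by (simp add: tri_def mult_ac)

lemma tri_sum: "tri (\<Sum>i\<in>A. u i) a b c = (\<Sum>i\<in>A. tri (u i) a b c)"
  by (induction A rule: infinite_finite_induct) (simp_all add: tri_add)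

text \<open>The right side is the 3 by 3 determinant of Kronecker deltas. Both sides are alternating
  in \<open>i, j, l\<close> and in \<open>a, b, c\<close>; if the two index sets agree, the value is
  the product of the signs that sort them.\<close>

lemma tri_wedge3_axis:
  fixes a b c :: "'n::{finite,linorder}"
  shows "tri (axis {i} (1::'a::comm_ring_1) \<and>\<^sub>e axis {j} 1 \<and>\<^sub>e axis {l} 1) a b c =
    of_bool (i = a) * of_bool (j = b) * of_bool (l = c) - of_bool (i = a) * of_bool (j = c) * of_bool (l = b)
    - of_bool (i = b) * of_bool (j = a) * of_bool (l = c) + of_bool (i = b) * of_bool (j = c) * of_bool (l = a)
    + of_bool (i = c) * of_bool (j = a) * of_bool (l = b) - of_bool (i = c) * of_bool (j = b) * of_bool (l = a)"
proof (cases "(a = b \<or> a = c \<or> b = c) \<or> (i = j \<or> i = l \<or> j = l)")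
  case True
  then show ?thesis
  proof
    assume "a = b \<or> a = c \<or> b = c"
    then show ?thesis by (elim disjE) (simp_all add: tri_def)
  next
    assume "i = j \<or> i = l \<or> j = l"
    then show ?thesis by (elim disjE) (simp_all add: wedge3_axis mult_ac)
  qed
next
  case False
  then have tri: "tri (axis {i} (1::'a) \<and>\<^sub>e axis {j} 1 \<and>\<^sub>e axis {l} 1) a b c =
      sgn3 i j l * (sgn3 a b c * of_bool ({i, j, l} = {a, b, c}))"
    by (simp add: wedge3_axis tri_scale) (simp add: tri_def axis_def eq_commute[of "{a, b, c}"])
  show ?thesis
  proof (cases "{i, j, l} = {a, b, c}")
    case set: True
    have *: "sgn3 a c b = - (sgn3 a b c :: 'a)" "sgn3 b a c = - (sgn3 a b c :: 'a)"
      "sgn3 b c a = (sgn3 a b c :: 'a)" "sgn3 c a b = (sgn3 a b c :: 'a)"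
      "sgn3 c b a = - (sgn3 a b c :: 'a)" "sgn3 a b c * sgn3 a b c = (1::'a)"
      using False by (auto simp: sgn3_def dest: order.asym)
    have "i = a \<or> i = b \<or> i = c" "j = a \<or> j = b \<or> j = c" "l = a \<or> l = b \<or> l = c"
      using set by auto
    then consider "i = a" "j = b" "l = c" | "i = a" "j = c" "l = b" | "i = b" "j = a" "l = c"
      | "i = b" "j = c" "l = a" | "i = c" "j = a" "l = b" | "i = c" "j = b" "l = a"
      using False by (elim disjE) simp_all
    then show ?thesis unfolding tri set using False by cases (simp_all add: *)
  next
    case set: False
    then have "\<not> (i = a \<and> j = b \<and> l = c)" "\<not> (i = a \<and> j = c \<and> l = b)"
      "\<not> (i = b \<and> j = a \<and> l = c)" "\<not> (i = b \<and> j = c \<and> l = a)"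
      "\<not> (i = c \<and> j = a \<and> l = b)" "\<not> (i = c \<and> j = b \<and> l = a)"
      by auto
    then show ?thesis unfolding tri using set by (auto simp del: insert_iff)
  qed
qed

lemma sum_delta3:
  fixes F :: "'n::finite \<Rightarrow> 'n \<Rightarrow> 'n \<Rightarrow> 'a::comm_ring_1"
  shows "(\<Sum>l\<in>UNIV. \<Sum>j\<in>UNIV. \<Sum>i\<in>UNIV.
    F i j l * (of_bool (i = a) * of_bool (j = b) * of_bool (l = c))) = F a b c"
proof -
  have "F i j l * (of_bool (i = a) * of_bool (j = b) * of_bool (l = c)) =
    (if i = a then if j = b then if l = c then F i j l else 0 else 0 else 0)" for i j l by simp
  then show ?thesis by simp
qed

lemma tri_wedge3:
  fixes u v w :: "'a::comm_ring_1 ^ 'n::{finite,linorder}"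
  shows "tri (ext_vec u \<and>\<^sub>e ext_vec v \<and>\<^sub>e ext_vec w) a b c =
    u$a * v$b * w$c - u$a * v$c * w$b - u$b * v$a * w$c + u$b * v$c * w$a
    + u$c * v$a * w$b - u$c * v$b * w$a"
proof -
  have "tri (ext_vec u \<and>\<^sub>e ext_vec v \<and>\<^sub>e ext_vec w) a b c =
    (\<Sum>l\<in>UNIV. \<Sum>j\<in>UNIV. \<Sum>i\<in>UNIV. u$i * v$j * w$l *
       tri (axis {i} (1::'a) \<and>\<^sub>e axis {j} 1 \<and>\<^sub>e axis {l} 1) a b c)"
    unfolding ext_vec_def wedge_sum_left wedge_sum_right wedge_scale_left wedge_scale_right
      tri_sum tri_scale by (simp add: mult_ac sum_distrib_left)
  also have "\<dots> = u$a * v$b * w$c - u$a * v$c * w$b - u$b * v$a * w$c + u$b * v$c * w$a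
    + u$c * v$a * w$b - u$c * v$b * w$a"
    unfolding tri_wedge3_axis right_diff_distrib distrib_left sum_subtractf sum.distrib sum_delta3 ..
  finally show ?thesis .
qed

text \<open>On antisymmetric tensors \<open>g\<close> acts as its third tensor power, so no minors
  of \<open>g\<close> appear. The minors produced by the definition come back when the full sum is
  grouped over increasing triples.\<close>

lemma tri_ext3_act:
  "tri (ext3_act g w) a b c =
     (\<Sum>i\<in>UNIV. \<Sum>j\<in>UNIV. \<Sum>l\<in>UNIV. g$a$i * g$b$j * g$c$l * tri w i j l)"
proof -
  have "(\<Sum>i\<in>UNIV. \<Sum>j\<in>UNIV. \<Sum>l\<in>UNIV. g$a$i * g$b$j * g$c$l * tri w i j l) =
    (\<Sum>(i, j, l)\<in>{(i, j, l). i < j \<and> j < l}. w $ {i, j, l} *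
       (g$a$i * g$b$j * g$c$l - g$a$i * g$b$l * g$c$j - g$a$j * g$b$i * g$c$l
        + g$a$j * g$b$l * g$c$i + g$a$l * g$b$i * g$c$j - g$a$l * g$b$j * g$c$i))"
  proof (subst sum_triples, goal_cases)
    case 1 then show ?case by (auto simp: tri_def)
  next
    case 2
    show ?case
    proof (rule sum.cong[OF refl], clarify)
      fix i j l :: 6 assume "i < j" "j < l"
      then have 1: "tri w i j l = w $ {i, j, l}" by (rule tri_sorted)
      have 2: "tri w i l j = - w $ {i, j, l}" by (simp only: tri_swap23[of w i l j] 1)
      have 3: "tri w j i l = - w $ {i, j, l}" by (simp only: tri_swap12[of w j i l] 1)
      have 4: "tri w j l i = w $ {i, j, l}" by (simp only: tri_swap23[of w j l i] 3 minus_minus)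
      have 5: "tri w l i j = w $ {i, j, l}" by (simp only: tri_swap12[of w l i j] 2 minus_minus)
      have 6: "tri w l j i = - w $ {i, j, l}" by (simp only: tri_swap23[of w l j i] 5)
      show "g$a$i * g$b$j * g$c$l * tri w i j l + g$a$i * g$b$l * g$c$j * tri w i l j
         + g$a$j * g$b$i * g$c$l * tri w j i l + g$a$j * g$b$l * g$c$i * tri w j l i
         + g$a$l * g$b$i * g$c$j * tri w l i j + g$a$l * g$b$j * g$c$i * tri w l j i =
        w $ {i, j, l} *
       (g$a$i * g$b$j * g$c$l - g$a$i * g$b$l * g$c$j - g$a$j * g$b$i * g$c$l
        + g$a$j * g$b$l * g$c$i + g$a$l * g$b$i * g$c$j - g$a$l * g$b$j * g$c$i)"
        unfolding 1 2 3 4 5 6 by (simp add: algebra_simps)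
    qed
  qed
  also have "\<dots> = tri (ext3_act g w) a b c"
    unfolding ext3_act_def linear_ext3_def tri_sum
  proof (rule sum.cong[OF refl], clarify)
    fix i j l :: 6
    have col: "(g *v axis i 1) $ a = g$a$i" for a i
      by (simp add: matrix_vector_mult_def axis_def if_distrib cong: if_cong)
    show "w $ {i, j, l} *
       (g$a$i * g$b$j * g$c$l - g$a$i * g$b$l * g$c$j - g$a$j * g$b$i * g$c$l
        + g$a$j * g$b$l * g$c$i + g$a$l * g$b$i * g$c$j - g$a$l * g$b$j * g$c$i) =
       tri (w $ {i, j, l} *s (ext_vec (g *v axis i 1) \<and>\<^sub>e ext_vec (g *v axis j 1)
         \<and>\<^sub>e ext_vec (g *v axis l 1))) a b c"
      unfolding tri_scale tri_wedge3 col by (simp add: algebra_simps)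
  qed
  finally show ?thesis ..
qed

lemma sum_triples_6:
  "(\<Sum>(i, j, l)\<in>{(i::6, j, l). i < j \<and> j < l}. F i j l) =
     F 0 1 2 + F 0 1 3 + F 0 1 4 + F 0 1 5 + F 0 2 3 + F 0 2 4 + F 0 2 5 + F 0 3 4 + F 0 3 5 + F 0 4 5
     + F 1 2 3 + F 1 2 4 + F 1 2 5 + F 1 3 4 + F 1 3 5 + F 1 4 5 + F 2 3 4 + F 2 3 5 + F 2 4 5 + F 3 4 5"
proof -
  have "(\<Sum>(i, j, l)\<in>{(i::6, j, l). i < j \<and> j < l}. F i j l) =
    (\<Sum>(i, j, l)\<in>UNIV. if i < j \<and> j < l then F i j l else 0)"
    by (rule sum.mono_neutral_cong_left) (auto split: if_splits)
  also have "\<dots> = (\<Sum>i\<in>UNIV. \<Sum>j\<in>UNIV. \<Sum>l\<in>UNIV.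
    if i < j \<and> j < l then F i j l else 0)"
    by (simp only: UNIV_Times_UNIV[symmetric] sum.cartesian_product)
  also have "\<dots> = F 0 1 2 + F 0 1 3 + F 0 1 4 + F 0 1 5 + F 0 2 3 + F 0 2 4 + F 0 2 5 + F 0 3 4 + F 0 3 5 + F 0 4 5
     + F 1 2 3 + F 1 2 4 + F 1 2 5 + F 1 3 4 + F 1 3 5 + F 1 4 5 + F 2 3 4 + F 2 3 5 + F 2 4 5 + F 3 4 5"
    unfolding sum_6 by (simp add: add.assoc)
  finally show ?thesis .
qed

section \<open>The matrix \<open>phi\<close> and the map \<open>psi\<close> in coordinates\<close>

lemma wedge_axis_component:
  "(u \<and>\<^sub>e axis T 1) $ S = (if T \<subseteq> S then shuffle_sign (S - T) T * u $ (S - T) else 0)"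
proof -
  have "(u \<and>\<^sub>e axis T 1) $ S =
      (\<Sum>R\<in>Pow S. if R = S - T then (if T \<subseteq> S then shuffle_sign (S - T) T * u $ (S - T) else 0) else 0)"
    unfolding wedge_def vec_lambda_beta
  proof (rule sum.cong[OF refl])
    fix R assume "R \<in> Pow S"
    then have "S - R = T \<longleftrightarrow> R = S - T \<and> T \<subseteq> S" by auto
    then show "shuffle_sign R (S - R) * u $ R * axis T 1 $ (S - R) =
      (if R = S - T then (if T \<subseteq> S then shuffle_sign (S - T) T * u $ (S - T) else 0) else 0)"
      by (auto simp: axis_def double_diff)
  qed
  also have "\<dots> = (if T \<subseteq> S then shuffle_sign (S - T) T * u $ (S - T) else 0)"
    by (subst sum.delta) auto
  finally show ?thesis .
qed

lemma wedge_axis_pair: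
  assumes "j < l" "d < e"
  shows "(axis {j} (1::'a::comm_ring_1) \<and>\<^sub>e axis {l} 1) $ {d, e} = of_bool (j = d \<and> l = e)"
proof -
  have "{j, l} = {d, e} \<longleftrightarrow> j = d \<and> l = e"
    using assms by (auto simp: doubleton_eq_iff)
  moreover have "axis {j} (1::'a) \<and>\<^sub>e axis {l} 1 = axis ({j} \<union> {l}) 1"
    using assms by (auto simp: wedge_axis shuffle_sign_insert_right[of _ "{}"] dest: order.asym)
  then have "axis {j} (1::'a) \<and>\<^sub>e axis {l} 1 = axis {j, l} 1"
    by (simp only: insert_is_Un[of j "{l}"])
  ultimately show ?thesis by (simp add: axis_def eq_commute[of "{d, e}"])
qed

text \<open>At most one of (m, d, e), (d, m, e), (d, e, m) is increasing, and the sign attached to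
  it in the definition is the sign that sorts (m, d, e). Differentiation is thus contraction in the
  first slot.\<close>

lemma ext_deriv_component:
  fixes w :: "'a::comm_ring_1 ^ (6 set)"
  assumes "d < e"
  shows "ext_deriv m w $ {d, e} = tri w m d e"
proof -
  let ?T = "{(i, j, l). i < j \<and> j < l} :: (6 \<times> 6 \<times> 6) set"
  have "ext_deriv m w $ {d, e} = (\<Sum>z\<in>?T.
      (if z = (m, d, e) then w $ {m, d, e} else 0) - (if z = (d, m, e) then w $ {d, m, e} else 0)
      + (if z = (d, e, m) then w $ {d, e, m} else 0))"
    unfolding ext_deriv_def linear_ext3_def sum_component
  proof (rule sum.cong[OF refl], clarify)
    fix i j l :: 6 assume "i < j" "j < l"
    then have "i < l" by simp
    have 1: "w $ {i, j, l} * (of_bool (i = m) * of_bool (j = d \<and> l = e)) =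
        (if (i, j, l) = (m, d, e) then w $ {m, d, e} else 0)" by (simp split: if_split)
    have 2: "w $ {i, j, l} * (of_bool (j = m) * of_bool (i = d \<and> l = e)) =
        (if (i, j, l) = (d, m, e) then w $ {d, m, e} else 0)" by (simp split: if_split)
    have 3: "w $ {i, j, l} * (of_bool (l = m) * of_bool (i = d \<and> j = e)) =
        (if (i, j, l) = (d, e, m) then w $ {d, e, m} else 0)" by (simp split: if_split)
    show "(w $ {i, j, l} *s (of_bool (i = m) *s (axis {j} 1 \<and>\<^sub>e axis {l} 1)
      - of_bool (j = m) *s (axis {i} 1 \<and>\<^sub>e axis {l} 1)
      + of_bool (l = m) *s (axis {i} 1 \<and>\<^sub>e axis {j} 1))) $ {d, e} =
      (if (i, j, l) = (m, d, e) then w $ {m, d, e} else 0) - (if (i, j, l) = (d, m, e) then w $ {d, m, e} else 0)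
      + (if (i, j, l) = (d, e, m) then w $ {d, e, m} else 0)"
      unfolding vector_smult_component vector_minus_component vector_add_component
        wedge_axis_pair[OF \<open>i < j\<close> assms] wedge_axis_pair[OF \<open>j < l\<close> assms]
        wedge_axis_pair[OF \<open>i < l\<close> assms]
        right_diff_distrib distrib_left 1 2 3 ..
  qed
  also have "\<dots> = (if (m, d, e) \<in> ?T then w $ {m, d, e} else 0)
     - (if (d, m, e) \<in> ?T then w $ {d, m, e} else 0) + (if (d, e, m) \<in> ?T then w $ {d, e, m} else 0)"
    by (simp only: sum.distrib sum_subtractf sum.delta[OF finite])
  also have "\<dots> = tri w m d e"
  proof -
    have eq: "{d, m, e} = {m, d, e}" "{d, e, m} = {m, d, e}" by auto
    show ?thesis unfolding eq using assms
      by (auto simp: tri_def sgn3_def dest: order.asym)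
  qed
  finally show ?thesis .
qed

text \<open>The ten terms are the splittings of five indices into three and two; splittings of other
  sizes vanish because \<open>w\<close> is homogeneous of degree 3.\<close>

lemma wedge_component_5:
  assumes w: "w \<in> ext_power 3" and "a < b" "b < c" "c < d" "d < e"
  shows "(w \<and>\<^sub>e z) $ {a, b, c, d, e} =
     w${a,b,c} * z${d,e} - w${a,b,d} * z${c,e} + w${a,b,e} * z${c,d} + w${a,c,d} * z${b,e}
     - w${a,c,e} * z${b,d} + w${a,d,e} * z${b,c} - w${b,c,d} * z${a,e} + w${b,c,e} * z${a,d}
     - w${b,d,e} * z${a,c} + w${c,d,e} * z${a,b}"
proof -
  have ne: "a \<noteq> b" "a \<noteq> c" "a \<noteq> d" "a \<noteq> e" "b \<noteq> c" "b \<noteq> d"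
    "b \<noteq> e" "c \<noteq> d" "c \<noteq> e" "d \<noteq> e"
    using assms(2-) by auto
  note ne' = ne ne[symmetric]
  have lt: "a < b" "a < c" "a < d" "a < e" "b < c" "b < d" "b < e" "c < d" "c < e" "d < e"
    using assms(2-) by auto
  have ge: "\<not> b < a" "\<not> c < a" "\<not> d < a" "\<not> e < a" "\<not> c < b" "\<not> d < b" "\<not> e < b"
    "\<not> d < c" "\<not> e < c" "\<not> e < d" using lt by auto
  have 0: "w $ S = 0" if "card S \<noteq> 3" for S using w that by (auto simp: ext_power_def)
  have sl: "shuffle_sign {x, y, z} T = shuffle_sign {x} T * (shuffle_sign {y} T * shuffle_sign {z} T)"
    if "x \<noteq> y" "x \<noteq> z" "y \<noteq> z" for x y z T
    using that by (simp add: shuffle_sign_insert_left[of x "{y, z}"] shuffle_sign_insert_left[of y "{z}"])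
  have sr: "shuffle_sign {x} {y, z} = (if y < x then - 1 else 1) * (if z < x then - 1 else 1)"
    if "y \<noteq> z" for x y z
    using that by (simp add: shuffle_sign_insert_right[of y "{z}"] shuffle_sign_insert_right[of z "{}"])
  show ?thesis
    unfolding wedge_def vec_lambda_beta
    by (simp add: sum_Pow_insert ne' 0 insert_Diff_if sl sr lt ge)
qed

lemma shuffle_sign_right_singleton:
  "shuffle_sign (insert a S) {b} = (if b < a then - 1 else 1) * shuffle_sign S {b}" if "a \<notin> S"
  using that by (simp add: shuffle_sign_insert_left[of a S "{b}"] shuffle_sign_insert_right[of b "{}" a])

text \<open>Wedging with a basis vector and reading the top coefficient selects the coefficient at
  the complement of \<open>j\<close>, up to the sign of moving \<open>j\<close> into place.\<close>

lemma phi_component: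
  assumes w: "w \<in> ext_power 3" and S: "UNIV - {j} = {a, b, c, d, e}"
    and lt: "a < b" "b < c" "c < d" "d < e"
  shows "phi w $ i $ j = shuffle_sign {a, b, c, d, e} {j} *
    (tri w a b c * tri w i d e - tri w a b d * tri w i c e + tri w a b e * tri w i c d
     + tri w a c d * tri w i b e - tri w a c e * tri w i b d + tri w a d e * tri w i b c
     - tri w b c d * tri w i a e + tri w b c e * tri w i a d - tri w b d e * tri w i a c
     + tri w c d e * tri w i a b)"
proof -
  have lt': "a < c" "a < d" "a < e" "b < d" "b < e" "c < e" using lt by auto
  show ?thesis
    unfolding phi_def vec_lambda_beta wedge_axis_component S wedge_component_5[OF w lt]
    by (simp add: ext_deriv_component tri_sorted lt lt')
qed

text \<open>The columns alternate in sign, since moving the basis vector of index j past the larger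
  indices costs (-1)^(5 - j).\<close>

lemma phi_components:
  fixes w :: "'a::comm_ring_1 ^ (6 set)"
  assumes w: "w \<in> ext_power 3"
  shows "phi w $ i $ 0 = - (tri w 1 2 3 * tri w i 4 5 - tri w 1 2 4 * tri w i 3 5 + tri w 1 2 5 * tri w i 3 4
     + tri w 1 3 4 * tri w i 2 5 - tri w 1 3 5 * tri w i 2 4 + tri w 1 4 5 * tri w i 2 3
     - tri w 2 3 4 * tri w i 1 5 + tri w 2 3 5 * tri w i 1 4 - tri w 2 4 5 * tri w i 1 3
     + tri w 3 4 5 * tri w i 1 2)"
  "phi w $ i $ 1 = tri w 0 2 3 * tri w i 4 5 - tri w 0 2 4 * tri w i 3 5 + tri w 0 2 5 * tri w i 3 4
     + tri w 0 3 4 * tri w i 2 5 - tri w 0 3 5 * tri w i 2 4 + tri w 0 4 5 * tri w i 2 3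
     - tri w 2 3 4 * tri w i 0 5 + tri w 2 3 5 * tri w i 0 4 - tri w 2 4 5 * tri w i 0 3
     + tri w 3 4 5 * tri w i 0 2"
  "phi w $ i $ 2 = - (tri w 0 1 3 * tri w i 4 5 - tri w 0 1 4 * tri w i 3 5 + tri w 0 1 5 * tri w i 3 4
     + tri w 0 3 4 * tri w i 1 5 - tri w 0 3 5 * tri w i 1 4 + tri w 0 4 5 * tri w i 1 3
     - tri w 1 3 4 * tri w i 0 5 + tri w 1 3 5 * tri w i 0 4 - tri w 1 4 5 * tri w i 0 3
     + tri w 3 4 5 * tri w i 0 1)"
  "phi w $ i $ 3 = tri w 0 1 2 * tri w i 4 5 - tri w 0 1 4 * tri w i 2 5 + tri w 0 1 5 * tri w i 2 4
     + tri w 0 2 4 * tri w i 1 5 - tri w 0 2 5 * tri w i 1 4 + tri w 0 4 5 * tri w i 1 2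
     - tri w 1 2 4 * tri w i 0 5 + tri w 1 2 5 * tri w i 0 4 - tri w 1 4 5 * tri w i 0 2
     + tri w 2 4 5 * tri w i 0 1"
  "phi w $ i $ 4 = - (tri w 0 1 2 * tri w i 3 5 - tri w 0 1 3 * tri w i 2 5 + tri w 0 1 5 * tri w i 2 3
     + tri w 0 2 3 * tri w i 1 5 - tri w 0 2 5 * tri w i 1 3 + tri w 0 3 5 * tri w i 1 2
     - tri w 1 2 3 * tri w i 0 5 + tri w 1 2 5 * tri w i 0 3 - tri w 1 3 5 * tri w i 0 2
     + tri w 2 3 5 * tri w i 0 1)"
  "phi w $ i $ 5 = tri w 0 1 2 * tri w i 3 4 - tri w 0 1 3 * tri w i 2 4 + tri w 0 1 4 * tri w i 2 3
     + tri w 0 2 3 * tri w i 1 4 - tri w 0 2 4 * tri w i 1 3 + tri w 0 3 4 * tri w i 1 2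
     - tri w 1 2 3 * tri w i 0 4 + tri w 1 2 4 * tri w i 0 3 - tri w 1 3 4 * tri w i 0 2
     + tri w 2 3 4 * tri w i 0 1"
proof goal_cases
  case 1
  have S: "UNIV - {0::6} = {1, 2, 3, 4, 5}" unfolding UNIV_6 by (simp add: insert_Diff_if)
  have "shuffle_sign {1, 2, 3, 4, 5} {0::6} = (- 1::'a)"
    by (simp add: shuffle_sign_right_singleton)
  note phi = phi_component[OF w S, of i, simplified this]
  show ?case by (simp add: phi)
next
  case 2
  have S: "UNIV - {1::6} = {0, 2, 3, 4, 5}" unfolding UNIV_6 by (simp add: insert_Diff_if)
  have "shuffle_sign {0, 2, 3, 4, 5} {1::6} = (1::'a)"
    by (simp add: shuffle_sign_right_singleton)
  note phi = phi_component[OF w S, of i, simplified this]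
  show ?case by (simp add: phi)
next
  case 3
  have S: "UNIV - {2::6} = {0, 1, 3, 4, 5}" unfolding UNIV_6 by (simp add: insert_Diff_if)
  have "shuffle_sign {0, 1, 3, 4, 5} {2::6} = (- 1::'a)"
    by (simp add: shuffle_sign_right_singleton)
  note phi = phi_component[OF w S, of i, simplified this]
  show ?case by (simp add: phi)
next
  case 4
  have S: "UNIV - {3::6} = {0, 1, 2, 4, 5}" unfolding UNIV_6 by (simp add: insert_Diff_if)
  have "shuffle_sign {0, 1, 2, 4, 5} {3::6} = (1::'a)"
    by (simp add: shuffle_sign_right_singleton)
  note phi = phi_component[OF w S, of i, simplified this]
  show ?case by (simp add: phi)
next
  case 5
  have S: "UNIV - {4::6} = {0, 1, 2, 3, 5}" unfolding UNIV_6 by (simp add: insert_Diff_if)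
  have "shuffle_sign {0, 1, 2, 3, 5} {4::6} = (- 1::'a)"
    by (simp add: shuffle_sign_right_singleton)
  note phi = phi_component[OF w S, of i, simplified this]
  show ?case by (simp add: phi)
next
  case 6
  have S: "UNIV - {5::6} = {0, 1, 2, 3, 4}" unfolding UNIV_6 by (simp add: insert_Diff_if)
  have "shuffle_sign {0, 1, 2, 3, 4} {5::6} = (1::'a)"
    by (simp add: shuffle_sign_right_singleton)
  note phi = phi_component[OF w S, of i, simplified this]
  show ?case by (simp add: phi)
qed

text \<open>As rewrite rules the conditional exchanges terminate, because each removes an inversion;
  on numerals every \<open>tri\<close> ends with increasing indices or vanishes.\<close>

lemma tri_sort:
  "b < a \<Longrightarrow> tri w a b c = - tri w b a c" "c < b \<Longrightarrow> tri w a b c = - tri w a c b"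
  "tri w a a c = 0" "tri w a c c = 0" "tri w a c a = 0"
  by (rule tri_swap12, rule tri_swap23, simp_all add: tri_def)

lemma form_J_6: "form_J v w = v$0 * w$3 + v$1 * w$4 + v$2 * w$5 - v$3 * w$0 - v$4 * w$1 - v$5 * w$2"
  unfolding form_J_def scalar_product_def matrix_vector_mult_def MJ_def
  by (simp add: sum_6)

lemma psi_component: "psi w $ i = tri w i 0 3 + tri w i 1 4 + tri w i 2 5"
proof -
  have "\<forall>i. psi w $ i = tri w i 0 3 + tri w i 1 4 + tri w i 2 5"
    unfolding psi_def linear_ext3_def sum_triples_6 forall_6
    by (simp add: form_J_6 axis_def tri_sort tri_sorted)
  then show ?thesis ..
qed

section \<open>The quadratic identity for contractions\<close>

text \<open>
  \<open>contr x v\<close> is the contraction of \<open>x\<close> with \<open>J(v, -)\<close>, turned from a bivector into an endomorphism by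
  \<open>J\<close>: thus \<open>J(contr x v w, u)\<close> is the alternating trilinear form of \<open>x\<close> at \<open>v, u, w\<close>.
\<close>

definition contr :: "'a::comm_ring_1 ^ (6 set) \<Rightarrow> 'a ^ 6 \<Rightarrow> 'a ^ 6 ^ 6" where
  "contr x v = (\<chi> i j. \<Sum>a\<in>UNIV. (MJ *v v) $ a * tri x a i j) ** MJ"

lemma MJ_mult_components [simp]:
  fixes v :: "'a::comm_ring_1 ^ 6"
  shows "(MJ *v v) $ 0 = v $ 3" "(MJ *v v) $ 1 = v $ 4" "(MJ *v v) $ 2 = v $ 5"
    "(MJ *v v) $ 3 = - v $ 0" "(MJ *v v) $ 4 = - v $ 1" "(MJ *v v) $ 5 = - v $ 2"
  by (simp_all add: matrix_vector_mult_def MJ_def sum_6)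

lemma contr_mult:
  "(contr x v *v w) $ i = (\<Sum>j\<in>UNIV. (MJ *v w) $ j * (\<Sum>a\<in>UNIV. (MJ *v v) $ a * tri x a i j))"
  unfolding contr_def matrix_vector_mul_assoc[symmetric]
  by (simp add: matrix_vector_mult_def mult_ac)

text \<open>The six equations of X, solved for six of the twenty coefficients. The other fourteen
  are the coordinates used below.\<close>

lemma psi_zero_6:
  assumes "psi x = 0"
  shows "tri x 0 2 5 = - tri x 0 1 4" "tri x 1 2 5 = tri x 0 1 3" "tri x 1 2 4 = - tri x 0 2 3"
    "tri x 2 3 5 = - tri x 1 3 4" "tri x 2 4 5 = tri x 0 3 4" "tri x 1 4 5 = - tri x 0 3 5"
proof -
  have p: "tri x i 0 3 + tri x i 1 4 + tri x i 2 5 = 0" for i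
    using assms by (simp flip: psi_component)
  show "tri x 0 2 5 = - tri x 0 1 4" using p[of 0] by (simp add: tri_sort add_eq_0_iff)
  show "tri x 1 2 5 = tri x 0 1 3" using p[of 1] by (simp add: tri_sort add_eq_0_iff)
  show "tri x 1 2 4 = - tri x 0 2 3" using p[of 2] by (simp add: tri_sort add_eq_0_iff)
  show "tri x 2 3 5 = - tri x 1 3 4" using p[of 3] by (simp add: tri_sort add_eq_0_iff)
  show "tri x 2 4 5 = tri x 0 3 4" using p[of 4] by (simp add: tri_sort add_eq_0_iff)
  show "tri x 1 4 5 = - tri x 0 3 5" using p[of 5] by (simp add: tri_sort add_eq_0_iff)
qed

lemma MJ_entry:
  "MJ $ 0 = axis 3 1" "MJ $ 1 = axis 4 1" "MJ $ 2 = axis 5 1"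
  "MJ $ 3 = axis 0 (- 1)" "MJ $ 4 = axis 1 (- 1)" "MJ $ 5 = axis 2 (- 1)"
  by (simp_all add: vec_eq_iff MJ_def axis_def)

lemma contr_column:
  "contr x v $ i $ 0 = - (\<Sum>a\<in>UNIV. (MJ *v v) $ a * tri x a i 3)"
  "contr x v $ i $ 1 = - (\<Sum>a\<in>UNIV. (MJ *v v) $ a * tri x a i 4)"
  "contr x v $ i $ 2 = - (\<Sum>a\<in>UNIV. (MJ *v v) $ a * tri x a i 5)"
  "contr x v $ i $ 3 = (\<Sum>a\<in>UNIV. (MJ *v v) $ a * tri x a i 0)"
  "contr x v $ i $ 4 = (\<Sum>a\<in>UNIV. (MJ *v v) $ a * tri x a i 1)"
  "contr x v $ i $ 5 = (\<Sum>a\<in>UNIV. (MJ *v v) $ a * tri x a i 2)"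
  unfolding contr_def matrix_matrix_mult_def vec_lambda_beta
  by (subst sum_6, simp add: MJ_entry axis_def)+

lemma MJ_phi:
  "(MJ ** A) $ 0 = A $ 3" "(MJ ** A) $ 1 = A $ 4" "(MJ ** A) $ 2 = A $ 5"
  "(MJ ** A) $ 3 = - A $ 0" "(MJ ** A) $ 4 = - A $ 1" "(MJ ** A) $ 5 = - A $ 2"
  unfolding matrix_matrix_mult_def
  by (simp_all add: vec_eq_iff MJ_entry sum_6 axis_def)

definition mk6 :: "'b \<Rightarrow> 'b \<Rightarrow> 'b \<Rightarrow> 'b \<Rightarrow> 'b \<Rightarrow> 'b
  \<Rightarrow> 'b ^ 6" where
  "mk6 a0 a1 a2 a3 a4 a5 = (\<chi> i. if i = 0 then a0 else if i = 1 then a1 else if i = 2 then a2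
     else if i = 3 then a3 else if i = 4 then a4 else a5)"

lemma mk6_nth [simp]:
  "mk6 a0 a1 a2 a3 a4 a5 $ 0 = a0" "mk6 a0 a1 a2 a3 a4 a5 $ 1 = a1" "mk6 a0 a1 a2 a3 a4 a5 $ 2 = a2"
  "mk6 a0 a1 a2 a3 a4 a5 $ 3 = a3" "mk6 a0 a1 a2 a3 a4 a5 $ 4 = a4" "mk6 a0 a1 a2 a3 a4 a5 $ 5 = a5"
  by (simp_all add: mk6_def)

text \<open>Names the fourteen free coefficients of an element of X, so that relations between
  \<open>contr\<close> and \<open>phi\<close> become polynomial identities in plain variables. The
  letters are the values of \<open>tri\<close> on the increasing triples that
  \<open>psi_zero_6\<close> does not eliminate.\<close>

lemma X_space_coordinates:
  fixes x :: "'a::comm_ring_1 ^ (6 set)"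
  assumes "x \<in> X_space"
  obtains a b c d e f g h k l m n p q where
    "contr x (axis 0 1) =
      mk6 (mk6 0 (- g) (- h) 0 (- b) (- e))
      (mk6 0 (- m) (- n) b 0 (- l))
      (mk6 0 (- p) m e l 0)
      (mk6 0 0 0 0 0 0)
      (mk6 0 0 q (- g) (- m) (- p))
      (mk6 0 (- q) 0 (- h) (- n) m)"
    "contr x (axis 1 1) =
      mk6 (mk6 g 0 (- k) 0 (- c) (- f))
      (mk6 m 0 h c 0 e)
      (mk6 p 0 (- g) f (- e) 0)
      (mk6 0 0 (- q) g m p)
      (mk6 0 0 0 0 0 0)
      (mk6 q 0 0 (- k) h (- g))"
    "contr x (axis 2 1) =
      mk6 (mk6 h k 0 0 (- d) c)
      (mk6 n (- h) 0 d 0 (- b))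
      (mk6 (- m) g 0 (- c) b 0)
      (mk6 0 q 0 h n (- m))
      (mk6 (- q) 0 0 k (- h) g)
      (mk6 0 0 0 0 0 0)"
    "contr x (axis 3 1) =
      mk6 (mk6 0 0 0 0 0 0)
      (mk6 (- b) (- c) (- d) 0 0 a)
      (mk6 (- e) (- f) c 0 (- a) 0)
      (mk6 0 (- g) (- h) 0 (- b) (- e))
      (mk6 g 0 (- k) 0 (- c) (- f))
      (mk6 h k 0 0 (- d) c)"
    "contr x (axis 4 1) =
      mk6 (mk6 b c d 0 0 (- a))
      (mk6 0 0 0 0 0 0)
      (mk6 (- l) e (- b) a 0 0)
      (mk6 0 (- m) (- n) b 0 (- l))
      (mk6 m 0 h c 0 e)
      (mk6 n (- h) 0 d 0 (- b))"
    "contr x (axis 5 1) =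
      mk6 (mk6 e f (- c) 0 a 0)
      (mk6 l (- e) b (- a) 0 0)
      (mk6 0 0 0 0 0 0)
      (mk6 0 (- p) m e l 0)
      (mk6 p 0 (- g) f (- e) 0)
      (mk6 (- m) g 0 (- c) b 0)"
    "phi x =
      mk6 (mk6 (- a*q + 2*c*m + d*p + f*n - k*l) (- 2*c*g + 2*e*k - 2*f*h) (- 2*b*k + 2*c*h - 2*d*g) (2*a*k
        + 2*c*c + 2*d*f) (- 2*a*h - 2*b*c - 2*d*e) (2*a*g - 2*b*f + 2*c*e))
      (mk6 (- 2*b*m - 2*e*n + 2*h*l) (- a*q + 2*b*g + d*p - f*n + k*l) (2*b*h + 2*c*n - 2*d*m) (- 2*a*h
        - 2*b*c - 2*d*e) (- 2*a*n + 2*b*b - 2*d*l) (2*a*m + 2*b*e + 2*c*l))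
      (mk6 (- 2*b*p + 2*e*m - 2*g*l) (- 2*c*p + 2*e*g + 2*f*m) (- a*q - d*p + 2*e*h + f*n + k*l) (2*a*g
        - 2*b*f + 2*c*e) (2*a*m + 2*b*e + 2*c*l) (2*a*p + 2*e*e + 2*f*l))
      (mk6 (- 2*l*q - 2*m*m - 2*n*p) (2*e*q + 2*g*m + 2*h*p) (- 2*b*q + 2*g*n - 2*h*m) (a*q - 2*c*m - d*p
        - f*n + k*l) (2*b*m + 2*e*n - 2*h*l) (2*b*p - 2*e*m + 2*g*l))
      (mk6 (2*e*q + 2*g*m + 2*h*p) (2*f*q - 2*g*g + 2*k*p) (- 2*c*q - 2*g*h - 2*k*m) (2*c*g - 2*e*k + 2*f*h)
        (a*q - 2*b*g - d*p + f*n - k*l) (2*c*p - 2*e*g - 2*f*m))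
      (mk6 (- 2*b*q + 2*g*n - 2*h*m) (- 2*c*q - 2*g*h - 2*k*m) (- 2*d*q - 2*h*h - 2*k*n) (2*b*k - 2*c*h
        + 2*d*g) (- 2*b*h - 2*c*n + 2*d*m) (a*q + d*p - 2*e*h - f*n - k*l))"
proof -
  have x: "x \<in> ext_power 3" "psi x = 0" using assms by (auto simp: X_space_def)
  note tri = tri_sort psi_zero_6[OF x(2)]
  show thesis
    by (rule that[where a = "tri x 0 1 2" and b = "tri x 0 1 3" and c = "tri x 0 1 4" and d = "tri x 0 1 5"
      and e = "tri x 0 2 3" and f = "tri x 0 2 4" and g = "tri x 0 3 4" and h = "tri x 0 3 5"
      and k = "tri x 0 4 5" and l = "tri x 1 2 3" and m = "tri x 1 3 4" and n = "tri x 1 3 5"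
      and p = "tri x 2 3 4" and q = "tri x 3 4 5"])
      (simp_all only: vec_eq_iff forall_6 contr_column MJ_mult_components sum_6 phi_components[OF x(1)] mk6_nth,
       simp_all add: axis_def tri algebra_simps)
qed

text \<open>The difference of the two sides of the identity in \<open>contr_contr_mult\<close>, polarized in \<open>v\<close>.\<close>

definition contr_tensor ::
    "'a::comm_ring_1 ^ (6 set) \<Rightarrow> 6 \<Rightarrow> 6 \<Rightarrow> 6 \<Rightarrow> 6 \<Rightarrow> 'a" where
  "contr_tensor x p q k i = 2 * (\<Sum>j\<in>UNIV. contr x (axis p 1) $ i $ j * contr x (axis q 1) $ j $ k)
    + (MJ ** phi x) $ p $ q * of_bool (i = k) - (MJ ** phi x) $ k $ q * of_bool (i = p)
    + MJ $ k $ p * phi x $ i $ q"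

text \<open>An expression quadratic in v sees only the symmetrized coefficients. Each of these is a
  polynomial in the fourteen coordinates of X whose terms cancel on expansion; by symmetry only the
  pairs with p \<le> q are computed.\<close>

lemma contr_tensor_skew:
  assumes "x \<in> X_space"
  shows "contr_tensor x p q k i + contr_tensor x q p k i = 0"
proof (rule X_space_coordinates[OF assms], goal_cases)
  case coords: (1 a b c d e f g h k l m n p' q')
  define S where "S p q \<longleftrightarrow> (\<forall>k i. contr_tensor x p q k i
    + contr_tensor x q p k i = 0)" for p q
  have sym: "S p q \<longleftrightarrow> S q p" for p q by (simp add: S_def add.commute)
  have S0: "S 0 0" "S 0 1" "S 0 2" "S 0 3" "S 0 4" "S 0 5"
    by (simp_all only: S_def contr_tensor_def sum_6 forall_6 coords mk6_nth,
      simp_all add: axis_def MJ_phi MJ_entry algebra_simps)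
  have S1: "S 1 1" "S 1 2" "S 1 3" "S 1 4" "S 1 5"
    by (simp_all only: S_def contr_tensor_def sum_6 forall_6 coords mk6_nth,
      simp_all add: axis_def MJ_phi MJ_entry algebra_simps)
  have S2: "S 2 2" "S 2 3" "S 2 4" "S 2 5"
    by (simp_all only: S_def contr_tensor_def sum_6 forall_6 coords mk6_nth,
      simp_all add: axis_def MJ_phi MJ_entry algebra_simps)
  have S3: "S 3 3" "S 3 4" "S 3 5"
    by (simp_all only: S_def contr_tensor_def sum_6 forall_6 coords mk6_nth,
      simp_all add: axis_def MJ_phi MJ_entry algebra_simps)
  have S4: "S 4 4" "S 4 5"
    by (simp_all only: S_def contr_tensor_def sum_6 forall_6 coords mk6_nth,
      simp_all add: axis_def MJ_phi MJ_entry algebra_simps)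
  have S5: "S 5 5"
    by (simp_all only: S_def contr_tensor_def sum_6 forall_6 coords mk6_nth,
      simp_all add: axis_def MJ_phi MJ_entry algebra_simps)
  have "\<forall>p q. S p q"
    unfolding forall_6 using S0 S1 S2 S3 S4 S5 by (simp add: sym[of 1 0] sym[of 2 0] sym[of 2 1] sym[of 3 0]
      sym[of 3 1] sym[of 3 2] sym[of 4 0] sym[of 4 1] sym[of 4 2] sym[of 4 3] sym[of 5 0] sym[of 5 1]
      sym[of 5 2] sym[of 5 3] sym[of 5 4])
  then show ?thesis by (simp add: S_def)
qed

lemma contr_expand: "contr x v $ i $ j = (\<Sum>p\<in>UNIV. v $ p * contr x (axis p 1) $ i $ j)"
proof -
  have "\<forall>j. contr x v $ i $ j = (\<Sum>p\<in>UNIV. v $ p * contr x (axis p 1) $ i $ j)"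
    unfolding forall_6 contr_column sum_6 MJ_mult_components
    by (simp add: axis_def algebra_simps)
  then show ?thesis ..
qed

lemma contr_mult_expand: "contr x v *v w = (\<Sum>p\<in>UNIV. v $ p *s (contr x (axis p 1) *v w))"
proof -
  have "(contr x v *v w) $ i = (\<Sum>p\<in>UNIV. v $ p *s (contr x (axis p 1) *v w)) $ i" for i
    unfolding matrix_vector_mult_def vec_lambda_beta sum_component vector_smult_component
    by (subst contr_expand) (simp add: sum_distrib_left sum_distrib_right mult_ac, rule sum.swap)
  then show ?thesis by (simp add: vec_eq_iff)
qed

text \<open>The difference of the two sides at coordinate \<open>i\<close> is a quadratic form in
  \<open>v\<close> with coefficient matrix \<open>C\<close>. Since \<open>C\<close> is skew by
  \<open>contr_tensor_skew\<close>, twice the form vanishes, and 2 is invertible.\<close>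

lemma contr_contr_mult:
  fixes x :: "'a::field ^ (6 set)"
  assumes "x \<in> X_space" and two: "(2::'a) \<noteq> 0"
  shows "2 *s (contr x v *v (contr x v *v w)) =
    form_J w (phi x *v v) *s v - form_J v (phi x *v v) *s w - form_J w v *s (phi x *v v)"
proof -
  let ?B = "\<lambda>p. contr x (axis p 1)"
  have key: "2 * (contr x v *v (contr x v *v w)) $ i + form_J v (phi x *v v) * w $ i
     - form_J w (phi x *v v) * v $ i + form_J w v * (phi x *v v) $ i = 0" for i
  proof -
    define C where "C p q = 2 * (?B p *v (?B q *v w)) $ i + (MJ ** phi x) $ p $ q * w $ i
       - (\<Sum>k\<in>UNIV. w $ k * (MJ ** phi x) $ k $ q) * of_bool (i = p)
       + (\<Sum>k\<in>UNIV. w $ k * MJ $ k $ p) * phi x $ i $ q" for p q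
    have C: "C p q = (\<Sum>k\<in>UNIV. w $ k * contr_tensor x p q k i)" for p q
    proof -
      have "(?B p *v (?B q *v w)) $ i = (\<Sum>k\<in>UNIV. w $ k * (\<Sum>j\<in>UNIV. ?B p $ i $ j * ?B q $ j $ k))"
        unfolding matrix_vector_mul_assoc by (simp add: matrix_vector_mult_def matrix_matrix_mult_def mult_ac)
      moreover have delta: "(\<Sum>k\<in>UNIV. w $ k * (m * of_bool (i = k))) = m * w $ i" for m
      proof -
        have "w $ k * (m * of_bool (i = k)) = (if i = k then m * w $ k else 0)" for k by simp
        then show ?thesis by simp
      qed
      ultimately show ?thesis
        unfolding C_def contr_tensor_def distrib_left right_diff_distrib sum.distrib sum_subtractf delta
        by (simp add: sum_distrib_left sum_distrib_right mult_ac)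
    qed
    have skew: "C p q + C q p = 0" for p q
      unfolding C sum.distrib[symmetric] distrib_left[symmetric]
      by (simp add: contr_tensor_skew[OF assms(1)])
    define Z where "Z = (\<Sum>p\<in>UNIV. \<Sum>q\<in>UNIV. v $ p * v $ q * C p q)"
    have "Z + Z = (\<Sum>p\<in>UNIV. \<Sum>q\<in>UNIV. v $ p * v $ q * C p q)
      + (\<Sum>p\<in>UNIV. \<Sum>q\<in>UNIV. v $ p * v $ q * C q p)"
      unfolding Z_def by (subst (4) sum.swap) (simp add: mult_ac)
    also have "\<dots> = (\<Sum>p\<in>UNIV. \<Sum>q\<in>UNIV. v $ p * v $ q * (C p q + C q p))"
      by (simp only: sum.distrib distrib_left)
    also have "\<dots> = 0" by (simp add: skew)
    finally have "2 * Z = 0" by simp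
    with two have Z0: "Z = 0" by simp
    have a: "(contr x v *v (contr x v *v w)) $ i
      = (\<Sum>p\<in>UNIV. \<Sum>q\<in>UNIV. v $ p * v $ q * (?B p *v (?B q *v w)) $ i)"
    proof -
      have "?B p *v (contr x v *v w) = (\<Sum>q\<in>UNIV. v $ q *s (?B p *v (?B q *v w)))" for p
        by (subst contr_mult_expand)
          (simp add: vec.linear_sum[OF matrix_vector_mul_linear_gen] vec.linear_scale[OF matrix_vector_mul_linear_gen])
      then show ?thesis
        by (subst contr_mult_expand) (simp add: sum_distrib_left mult_ac)
    qed
    have b: "form_J v (phi x *v v) = (\<Sum>p\<in>UNIV. \<Sum>q\<in>UNIV. v $ p * v $ q * (MJ ** phi x) $ p $ q)"
      unfolding form_J_def matrix_vector_mul_assoc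
      by (simp add: scalar_product_def matrix_vector_mult_def sum_distrib_left mult_ac)
    have c: "form_J w (phi x *v v) = (\<Sum>q\<in>UNIV. v $ q * (\<Sum>k\<in>UNIV. w $ k * (MJ ** phi x) $ k $ q))"
      unfolding form_J_def matrix_vector_mul_assoc
      by (simp add: scalar_product_def matrix_vector_mult_def sum_distrib_left mult_ac) (rule sum.swap)
    have d: "form_J w v = (\<Sum>p\<in>UNIV. v $ p * (\<Sum>k\<in>UNIV. w $ k * MJ $ k $ p))"
      unfolding form_J_def
      by (simp add: scalar_product_def matrix_vector_mult_def sum_distrib_left mult_ac) (rule sum.swap)
    have e: "(phi x *v v) $ i = (\<Sum>q\<in>UNIV. v $ q * phi x $ i $ q)"
      by (simp add: matrix_vector_mult_def mult_ac)
    have f: "(\<Sum>p\<in>UNIV. v $ p * of_bool (i = p)) = v $ i"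
      by (simp add: of_bool_def if_distrib cong: if_cong)
    have product: "(\<Sum>p\<in>UNIV. \<Sum>q\<in>UNIV. v $ p * v $ q * (g q * h p)) =
        (\<Sum>p\<in>UNIV. v $ p * h p) * (\<Sum>q\<in>UNIV. v $ q * g q)" for g h :: "6 \<Rightarrow> 'a"
      unfolding sum_product by (intro sum.cong refl) (simp only: mult_ac)
    have "Z = (\<Sum>p\<in>UNIV. \<Sum>q\<in>UNIV. v $ p * v $ q * (2 * (?B p *v (?B q *v w)) $ i))
      + (\<Sum>p\<in>UNIV. \<Sum>q\<in>UNIV. v $ p * v $ q * ((MJ ** phi x) $ p $ q * w $ i))
      - (\<Sum>p\<in>UNIV. \<Sum>q\<in>UNIV. v $ p * v $ q * ((\<Sum>k\<in>UNIV. w $ k * (MJ ** phi x) $ k $ q) * of_bool (i = p)))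
      + (\<Sum>p\<in>UNIV. \<Sum>q\<in>UNIV. v $ p * v $ q * (phi x $ i $ q * (\<Sum>k\<in>UNIV. w $ k * MJ $ k $ p)))"
      unfolding Z_def C_def mult.commute[of _ "phi x $ i $ _"]
      by (simp only: distrib_left right_diff_distrib sum.distrib sum_subtractf)
    also have "\<dots> = 2 * (contr x v *v (contr x v *v w)) $ i + form_J v (phi x *v v) * w $ i
     - v $ i * form_J w (phi x *v v) + form_J w v * (phi x *v v) $ i"
      unfolding product f d[symmetric] c[symmetric] e[symmetric]
      by (simp only: a b sum_distrib_left sum_distrib_right mult_ac)
    finally have "Z = 2 * (contr x v *v (contr x v *v w)) $ i + form_J v (phi x *v v) * w $ i
     - v $ i * form_J w (phi x *v v) + form_J w v * (phi x *v v) $ i" .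
    then show ?thesis unfolding Z0 by (simp add: algebra_simps)
  qed
  show ?thesis unfolding vec_eq_iff
  proof
    fix i
    show "(2 *s (contr x v *v (contr x v *v w))) $ i =
      (form_J w (phi x *v v) *s v - form_J v (phi x *v v) *s w - form_J w v *s (phi x *v v)) $ i"
      using key[of i] by (simp add: algebra_simps)
  qed
qed

section \<open>The symplectic form and equivariance\<close>

text \<open>The tensor \<open>t\<close> is arbitrary: once a matrix has acted on a single slot, the
  intermediate tensor is in general no longer alternating.\<close>

definition tri_sum :: "('n::finite \<Rightarrow> 'n \<Rightarrow> 'n \<Rightarrow> 'a::comm_ring_1)
  \<Rightarrow> 'a ^ 'n \<Rightarrow> 'a ^ 'n \<Rightarrow> 'a ^ 'n \<Rightarrow> 'a" where
  "tri_sum t u v w = (\<Sum>a\<in>UNIV. \<Sum>b\<in>UNIV. \<Sum>c\<in>UNIV. u $ a * v $ b * w $ c * t a b c)"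

lemma tri_sum_cong: "(\<And>a b c. t a b c = t' a b c) \<Longrightarrow> tri_sum t u v w = tri_sum t' u v w"
  by (simp add: tri_sum_def)

lemma tri_sum_transform1:
  "tri_sum (\<lambda>a b c. \<Sum>i\<in>UNIV. g $ a $ i * t i b c) u v w = tri_sum t (transpose g *v u) v w"
proof -
  define S where "S i = (\<Sum>b\<in>UNIV. \<Sum>c\<in>UNIV. v $ b * w $ c * t i b c)" for i
  have S: "(\<Sum>b\<in>UNIV. \<Sum>c\<in>UNIV. v $ b * w $ c * (\<Sum>i\<in>UNIV. g $ a $ i * t i b c))
    = (\<Sum>i\<in>UNIV. g $ a $ i * S i)" for a
  proof -
    have "(\<Sum>i\<in>UNIV. g $ a $ i * S i)
      = (\<Sum>i\<in>UNIV. \<Sum>b\<in>UNIV. \<Sum>c\<in>UNIV. v $ b * w $ c * (g $ a $ i * t i b c))"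
      by (simp add: S_def sum_distrib_left mult_ac)
    also have "\<dots> = (\<Sum>b\<in>UNIV. \<Sum>i\<in>UNIV. \<Sum>c\<in>UNIV. v $ b * w $ c * (g $ a $ i * t i b c))"
      by (rule sum.swap)
    also have "\<dots> = (\<Sum>b\<in>UNIV. \<Sum>c\<in>UNIV. \<Sum>i\<in>UNIV. v $ b * w $ c * (g $ a $ i * t i b c))"
      by (rule sum.cong[OF refl], rule sum.swap)
    finally show ?thesis by (simp add: sum_distrib_left)
  qed
  have "tri_sum (\<lambda>a b c. \<Sum>i\<in>UNIV. g $ a $ i * t i b c) u v w
    = (\<Sum>a\<in>UNIV. u $ a * (\<Sum>i\<in>UNIV. g $ a $ i * S i))"
    unfolding tri_sum_def S[symmetric] by (simp add: sum_distrib_left mult.assoc)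
  also have "\<dots> = (\<Sum>a\<in>UNIV. \<Sum>i\<in>UNIV. g $ a $ i * u $ a * S i)"
    by (simp add: sum_distrib_left mult_ac)
  also have "\<dots> = (\<Sum>i\<in>UNIV. \<Sum>a\<in>UNIV. g $ a $ i * u $ a * S i)"
    by (rule sum.swap)
  also have "\<dots> = (\<Sum>i\<in>UNIV. (transpose g *v u) $ i * S i)"
    unfolding matrix_vector_mult_def transpose_def by (simp add: sum_distrib_right)
  also have "\<dots> = tri_sum t (transpose g *v u) v w"
    unfolding tri_sum_def S_def sum_distrib_left mult.assoc ..
  finally show ?thesis .
qed

lemma tri_sum_swap12: "tri_sum t u v w = tri_sum (\<lambda>a b c. t b a c) v u w"
  unfolding tri_sum_def by (subst sum.swap) (simp add: mult_ac)

lemma tri_sum_swap23: "tri_sum t u v w = tri_sum (\<lambda>a b c. t a c b) u w v"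
  unfolding tri_sum_def by (rule sum.cong[OF refl], subst sum.swap) (simp add: mult_ac)

lemma tri_sum_transform2:
  "tri_sum (\<lambda>a b c. \<Sum>i\<in>UNIV. g $ b $ i * t a i c) u v w = tri_sum t u (transpose g *v v) w"
  using tri_sum_transform1[of g "\<lambda>a b c. t b a c" v u w]
  by (simp only: tri_sum_swap12[of _ u])

lemma tri_sum_transform3:
  "tri_sum (\<lambda>a b c. \<Sum>i\<in>UNIV. g $ c $ i * t a b i) u v w = tri_sum t u v (transpose g *v w)"
  using tri_sum_transform2[of g "\<lambda>a b c. t a c b" u w v]
  by (simp only: tri_sum_swap23[of _ u v])

text \<open>Acting by \<open>g\<close> on the coefficients is pulling the trilinear form back along
  the transpose of \<open>g\<close>, one slot after another.\<close>

lemma tri_sum_ext3_act: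
  "tri_sum (tri (ext3_act g x)) u v w =
     tri_sum (tri x) (transpose g *v u) (transpose g *v v) (transpose g *v w)"
proof -
  have "tri (ext3_act g x) a b c
    = (\<Sum>i\<in>UNIV. g $ a $ i * (\<Sum>j\<in>UNIV. g $ b $ j * (\<Sum>l\<in>UNIV. g $ c $ l * tri x i j l)))"
    for a b c unfolding tri_ext3_act by (simp add: sum_distrib_left mult_ac)
  then have "tri_sum (tri (ext3_act g x)) u v w = tri_sum (\<lambda>a b c. \<Sum>i\<in>UNIV. g $ a $ i *
      (\<lambda>i b c. (\<Sum>j\<in>UNIV. g $ b $ j * (\<lambda>i j c. \<Sum>l\<in>UNIV. g $ c $ l * tri x i j l) i j c)) i b c) u v w"
    by (intro tri_sum_cong) simp
  also have "\<dots> = tri_sum (tri x) (transpose g *v u) (transpose g *v v) (transpose g *v w)"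
    by (simp only: tri_sum_transform1 tri_sum_transform2 tri_sum_transform3)
  finally show ?thesis .
qed

lemma tri_sum_axis: "tri_sum t (axis i 1) (axis j 1) (axis l 1) = t i j l"
proof -
  have "axis i 1 $ a * axis j 1 $ b * axis l 1 $ c * t a b c =
    (if c = l then if b = j then if a = i then t i j l else 0 else 0 else 0)" for a b c
    by (simp add: axis_def)
  then show ?thesis unfolding tri_sum_def by simp
qed

lemma ext3_act_ext_power:
  "ext3_act g w \<in> ext_power 3"
proof -
  have 1: "(axis {a} (1::'a) \<and>\<^sub>e axis {b} 1 \<and>\<^sub>e axis {c} 1) $ S = 0"
    if "card S \<noteq> 3" for a b c :: 6 and S
    unfolding wedge3_axis using that by (auto simp: axis_def)
  have 2: "(ext_vec u \<and>\<^sub>e ext_vec v \<and>\<^sub>e ext_vec z) $ S = 0"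
    if "card S \<noteq> 3" for u v z :: "'a ^ 6" and S
    unfolding ext_vec_def wedge_sum_left wedge_sum_right wedge_scale_left wedge_scale_right
    by (simp add: 1[OF that])
  show ?thesis
    unfolding ext_power_def ext3_act_def linear_ext3_def
    using 2 by (auto simp: split_def intro!: sum.neutral)
qed

lemma card_3_sorted:
  fixes S :: "'n::linorder set"
  assumes "card S = 3"
  obtains a b c where "S = {a, b, c}" "a < b" "b < c"
proof -
  obtain x y z where S: "S = {x, y, z}" and ne: "x \<noteq> y" "y \<noteq> z" "x \<noteq> z"
    using assms by (auto simp: card_3_iff)
  then consider "x < y" "y < z" | "x < z" "z < y" | "y < x" "x < z" | "y < z" "z < x"
    | "z < x" "x < y" | "z < y" "y < x" by (metis linorder_neqE)
  then show thesis using S that by cases (metis insert_commute)+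
qed

lemma ext_power_3_eqI:
  assumes "u \<in> ext_power 3" "w \<in> ext_power 3" and "\<And>a b c. a < b \<Longrightarrow> b < c
    \<Longrightarrow> tri u a b c = tri w a b c"
  shows "u = w"
proof -
  have "u $ S = w $ S" for S
  proof (cases "card S = 3")
    case True
    then obtain a b c where "S = {a, b, c}" "a < b" "b < c" by (rule card_3_sorted)
    with assms(3) show ?thesis by (metis tri_sorted)
  next
    case False
    then have "u $ S = 0" "w $ S = 0" using assms(1,2) by (auto simp: ext_power_def)
    then show ?thesis by simp
  qed
  then show ?thesis by (simp add: vec_eq_iff)
qed

text \<open>Compared as trilinear forms, both sides are pullbacks along transposes, and
  transposition reverses products. This replaces an expansion of the minors of a matrix
  product.\<close>

lemma ext3_act_compose: "ext3_act g (ext3_act h w) = ext3_act (g ** h) w"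
proof (rule ext_power_3_eqI[OF ext3_act_ext_power ext3_act_ext_power])
  fix a b c :: 6
  have "tri_sum (tri (ext3_act g (ext3_act h w))) u v z = tri_sum (tri (ext3_act (g ** h) w)) u v z" for u v z
    by (simp only: tri_sum_ext3_act matrix_transpose_mul matrix_vector_mul_assoc)
  from this[of "axis a 1" "axis b 1" "axis c 1"]
  show "tri (ext3_act g (ext3_act h w)) a b c = tri (ext3_act (g ** h) w) a b c"
    by (simp only: tri_sum_axis)
qed

lemma ext3_act_one:
  assumes "w \<in> ext_power 3"
  shows "ext3_act (mat 1) w = w"
proof (rule ext_power_3_eqI[OF ext3_act_ext_power assms])
  fix a b c :: 6
  have "tri_sum (tri (ext3_act (mat 1) w)) u v z = tri_sum (tri w) u v z" for u v z
    by (simp only: tri_sum_ext3_act transpose_mat matrix_vector_mul_lid)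
  from this[of "axis a 1" "axis b 1" "axis c 1"]
  show "tri (ext3_act (mat 1) w) a b c = tri w a b c"
    by (simp only: tri_sum_axis)
qed

lemma rep_act_compose: "rep_act g (rep_act h y) = rep_act (g ** h) y"
  by (cases y) (simp add: rep_act_def ext3_act_compose matrix_vector_mul_assoc)

lemma rep_act_one: "fst y \<in> ext_power 3 \<Longrightarrow> rep_act (mat 1) y = y"
  by (cases y) (simp add: rep_act_def ext3_act_one)

section \<open>The symplectic group and the form J\<close>

lemma MJ_MJ: "MJ ** MJ = - mat 1" "MJ *v (MJ *v v) = - v"
  by (simp_all add: vec_eq_iff forall_6 matrix_matrix_mult_def MJ_entry sum_6 axis_def mat_def)

text \<open>The defining equation of \<open>Sp6\<close> puts the transpose on the right, while
  invariance of J on column vectors needs it on the left. As \<open>MJ\<close> has inverse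
  \<open>- MJ\<close>, either equation exhibits a one-sided inverse of \<open>g\<close>, which for
  square matrices is two-sided.\<close>

lemma Sp6_transpose:
  fixes g :: "'a::field ^ 6 ^ 6"
  shows "g \<in> Sp6 \<longleftrightarrow> transpose g ** MJ ** g = MJ"
proof
  have neg: "(- A) ** C = - (A ** C)" "A ** (- C) = - (A ** C)" for A C :: "'a ^ 6 ^ 6"
    by (simp_all add: vec_eq_iff matrix_matrix_mult_def sum_negf)
  have swap: "transpose h ** MJ ** h = MJ" if h: "h ** MJ ** transpose h = MJ" for h :: "'a ^ 6 ^ 6"
  proof -
    have "h ** (- (MJ ** transpose h ** MJ)) = - (h ** MJ ** transpose h ** MJ)"
      by (simp only: neg matrix_mul_assoc)
    also have "\<dots> = mat 1" by (simp only: h MJ_MJ minus_minus)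
    finally have "- (MJ ** transpose h ** MJ) ** h = mat 1"
      using matrix_left_right_inverse by blast
    then have "MJ ** (- (MJ ** transpose h ** MJ) ** h) = MJ ** mat 1" by simp
    then have "- (MJ ** MJ ** transpose h ** MJ ** h) = MJ"
      by (simp only: neg matrix_mul_assoc matrix_mul_rid)
    then show ?thesis by (simp only: MJ_MJ neg minus_minus matrix_mul_lid)
  qed
  show "transpose g ** MJ ** g = MJ" if "g \<in> Sp6"
    using swap that by (simp add: Sp6_def)
  show "g \<in> Sp6" if h: "transpose g ** MJ ** g = MJ"
  proof -
    have "(- (MJ ** transpose g ** MJ)) ** g = - (MJ ** (transpose g ** MJ ** g))"
      by (simp only: neg matrix_mul_assoc)
    also have "\<dots> = mat 1" by (simp only: h MJ_MJ minus_minus)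
    finally have "invertible g" unfolding invertible_left_inverse by blast
    moreover have "g ** MJ ** transpose g = MJ" using swap[of "transpose g"] h by simp
    ultimately show ?thesis by (simp add: Sp6_def)
  qed
qed

lemma form_J_add: "form_J (u + v) w = form_J u w + form_J v w" "form_J w (u + v) = form_J w u + form_J w v"
  by (simp_all add: form_J_6 algebra_simps)

lemma form_J_diff: "form_J (u - v) w = form_J u w - form_J v w" "form_J w (u - v) = form_J w u - form_J w v"
  by (simp_all add: form_J_6 algebra_simps)

lemma form_J_scale: "form_J (c *s u) w = c * form_J u w" "form_J w (c *s u) = c * form_J w u"
  by (simp_all add: form_J_6 algebra_simps)

lemma form_J_zero [simp]: "form_J 0 w = 0" "form_J w 0 = 0"
  by (simp_all add: form_J_6)

lemma form_J_swap: "form_J u v = - form_J v u"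
  by (simp add: form_J_6 algebra_simps)

lemma form_J_self [simp]: "form_J u u = 0"
  by (simp add: form_J_6 algebra_simps)

lemma form_J_axis:
  "form_J u (axis 0 1) = - u $ 3" "form_J u (axis 1 1) = - u $ 4" "form_J u (axis 2 1) = - u $ 5"
  "form_J u (axis 3 1) = u $ 0" "form_J u (axis 4 1) = u $ 1" "form_J u (axis 5 1) = u $ 2"
  by (simp_all add: form_J_6 axis_def)

lemma form_J_nondegenerate:
  assumes "\<And>w. form_J u w = 0"
  shows "u = 0"
  using assms[of "axis 0 1"] assms[of "axis 1 1"] assms[of "axis 2 1"] assms[of "axis 3 1"]
    assms[of "axis 4 1"] assms[of "axis 5 1"]
  by (simp add: form_J_axis vec_eq_iff forall_6)

lemma form_J_matrix: "form_J (g *v u) (h *v v) = scalar_product u ((transpose g ** MJ ** h) *v v)"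
proof -
  have "scalar_product (g *v u) w = scalar_product u (transpose g *v w)" for w :: "'a ^ 6"
    unfolding scalar_product_def matrix_vector_mult_def transpose_def
    by (simp add: sum_distrib_left sum_distrib_right mult_ac) (rule sum.swap)
  then show ?thesis by (simp only: form_J_def matrix_vector_mul_assoc matrix_mul_assoc)
qed

lemma form_J_Sp6: "g \<in> Sp6 \<Longrightarrow> form_J (g *v u) (g *v v) = form_J u (v :: 'a::field ^ 6)"
  unfolding form_J_matrix Sp6_transpose by (simp add: form_J_def)

lemma form_J_contr: "form_J (contr x u *v w) v = tri_sum (tri x) (MJ *v u) (MJ *v v) (MJ *v w)"
proof -
  have "form_J (contr x u *v w) v = (\<Sum>i\<in>UNIV. \<Sum>j\<in>UNIV. \<Sum>a\<in>UNIV.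
      (MJ *v u) $ a * (MJ *v v) $ i * (MJ *v w) $ j * tri x a i j)"
    unfolding form_J_def scalar_product_def contr_mult by (simp add: sum_distrib_left sum_distrib_right mult_ac)
  also have "\<dots> = tri_sum (tri x) (MJ *v u) (MJ *v v) (MJ *v w)"
    unfolding tri_sum_def
    by (subst (2) sum.swap, subst sum.swap) (rule refl)
  finally show ?thesis .
qed

lemma contr_alternating:
  "form_J (contr x v *v w) u = - form_J (contr x u *v w) v"
  "form_J (contr x u *v v) w = - form_J (contr x u *v w) v"
proof -
  have neg: "tri_sum (\<lambda>a b c. - t a b c) u v w = - tri_sum t u v w" for t :: "6 \<Rightarrow> 6
    \<Rightarrow> 6 \<Rightarrow> 'a" and u v w
    by (simp add: tri_sum_def sum_negf)
  show "form_J (contr x v *v w) u = - form_J (contr x u *v w) v"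
    unfolding form_J_contr tri_sum_swap12[of "tri x" "MJ *v v"] neg[symmetric]
    by (intro tri_sum_cong) (rule tri_swap12)
  show "form_J (contr x u *v v) w = - form_J (contr x u *v w) v"
    unfolding form_J_contr tri_sum_swap23[of "tri x" "MJ *v u" "MJ *v w"] neg[symmetric]
    by (intro tri_sum_cong) (rule tri_swap23)
qed

lemma contr_linear_left:
  "contr x (u + v) = contr x u + contr x v" "contr x (c *s u) *v w = c *s (contr x u *v w)"
  by (simp_all add: vec_eq_iff forall_6 contr_column contr_mult sum_6 algebra_simps)

lemma contr_swap: "contr x u *v w = - (contr x w *v u)"
proof -
  have "form_J (contr x u *v w + contr x w *v u) v = 0" for v
    by (simp only: form_J_add contr_alternating(2)[of x w u v] contr_alternating(1)[of x w v u]
      contr_alternating(2)[of x u v w]) simp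
  then have "contr x u *v w + contr x w *v u = 0" by (rule form_J_nondegenerate)
  then show ?thesis by (simp add: eq_neg_iff_add_eq_0)
qed

lemma contr_self [simp]:
  fixes u :: "'a::field ^ 6"
  assumes two: "(2::'a) \<noteq> 0"
  shows "contr x u *v u = 0"
proof -
  have "2 *s (contr x u *v u) = 0" using contr_swap[of x u u] by (simp add: vec_eq_iff)
  with two show ?thesis by (simp add: vec_eq_iff)
qed

text \<open>Because \<open>g\<close> is symplectic, its transpose takes the covector of g z back to
  the covector of z. The two vectors are compared by pairing them with all g v, which suffices since
  \<open>g\<close> is onto and J is nondegenerate.\<close>

lemma contr_ext3_act:
  fixes g :: "'a::field ^ 6 ^ 6"
  assumes "g \<in> Sp6"
  shows "contr (ext3_act g x) (g *v u) *v (g *v w) = g *v (contr x u *v w)"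
proof -
  have t: "transpose g *v (MJ *v (g *v z)) = MJ *v z" for z
    using assms unfolding Sp6_transpose by (metis matrix_vector_mul_assoc)
  have "form_J (contr (ext3_act g x) (g *v u) *v (g *v w)) (g *v v) = form_J (g *v (contr x u *v w)) (g *v v)" for v
    unfolding form_J_Sp6[OF assms] form_J_contr tri_sum_ext3_act t ..
  moreover have "surj ((*v) g)"
    using assms by (metis (no_types, lifting) Sp6_def invertible_def matrix_right_invertible_surjective mem_Collect_eq)
  ultimately have "form_J (contr (ext3_act g x) (g *v u) *v (g *v w) - g *v (contr x u *v w)) v = 0" for v
    by (metis (no_types, lifting) form_J_diff(1) right_minus_eq surjD)
  then show ?thesis using form_J_nondegenerate by (metis right_minus_eq)
qed

section \<open>Quaternions and the derivative of a morphism\<close>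

lemma vector_4 [simp]:
  "(vector [x, y, z, w] :: 'a::zero ^ 4) $ 1 = x" "(vector [x, y, z, w] :: 'a::zero ^ 4) $ 2 = y"
  "(vector [x, y, z, w] :: 'a::zero ^ 4) $ 3 = z" "(vector [x, y, z, w] :: 'a::zero ^ 4) $ 4 = w"
  unfolding vector_def by auto

lemma vec_eq_4: "x = y
  \<longleftrightarrow> x $ 1 = y $ 1 \<and> x $ 2 = y $ 2 \<and> x $ 3 = y $ 3 \<and> x $ (4::4) = y $ 4"
  by (simp add: vec_eq_iff forall_4)

lemma quat_mult_nth [simp]:
  "quat_mult c d x y $ 1 = x$1 * y$1 + c * x$2 * y$2 + d * x$3 * y$3 - c * d * x$4 * y$4"
  "quat_mult c d x y $ 2 = x$1 * y$2 + x$2 * y$1 - d * x$3 * y$4 + d * x$4 * y$3"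
  "quat_mult c d x y $ 3 = x$1 * y$3 + x$3 * y$1 + c * x$2 * y$4 - c * x$4 * y$2"
  "quat_mult c d x y $ 4 = x$1 * y$4 + x$4 * y$1 + x$2 * y$3 - x$3 * y$2"
  by (simp_all only: quat_mult_def vector_4)

definition quat_one :: "'a::comm_ring_1 ^ 4" where "quat_one = vector [1, 0, 0, 0]"

definition quat_conj :: "'a::comm_ring_1 ^ 4 \<Rightarrow> 'a ^ 4" where
  "quat_conj x = vector [x$1, - x$2, - x$3, - x$4]"

lemma quat_one_nth [simp]:
  "quat_one $ 1 = 1" "quat_one $ 2 = 0" "quat_one $ 3 = 0" "quat_one $ 4 = 0"
  by (simp_all add: quat_one_def)

lemma quat_conj_nth [simp]:
  "quat_conj x $ 1 = x $ 1" "quat_conj x $ 2 = - x $ 2" "quat_conj x $ 3 = - x $ 3" "quat_conj x $ 4 = - x $ 4"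
  by (simp_all add: quat_conj_def)

lemma quat_mult_assoc: "quat_mult c d (quat_mult c d x y) z = quat_mult c d x (quat_mult c d y z)"
  by (simp add: vec_eq_4 algebra_simps)

lemma quat_mult_one [simp]: "quat_mult c d quat_one x = x" "quat_mult c d x quat_one = x"
  by (simp_all add: vec_eq_4)

lemma quat_norm_mult: "quat_norm c d (quat_mult c d x y) = quat_norm c d x * quat_norm c d y"
  by (simp add: quat_norm_def power2_eq_square algebra_simps)

lemma quat_norm_conj [simp]: "quat_norm c d (quat_conj x) = quat_norm c d x"
  by (simp add: quat_norm_def)

lemma quat_norm_one [simp]: "quat_norm c d quat_one = 1"
  by (simp add: quat_norm_def)

lemma quat_mult_conj:
  "quat_mult c d x (quat_conj x) = quat_norm c d x *s quat_one"
  "quat_mult c d (quat_conj x) x = quat_norm c d x *s quat_one"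
  by (simp_all add: vec_eq_4 quat_norm_def power2_eq_square algebra_simps)

lemma quat_mult_linear:
  "quat_mult c d (x + y) z = quat_mult c d x z + quat_mult c d y z"
  "quat_mult c d z (x + y) = quat_mult c d z x + quat_mult c d z y"
  "quat_mult c d (a *s x) z = a *s quat_mult c d x z"
  "quat_mult c d z (a *s x) = a *s quat_mult c d z x"
  by (simp_all add: vec_eq_4 algebra_simps)

definition quat_bracket :: "'a::comm_ring_1 \<Rightarrow> 'a \<Rightarrow> 'a ^ 4 \<Rightarrow> 'a ^ 4
  \<Rightarrow> 'a ^ 4" where
  "quat_bracket c d x y = quat_mult c d x y - quat_mult c d y x"

lemma quat_bracket_linear:
  "quat_bracket c d (x + y) z = quat_bracket c d x z + quat_bracket c d y z"
  "quat_bracket c d (a *s x) z = a *s quat_bracket c d x z"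
  by (simp_all add: quat_bracket_def vec_eq_4 algebra_simps)

text \<open>For pure x the bracket [x, y] anticommutes with x, since x^2 is a scalar. On such
  elements, bracketing with x is left multiplication by 2x, and (2x)^2 = -4 N(x).\<close>

lemma quat_bracket_triple:
  assumes "x $ 1 = 0" "y $ 1 = 0"
  shows "quat_bracket c d x (quat_bracket c d x (quat_bracket c d x y)) =
    (- 4 * quat_norm c d x) *s quat_bracket c d x y"
  using assms by (simp add: quat_bracket_def vec_eq_4 quat_norm_def power2_eq_square algebra_simps)

lemma quat_bracket_pure: "quat_bracket c d x y $ 1 = 0"
  by (simp add: quat_bracket_def algebra_simps)

text \<open>A pure x that commutes with both i and j is zero. The test element is j if x is a
  multiple of i, and i otherwise.\<close>

lemma quat_bracket_nonzero:
  fixes x :: "'a::field ^ 4"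
  assumes "x $ 1 = 0" "x \<noteq> 0" and "c \<noteq> 0" "d \<noteq> 0" "(2::'a) \<noteq> 0"
  obtains y where "y $ 1 = 0" "quat_bracket c d x y \<noteq> 0"
proof (cases "x $ 3 = 0 \<and> x $ 4 = 0")
  case True
  with assms have "x $ 2 \<noteq> 0" by (auto simp: vec_eq_4)
  then have "quat_bracket c d x (axis 3 1) $ 4 \<noteq> 0" using assms True by (simp add: quat_bracket_def axis_def)
  then show ?thesis by (intro that[of "axis 3 1"]) (auto simp: axis_def)
next
  case False
  have "quat_bracket c d x (axis 2 1) $ 3 = - 2 * c * x $ 4" "quat_bracket c d x (axis 2 1) $ 4 = - 2 * x $ 3"
    by (simp_all add: quat_bracket_def axis_def algebra_simps)
  then have "quat_bracket c d x (axis 2 1) $ 3 \<noteq> 0 \<or> quat_bracket c d x (axis 2 1) $ 4 \<noteq> 0"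
    using assms False by auto
  then show ?thesis by (intro that[of "axis 2 1"]) (auto simp: axis_def)
qed

section \<open>Nilpotent quaternions and differentiation along polynomial curves\<close>

lemma alg_closure_infinite: "infinite (UNIV :: 'a::alg_closed_field set)"
proof
  assume fin: "finite (UNIV :: 'a set)"
  define p :: "'a poly" where "p = (\<Prod>a\<in>UNIV. [:- a, 1:]) + 1"
  have dp: "degree (\<Prod>a\<in>UNIV. [:- a, 1:] :: 'a poly) = card (UNIV :: 'a set)"
    by (subst degree_prod_eq_sum_degree) auto
  have "card (UNIV :: 'a set) > 0" using fin by (simp add: card_gt_0_iff)
  then have "degree p > 0" unfolding p_def by (subst degree_add_eq_left) (simp_all add: dp)
  then obtain x where "poly p x = 0" using alg_closed_imp_poly_has_root by blast
  moreover have "poly (\<Prod>a\<in>UNIV. [:- a, 1:]) x = 0"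
    using fin by (simp add: poly_prod)
  ultimately show False by (simp add: p_def)
qed

lemma poly_eq_infinite:
  fixes p q :: "'a::alg_closed_field poly"
  assumes "\<And>t. poly p t = poly q t"
  shows "p = q"
proof (rule ccontr)
  assume "p \<noteq> q"
  then have "finite {t. poly (p - q) t = 0}" by (intro poly_roots_finite) simp
  moreover have "{t. poly (p - q) t = 0} = UNIV" using assms by simp
  ultimately show False using alg_closure_infinite by metis
qed

text \<open>With r^2 = c and s^2 = d, the elements r j + ij, r j - ij, s i + ij, s i - ij have norm
  zero and span the pure quaternions. The fact is stated as an induction rule for properties stable
  under linear combinations.\<close>

lemma pure_quaternion_induct:
  fixes z :: "'a::alg_closed_field ^ 4"
  assumes "z $ 1 = 0" and cd: "c \<noteq> 0" "d \<noteq> 0" "(2::'a) \<noteq> 0"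
    and nilpotent: "\<And>n. n $ 1 = 0 \<Longrightarrow> quat_norm c d n = 0 \<Longrightarrow> P n"
    and add: "\<And>x y. x $ 1 = 0 \<Longrightarrow> y $ 1 = 0 \<Longrightarrow> P x \<Longrightarrow> P y
      \<Longrightarrow> P (x + y)"
    and scale: "\<And>a x. x $ 1 = 0 \<Longrightarrow> P x \<Longrightarrow> P (a *s x)"
  shows "P z"
proof -
  obtain r where r: "r^2 = c" using nth_root_exists[of 2 c] by auto
  obtain s where s: "s^2 = d" using nth_root_exists[of 2 d] by auto
  have rs: "r \<noteq> 0" "s \<noteq> 0" using r s cd by auto
  let ?n1 = "vector [0, 0, r, 1] :: 'a ^ 4" and ?n2 = "vector [0, 0, r, - 1] :: 'a ^ 4"
  let ?n3 = "vector [0, s, 0, 1] :: 'a ^ 4" and ?n4 = "vector [0, s, 0, - 1] :: 'a ^ 4"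
  have P: "P ?n1" "P ?n2" "P ?n3" "P ?n4"
    by (intro nilpotent; simp add: quat_norm_def r s)+
  have four: "(4::'a) \<noteq> 0" using cd(3) mult_eq_0_iff[of "2::'a" 2] by simp
  define y1 where "y1 = (z$3 / (2 * r) + z$4 / 2) *s ?n1"
  define y2 where "y2 = (z$3 / (2 * r) - z$4 / 2) *s ?n2"
  define y3 where "y3 = (z$2 / (2 * s)) *s ?n3"
  define y4 where "y4 = (z$2 / (2 * s)) *s ?n4"
  note y = y1_def y2_def y3_def y4_def
  have "P (y1 + y2 + y3 + y4)"
    by (intro add) (use P in \<open>auto simp: y intro!: scale\<close>)
  also have "y1 + y2 + y3 + y4 = z"
    using rs cd four assms(1) by (simp add: vec_eq_4 y field_simps)
  finally show ?thesis .
qed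

text \<open>A vector of polynomials is a parametrized curve. Values and coefficients are kept apart,
  as the coefficient of t serves as the velocity at 0.\<close>

definition poly_vec_eval :: "'a::comm_ring_1 poly ^ 'n \<Rightarrow> 'a \<Rightarrow> 'a ^ 'n" where
  "poly_vec_eval x t = (\<chi> i. poly (x $ i) t)"

definition poly_vec_coeff :: "'a::comm_ring_1 poly ^ 'n \<Rightarrow> nat \<Rightarrow> 'a ^ 'n" where
  "poly_vec_coeff x k = (\<chi> i. coeff (x $ i) k)"

lemma poly_vec_eval_nth [simp]: "poly_vec_eval x t $ i = poly (x $ i) t"
  by (simp add: poly_vec_eval_def)

lemma poly_vec_coeff_nth [simp]: "poly_vec_coeff x k $ i = coeff (x $ i) k"
  by (simp add: poly_vec_coeff_def)

lemma poly_vec_eq: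
  fixes x y :: "'a::alg_closed_field poly ^ 'n"
  assumes "\<And>t. poly_vec_eval x t = poly_vec_eval y t"
  shows "x = y"
proof -
  have "x $ i = y $ i" for i
    using assms by (intro poly_eq_infinite) (metis poly_vec_eval_nth)
  then show ?thesis by (simp add: vec_eq_iff)
qed

lemma poly_vec_eval_0: "poly_vec_eval x 0 = poly_vec_coeff x 0"
  by (simp add: vec_eq_iff poly_0_coeff_0)

lemma poly_vec_eval_quat_mult:
  "poly_vec_eval (quat_mult [:c:] [:d:] x y) t = quat_mult c d (poly_vec_eval x t) (poly_vec_eval y t)"
  by (simp add: vec_eq_4)

lemma coeff_mult_1: "coeff (p * q) (Suc 0) = coeff p 0 * coeff q (Suc 0) + coeff p (Suc 0) * coeff q 0"
  by (simp add: coeff_mult)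

lemma poly_vec_coeff_quat_mult:
  "poly_vec_coeff (quat_mult [:c:] [:d:] x y) 1 =
    quat_mult c d (poly_vec_coeff x 0) (poly_vec_coeff y 1) + quat_mult c d (poly_vec_coeff x 1) (poly_vec_coeff y 0)"
  by (simp add: vec_eq_4 coeff_mult_1 algebra_simps)

text \<open>A gradient expressed by the chain rule along polynomial curves through 1, with entries
  in k although the curves live over the closure. \<open>P\<close> is the restriction of
  \<open>p\<close> to the curve, as a polynomial in the parameter.\<close>

definition has_gradient_at_one ::
    "('a::field alg_closure ^ 4 \<Rightarrow> 'a alg_closure) \<Rightarrow> 'a ^ 4 \<Rightarrow> bool" where
  "has_gradient_at_one p a \<longleftrightarrow> (\<forall>x. poly_vec_eval x 0 = quat_one \<longrightarrow>
    (\<exists>P. (\<forall>t. p (poly_vec_eval x t) = poly P t) \<and>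
      coeff P 1 = (\<Sum>i\<in>UNIV. to_ac (a $ i) * poly_vec_coeff x 1 $ i)))"

text \<open>The value at 1 enters the product rule, so its lying in k is carried through the
  induction together with the gradient.\<close>

lemma k_polynomial_gradient:
  assumes "k_polynomial vector_coords p"
  shows "(\<exists>b. p quat_one = to_ac b) \<and> (\<exists>a. has_gradient_at_one p a)"
  using assms
proof (induction rule: k_polynomial.induct)
  case (const c)
  show ?case unfolding has_gradient_at_one_def
    by (auto intro!: exI[of _ 0] exI[of _ "[:to_ac c:]"])
next
  case (coord q)
  then obtain i where q: "q = (\<lambda>v. v $ i)" by (auto simp: vector_coords_def)
  have "\<exists>b. quat_one $ i = to_ac b"
    using exhaust_4[of i] by (auto intro: exI[of _ 0] exI[of _ 1])
  moreover have sum: "(\<Sum>j\<in>UNIV. to_ac ((axis i 1 :: 'a ^ 4) $ j) * y $ j) = y $ i" for y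
    by (simp add: axis_def if_distrib[of to_ac] if_distribR cong: if_cong)
      (simp add: if_distrib if_distribR cong: if_cong)
  have "has_gradient_at_one (\<lambda>v. v $ i) (axis i 1 :: 'a ^ 4)"
    unfolding has_gradient_at_one_def sum by (auto intro: exI[of _ "_ $ i"])
  ultimately show ?case unfolding q by blast
next
  case (add q r)
  then obtain b b' a a' where b: "q quat_one = to_ac b" "r quat_one = to_ac b'"
    and a: "has_gradient_at_one q a" "has_gradient_at_one r a'" by blast
  have "has_gradient_at_one (\<lambda>x. q x + r x) (a + a')"
    unfolding has_gradient_at_one_def
  proof (intro allI impI)
    fix x :: "'a alg_closure poly ^ 4" assume "poly_vec_eval x 0 = quat_one"
    with a obtain P P' where
      "\<forall>t. q (poly_vec_eval x t) = poly P t" "coeff P 1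
        = (\<Sum>i\<in>UNIV. to_ac (a $ i) * poly_vec_coeff x 1 $ i)"
      "\<forall>t. r (poly_vec_eval x t) = poly P' t" "coeff P' 1
        = (\<Sum>i\<in>UNIV. to_ac (a' $ i) * poly_vec_coeff x 1 $ i)"
      unfolding has_gradient_at_one_def by blast
    then show "\<exists>P. (\<forall>t. q (poly_vec_eval x t) + r (poly_vec_eval x t) = poly P t) \<and>
      coeff P 1 = (\<Sum>i\<in>UNIV. to_ac ((a + a') $ i) * poly_vec_coeff x 1 $ i)"
      by (intro exI[of _ "P + P'"]) (simp add: distrib_right sum.distrib)
  qed
  moreover have "q quat_one + r quat_one = to_ac (b + b')" using b by simp
  ultimately show ?case by blast
next
  case (mult q r)
  then obtain b b' a a' where b: "q quat_one = to_ac b" "r quat_one = to_ac b'"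
    and a: "has_gradient_at_one q a" "has_gradient_at_one r a'" by blast
  have "has_gradient_at_one (\<lambda>x. q x * r x) (b *s a' + b' *s a)"
    unfolding has_gradient_at_one_def
  proof (intro allI impI)
    fix x :: "'a alg_closure poly ^ 4" assume x: "poly_vec_eval x 0 = quat_one"
    with a obtain P P' where
      P: "\<forall>t. q (poly_vec_eval x t) = poly P t" "coeff P 1
        = (\<Sum>i\<in>UNIV. to_ac (a $ i) * poly_vec_coeff x 1 $ i)"
      "\<forall>t. r (poly_vec_eval x t) = poly P' t" "coeff P' 1
        = (\<Sum>i\<in>UNIV. to_ac (a' $ i) * poly_vec_coeff x 1 $ i)"
      unfolding has_gradient_at_one_def by blast
    have "poly P 0 = to_ac b" "poly P' 0 = to_ac b'" using P b x by metis+
    then have "coeff P 0 = to_ac b" "coeff P' 0 = to_ac b'" by (simp_all add: poly_0_coeff_0)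
    then have "coeff (P * P') 1 = to_ac b * coeff P' 1 + to_ac b' * coeff P 1"
      by (simp add: coeff_mult_1)
    also have "\<dots> = (\<Sum>i\<in>UNIV. to_ac ((b *s a' + b' *s a) $ i) * poly_vec_coeff x 1 $ i)"
      by (simp only: P(2,4)) (simp add: sum_distrib_left distrib_left distrib_right sum.distrib mult_ac)
    finally show "\<exists>P. (\<forall>t. q (poly_vec_eval x t) * r (poly_vec_eval x t) = poly P t) \<and>
      coeff P 1 = (\<Sum>i\<in>UNIV. to_ac ((b *s a' + b' *s a) $ i) * poly_vec_coeff x 1 $ i)"
      using P(1,3) by (intro exI[of _ "P * P'"]) simp
  qed
  moreover have "q quat_one * r quat_one = to_ac (b * b')" using b by simp
  ultimately show ?case by blast
qed

lemma quat_mult_diff: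
  "quat_mult c d (x - y) z = quat_mult c d x z - quat_mult c d y z"
  "quat_mult c d z (x - y) = quat_mult c d z x - quat_mult c d z y"
  by (simp_all add: vec_eq_4 algebra_simps)

definition ac_matrix :: "'a::field ^ 'n ^ 'm \<Rightarrow> 'a alg_closure ^ 'n ^ 'm" where
  "ac_matrix A = (\<chi> i j. to_ac (A $ i $ j))"

definition line_at_one :: "'a::comm_ring_1 ^ 4 \<Rightarrow> 'a poly ^ 4" where
  "line_at_one n = (\<chi> i. [:quat_one $ i, n $ i:])"

lemma line_at_one_eval: "poly_vec_eval (line_at_one n) t = quat_one + t *s n"
  by (simp add: vec_eq_iff line_at_one_def)

lemma line_at_one_coeff [simp]:
  "poly_vec_coeff (line_at_one n) 0 = quat_one" "poly_vec_coeff (line_at_one n) (Suc 0) = n"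
  by (simp_all add: vec_eq_iff line_at_one_def)

lemma line_in_SL1:
  assumes "n $ 1 = 0" "quat_norm c d n = 0"
  shows "quat_one + t *s n \<in> SL1 c d"
proof -
  have "quat_norm c d (quat_one + t *s n) = 1 + t^2 * quat_norm c d n"
    using assms(1) by (simp add: quat_norm_def power_mult_distrib algebra_simps)
  with assms(2) show ?thesis by (simp add: SL1_def)
qed

text \<open>Only curves inside \<open>G\<close> are tested, since a morphism is given by polynomials
  only there. The matrix is thus constrained on the velocities of such curves; nothing is claimed
  about other directions.\<close>

definition differential_at_one ::
    "('a::field alg_closure ^ 4) set \<Rightarrow> ('a alg_closure ^ 4 \<Rightarrow> 'a alg_closure ^ 4)
      \<Rightarrow> 'a ^ 4 ^ 4 \<Rightarrow> bool" where
  "differential_at_one G F A \<longleftrightarrow>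
    (\<forall>x. poly_vec_eval x 0 = quat_one \<longrightarrow> (\<forall>t. poly_vec_eval x t \<in> G) \<longrightarrow>
      (\<exists>y. (\<forall>t. F (poly_vec_eval x t) = poly_vec_eval y t) \<and>
        poly_vec_coeff y 1 = ac_matrix A *v poly_vec_coeff x 1))"

lemma k_morphism_differential:
  fixes F :: "'a::field alg_closure ^ 4 \<Rightarrow> 'a alg_closure ^ 4"
  assumes "k_morphism vector_coords G vector_coords H F"
  obtains A where "differential_at_one G F A"
proof -
  have "\<exists>p. k_polynomial vector_coords p \<and> (\<forall>g\<in>G. F g $ i = p g)" for i
    using assms by (fastforce simp: k_morphism_def vector_coords_def)
  then obtain p where p: "\<And>i. k_polynomial vector_coords (p i)" "\<And>i g. g \<in> G
    \<Longrightarrow> F g $ i = p i g"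
    by metis
  have "\<forall>i. \<exists>a. has_gradient_at_one (p i) a" using k_polynomial_gradient[OF p(1)] by blast
  then obtain a where a: "\<And>i. has_gradient_at_one (p i) (a i)" by metis
  have "differential_at_one G F (\<chi> i. a i)"
    unfolding differential_at_one_def
  proof (intro allI impI)
    fix x :: "'a alg_closure poly ^ 4"
    assume x: "poly_vec_eval x 0 = quat_one" "\<forall>t. poly_vec_eval x t \<in> G"
    from a x(1) have "\<forall>i. \<exists>P. (\<forall>t. p i (poly_vec_eval x t) = poly P t) \<and>
      coeff P 1 = (\<Sum>j\<in>UNIV. to_ac (a i $ j) * poly_vec_coeff x 1 $ j)"
      unfolding has_gradient_at_one_def by blast
    then obtain P where P: "\<And>i t. p i (poly_vec_eval x t) = poly (P i) t"
      "\<And>i. coeff (P i) 1 = (\<Sum>j\<in>UNIV. to_ac (a i $ j) * poly_vec_coeff x 1 $ j)"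
      by metis
    show "\<exists>y. (\<forall>t. F (poly_vec_eval x t) = poly_vec_eval y t) \<and>
        poly_vec_coeff y 1 = ac_matrix (\<chi> i. a i) *v poly_vec_coeff x 1"
    proof (intro exI[of _ "\<chi> i. P i"] conjI allI)
      show "F (poly_vec_eval x t) = poly_vec_eval (\<chi> i. P i) t" for t
        using x(2) by (simp add: vec_eq_iff p(2) P(1))
      show "poly_vec_coeff (\<chi> i. P i) 1 = ac_matrix (\<chi> i. a i) *v poly_vec_coeff x 1"
        using P(2) by (simp add: vec_eq_iff ac_matrix_def matrix_vector_mult_def)
    qed
  qed
  then show thesis by (rule that)
qed

text \<open>Along 1 + t n with n nilpotent the image has constant norm 1, so its velocity has no
  scalar part. Moreover F turns conjugation by g into conjugation by F g; differentiating this in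
  the conjugated element, and once more with g = 1 + t n, gives the commutators.\<close>

lemma SL1_homomorphism_differential:
  fixes F :: "'a::field alg_closure ^ 4 \<Rightarrow> 'a alg_closure ^ 4"
  assumes mor: "k_morphism vector_coords (SL1 c d) vector_coords (SL1 c' d') F"
    and hom: "\<And>g h. g \<in> SL1 c d \<Longrightarrow> h \<in> SL1 c d
      \<Longrightarrow> F (quat_mult c d g h) = quat_mult c' d' (F g) (F h)"
    and cd: "c \<noteq> 0" "d \<noteq> 0" and two: "(2::'a alg_closure) \<noteq> 0"
  obtains A :: "'a ^ 4 ^ 4" where "differential_at_one (SL1 c d) F A" "F quat_one = quat_one"
    "\<And>z. z $ 1 = 0 \<Longrightarrow> (ac_matrix A *v z) $ 1 = 0"
    "\<And>x y. x $ 1 = 0 \<Longrightarrow> y $ 1 = 0 \<Longrightarrow> ac_matrix A *v quat_bracket c d x y =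
       quat_bracket c' d' (ac_matrix A *v x) (ac_matrix A *v y)"
proof -
  from k_morphism_differential[OF mor] obtain A :: "'a ^ 4 ^ 4" where
    A: "differential_at_one (SL1 c d) F A" by blast
  let ?m = "quat_mult c d" and ?m' = "quat_mult c' d'"
  define D where "D z = ac_matrix A *v z" for z
  have D_add: "D (x + y) = D x + D y" for x y by (simp add: D_def matrix_vector_right_distrib)
  have D_diff: "D (x - y) = D x - D y" for x y by (simp add: D_def matrix_vector_mult_diff_distrib)
  have D_scale: "D (a *s x) = a *s D x" for a x by (simp add: D_def vector_scalar_commute)
  note D_lin = D_add D_diff D_scale
  have FG: "quat_norm c' d' (F g) = 1" if "g \<in> SL1 c d" for g
    using mor that by (auto simp: k_morphism_def SL1_def)
  have one: "quat_one \<in> SL1 c d" by (simp add: SL1_def)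
  \<comment> \<open>F 1 is idempotent and has norm 1, so multiplying by its conjugate cancels one
    factor.\<close>
  have F1: "F quat_one = quat_one"
  proof -
    have "?m' (F quat_one) (F quat_one) = F quat_one" using hom[OF one one] by simp
    then have "?m' (?m' (F quat_one) (F quat_one)) (quat_conj (F quat_one)) = ?m' (F quat_one) (quat_conj (F quat_one))"
      by simp
    then show ?thesis by (simp add: quat_mult_assoc quat_mult_conj FG[OF one] quat_mult_linear)
  qed
  have curve: "\<exists>y. (\<forall>t. F (quat_one + t *s n) = poly_vec_eval y t) \<and> poly_vec_coeff y 0 = quat_one
      \<and> poly_vec_coeff y 1 = D n"
    if n: "n $ 1 = 0" "quat_norm c d n = 0" for n
  proof -
    from A[unfolded differential_at_one_def, rule_format, of "line_at_one n"] line_in_SL1[OF n] obtain y where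
      y: "\<forall>t. F (quat_one + t *s n) = poly_vec_eval y t" "poly_vec_coeff y 1 = D n"
      by (auto simp: line_at_one_eval D_def)
    have "poly_vec_coeff y 0 = quat_one"
      using y(1)[rule_format, of 0] F1 by (simp add: poly_vec_eval_0)
    with y show ?thesis by blast
  qed
  have pure: "D z $ 1 = 0" if "z $ 1 = 0" for z
    using that cd two
  proof (rule pure_quaternion_induct)
    fix n :: "'a alg_closure ^ 4" assume n: "n $ 1 = 0" "quat_norm c d n = 0"
    from curve[OF n] obtain y where y: "\<And>t. F (quat_one + t *s n) = poly_vec_eval y t"
      "poly_vec_coeff y 0 = quat_one" "poly_vec_coeff y 1 = D n" by blast
    have "quat_norm c' d' (poly_vec_eval y t) = 1" for t
      using FG[OF line_in_SL1[OF n]] y(1) by metis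
    then have "poly (quat_norm [:c':] [:d':] y) t = poly 1 t" for t
      by (simp add: quat_norm_def mult_ac)
    then have "quat_norm [:c':] [:d':] y = 1" by (rule poly_eq_infinite)
    then have "coeff (quat_norm [:c':] [:d':] y) 1 = 0" by simp
    moreover have "coeff (y $ 1) 0 = 1" "coeff (y $ 2) 0 = 0" "coeff (y $ 3) 0 = 0" "coeff (y $ 4) 0 = 0"
      using y(2) by (simp_all add: vec_eq_4)
    ultimately have "2 * coeff (y $ 1) 1 = 0"
      by (simp add: quat_norm_def power2_eq_square coeff_mult_1)
    then have "coeff (y $ 1) 1 = 0" using two by simp
    then show "D n $ 1 = 0" using y(3) by (metis poly_vec_coeff_nth)
  qed (simp_all add: D_lin)
  \<comment> \<open>This comes from (1 + t n') g = g (1 + t n) with n' the conjugate of n by g.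
    Keeping g on the right avoids an inverse of F g.\<close>
  have equivariant: "?m' (F g) (D z) = ?m' (D (?m (?m g z) (quat_conj g))) (F g)"
    if z: "z $ 1 = 0" and g: "g \<in> SL1 c d" for g z
    using z cd two
  proof (rule pure_quaternion_induct)
    fix n :: "'a alg_closure ^ 4" assume n: "n $ 1 = 0" "quat_norm c d n = 0"
    define n' where "n' = ?m (?m g n) (quat_conj g)"
    have n': "n' $ 1 = 0" "quat_norm c d n' = 0"
      using n by (simp add: n'_def algebra_simps) (simp add: n'_def quat_norm_mult n)
    from curve[OF n] obtain y where y: "\<And>t. F (quat_one + t *s n) = poly_vec_eval y t"
      "poly_vec_coeff y 0 = quat_one" "poly_vec_coeff y 1 = D n" by blast
    from curve[OF n'] obtain y' where y': "\<And>t. F (quat_one + t *s n') = poly_vec_eval y' t"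
      "poly_vec_coeff y' 0 = quat_one" "poly_vec_coeff y' 1 = D n'" by blast
    define G :: "'a alg_closure poly ^ 4" where "G = (\<chi> i. [:F g $ i:])"
    have G: "poly_vec_eval G t = F g" "poly_vec_coeff G 0 = F g" "poly_vec_coeff G 1 = 0" for t
      by (simp_all add: G_def vec_eq_iff)
    have "?m (quat_one + t *s n') g = ?m g (quat_one + t *s n)" for t
    proof -
      have "?m n' g = ?m (?m g n) (?m (quat_conj g) g)" by (simp add: n'_def quat_mult_assoc)
      then show ?thesis using g by (simp add: quat_mult_linear quat_mult_conj SL1_def)
    qed
    then have "?m' (poly_vec_eval y' t) (F g) = ?m' (F g) (poly_vec_eval y t)" for t
      using hom[OF line_in_SL1[OF n'] g] hom[OF g line_in_SL1[OF n]] y(1) y'(1) by metis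
    then have "poly_vec_eval (quat_mult [:c':] [:d':] y' G) t = poly_vec_eval (quat_mult [:c':] [:d':] G y) t" for t
      by (simp add: poly_vec_eval_quat_mult G)
    then have "quat_mult [:c':] [:d':] y' G = quat_mult [:c':] [:d':] G y" by (rule poly_vec_eq)
    then have "poly_vec_coeff (quat_mult [:c':] [:d':] y' G) 1 = poly_vec_coeff (quat_mult [:c':] [:d':] G y) 1"
      by simp
    moreover have "?m' x 0 = 0" "?m' 0 x = 0" for x by (simp_all add: vec_eq_4)
    ultimately show "?m' (F g) (D n) = ?m' (D (?m (?m g n) (quat_conj g))) (F g)"
      unfolding poly_vec_coeff_quat_mult G y y' by (simp add: n'_def)
  qed (simp_all add: D_lin quat_mult_linear)
  have lie: "D (quat_bracket c d x z) = quat_bracket c' d' (D x) (D z)" if "x $ 1 = 0" and z: "z $ 1 = 0" for x z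
    using that(1) cd two
  proof (rule pure_quaternion_induct)
    fix n :: "'a alg_closure ^ 4" assume n: "n $ 1 = 0" "quat_norm c d n = 0"
    from curve[OF n] obtain y where y: "\<And>t. F (quat_one + t *s n) = poly_vec_eval y t"
      "poly_vec_coeff y 0 = quat_one" "poly_vec_coeff y 1 = D n" by blast
    define Z :: "'a alg_closure poly ^ 4" where "Z = (\<chi> i. [:D z $ i:])"
    have Z: "poly_vec_eval Z t = D z" "poly_vec_coeff Z 0 = D z" "poly_vec_coeff Z 1 = 0" for t
      by (simp_all add: Z_def vec_eq_iff)
    \<comment> \<open>The curve obtained by conjugating z with g = 1 + t n and applying D; as the
      conjugate quaternion of g is 1 - t n, the coefficient of t is D [n, z] and that of t^2 is -D(n
      z n).\<close>
    define w :: "'a alg_closure poly ^ 4" where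
      "w = (\<chi> i. [:D z $ i, D (quat_bracket c d n z) $ i, - D (?m (?m n z) n) $ i:])"
    have w: "poly_vec_coeff w 0 = D z" "poly_vec_coeff w 1 = D (quat_bracket c d n z)"
      by (simp_all add: w_def vec_eq_iff)
    have w_eval: "poly_vec_eval w t = D (?m (?m (quat_one + t *s n) z) (quat_conj (quat_one + t *s n)))" for t
    proof -
      have conj: "quat_conj (quat_one + t *s n) = quat_one - t *s n" using n by (simp add: vec_eq_4)
      have "?m (?m (quat_one + t *s n) z) (quat_conj (quat_one + t *s n)) =
          z + t *s quat_bracket c d n z - (t * t) *s ?m (?m n z) n"
        unfolding conj by (simp add: quat_mult_linear quat_mult_diff quat_bracket_def vec_eq_iff algebra_simps)
      then have "D (?m (?m (quat_one + t *s n) z) (quat_conj (quat_one + t *s n))) =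
          D z + t *s D (quat_bracket c d n z) - (t * t) *s D (?m (?m n z) n)"
        by (simp only: D_lin)
      then show ?thesis by (simp add: w_def vec_eq_iff algebra_simps)
    qed
    have "?m' (poly_vec_eval y t) (D z) = ?m' (poly_vec_eval w t) (poly_vec_eval y t)" for t
      using equivariant[OF z line_in_SL1[OF n]] unfolding y(1) w_eval .
    then have "poly_vec_eval (quat_mult [:c':] [:d':] y Z) t = poly_vec_eval (quat_mult [:c':] [:d':] w y) t" for t
      by (simp add: poly_vec_eval_quat_mult Z)
    then have "quat_mult [:c':] [:d':] y Z = quat_mult [:c':] [:d':] w y" by (rule poly_vec_eq)
    then have "poly_vec_coeff (quat_mult [:c':] [:d':] y Z) 1 = poly_vec_coeff (quat_mult [:c':] [:d':] w y) 1"
      by simp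
    then have "?m' quat_one 0 + ?m' (D n) (D z) = ?m' (D z) (D n) + ?m' (D (quat_bracket c d n z)) quat_one"
      unfolding poly_vec_coeff_quat_mult Z y w by simp
    then show "D (quat_bracket c d n z) = quat_bracket c' d' (D n) (D z)"
      by (simp add: quat_bracket_def algebra_simps)
  qed (simp_all add: D_lin quat_bracket_linear)
  show thesis
    by (rule that[of A, OF A F1]) (use pure lie in \<open>auto simp: D_def\<close>)
qed

lemma k_isomorphic_SL1_isometric:
  fixes c d c' d' :: "'a::field"
  assumes iso: "k_isomorphic vector_coords (quat_mult (to_ac c) (to_ac d)) (SL1 (to_ac c) (to_ac d))
      vector_coords (quat_mult (to_ac c') (to_ac d')) (SL1 (to_ac c') (to_ac d'))"
    and nz: "c \<noteq> 0" "d \<noteq> 0" "c' \<noteq> 0" "d' \<noteq> 0" and two: "(2::'a) \<noteq> 0"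
  shows "isometric (quat_norm c d) (quat_norm c' d')"
proof -
  let ?G = "SL1 (to_ac c) (to_ac d)" and ?H = "SL1 (to_ac c') (to_ac d')"
  let ?m = "quat_mult (to_ac c) (to_ac d)" and ?m' = "quat_mult (to_ac c') (to_ac d')"
  have two': "(2::'a alg_closure) \<noteq> 0" using two to_ac_eq_0_iff[of "2::'a"] by simp
  have nz': "to_ac c \<noteq> 0" "to_ac d \<noteq> 0" "to_ac c' \<noteq> 0" "to_ac d' \<noteq> 0" using nz by simp_all
  from iso obtain F where bij: "bij_betw F ?G ?H"
    and hom: "\<And>g h. g \<in> ?G \<Longrightarrow> h \<in> ?G \<Longrightarrow> F (?m g h) = ?m' (F g) (F h)"
    and mor: "k_morphism vector_coords ?G vector_coords ?H F"
    and mor': "k_morphism vector_coords ?H vector_coords ?G (inv_into ?G F)"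
    unfolding k_isomorphic_def by blast
  obtain A :: "'a ^ 4 ^ 4" where A: "differential_at_one ?G F A"
    and F1: "F quat_one = quat_one"
    and pure: "\<And>z. z $ 1 = 0 \<Longrightarrow> (ac_matrix A *v z) $ 1 = 0"
    and lie: "\<And>x y. x $ 1 = 0 \<Longrightarrow> y $ 1 = 0
      \<Longrightarrow> ac_matrix A *v quat_bracket (to_ac c) (to_ac d) x y =
       quat_bracket (to_ac c') (to_ac d') (ac_matrix A *v x) (ac_matrix A *v y)"
    using SL1_homomorphism_differential[OF mor hom nz'(1,2) two'] by blast
  from k_morphism_differential[OF mor'] obtain B :: "'a ^ 4 ^ 4" where
    B: "differential_at_one ?H (inv_into ?G F) B" by blast
  note A = A[unfolded differential_at_one_def, rule_format] and B = B[unfolded differential_at_one_def, rule_format]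
  have BA: "ac_matrix B *v (ac_matrix A *v z) = z" if "z $ 1 = 0" for z
    using that nz'(1,2) two'
  proof (rule pure_quaternion_induct)
    fix n :: "'a alg_closure ^ 4" assume n: "n $ 1 = 0" "quat_norm (to_ac c) (to_ac d) n = 0"
    have inG: "poly_vec_eval (line_at_one n) t \<in> ?G" for t
      using line_in_SL1[OF n] by (simp add: line_at_one_eval)
    have start: "poly_vec_eval (line_at_one n) 0 = quat_one" by (simp add: line_at_one_eval)
    from A[OF start inG] obtain y where y: "\<And>t. F (poly_vec_eval (line_at_one n) t) = poly_vec_eval y t"
      "poly_vec_coeff y 1 = ac_matrix A *v n" by auto
    have "poly_vec_eval y t \<in> ?H" for t
      using bij inG y(1) by (metis bij_betw_apply)
    moreover have "poly_vec_eval y 0 = quat_one" using y(1)[of 0] F1 start by simp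
    ultimately obtain x where x: "\<And>t. inv_into ?G F (poly_vec_eval y t) = poly_vec_eval x t"
      "poly_vec_coeff x 1 = ac_matrix B *v (ac_matrix A *v n)" using B[of y] y(2) by auto
    have "poly_vec_eval x t = poly_vec_eval (line_at_one n) t" for t
      using x(1)[of t] y(1)[of t] bij_betw_inv_into_left[OF bij inG] by metis
    then have "x = line_at_one n" by (rule poly_vec_eq)
    with x(2) show "ac_matrix B *v (ac_matrix A *v n) = n" by simp
  qed (simp_all add: matrix_vector_right_distrib vector_scalar_commute)
  have norm: "quat_norm (to_ac c') (to_ac d') (ac_matrix A *v x) = quat_norm (to_ac c) (to_ac d) x"
    if x: "x $ 1 = 0" for x
  proof (cases "x = 0")
    case True
    then show ?thesis by (simp add: quat_norm_def)
  next
    case False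
    obtain y where y: "y $ 1 = 0" "quat_bracket (to_ac c) (to_ac d) x y \<noteq> 0"
      using quat_bracket_nonzero[OF x False nz'(1,2) two'] by blast
    let ?br = "quat_bracket (to_ac c) (to_ac d)" and ?br' = "quat_bracket (to_ac c') (to_ac d')"
    let ?x = "ac_matrix A *v x" and ?y = "ac_matrix A *v y"
    have "ac_matrix A *v ?br x (?br x (?br x y)) = ?br' ?x (?br' ?x (?br' ?x ?y))"
      using x y(1) by (simp add: lie quat_bracket_pure)
    then have "(- 4 * quat_norm (to_ac c) (to_ac d) x) *s ?br' ?x ?y =
        (- 4 * quat_norm (to_ac c') (to_ac d') ?x) *s ?br' ?x ?y"
      unfolding quat_bracket_triple[OF x y(1)] quat_bracket_triple[OF pure[OF x] pure[OF y(1)]]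
      by (simp only: vector_scalar_commute lie[OF x y(1)])
    \<comment> \<open>The two scalars can be compared only because this vector is nonzero: A is
      injective on pure quaternions, with left inverse B.\<close>
    moreover have "?br' ?x ?y \<noteq> 0"
    proof
      assume "?br' ?x ?y = 0"
      then have "ac_matrix B *v (ac_matrix A *v ?br x y) = 0"
        by (simp add: lie[OF x y(1)])
      with BA[OF quat_bracket_pure] y(2) show False by metis
    qed
    ultimately have "- 4 * quat_norm (to_ac c) (to_ac d) x = - 4 * quat_norm (to_ac c') (to_ac d') ?x"
      by (simp only: vector_mul_rcancel) blast
    moreover have "(4::'a alg_closure) \<noteq> 0" using two' mult_eq_0_iff[of "2::'a alg_closure" 2] by simp
    ultimately show ?thesis by simp
  qed
  \<comment> \<open>A is controlled only on pure quaternions, so T takes its pure block and fixes 1.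
    This fits the norm form, which is the orthogonal sum of the square on scalars and its pure
    part.\<close>
  define T :: "'a ^ 4 ^ 4" where
    "T = (\<chi> i j. if i = 1 then of_bool (j = 1) else if j = 1 then 0 else A $ i $ j)"
  define e where "e x = (\<chi> i. to_ac (x $ i))" for x :: "'a ^ 4"
  define p where "p x = (\<chi> i. if i = 1 then 0 else x $ i)" for x :: "'a ^ 4"
  have Tp: "e (T *v x) = to_ac (x $ 1) *s quat_one + ac_matrix A *v e (p x)" for x
    using pure[of "e (p x)"]
    by (simp add: vec_eq_4 e_def p_def T_def ac_matrix_def matrix_vector_mult_def sum_4 to_ac_sum)
  have e_norm: "to_ac (quat_norm a b x) = quat_norm (to_ac a) (to_ac b) (e x)" for a b x
    by (simp add: quat_norm_def e_def)
  have split: "quat_norm a b (r *s quat_one + z) = r^2 + quat_norm a b z" if "z $ 1 = 0" for a b r and z ::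
    "'a alg_closure ^ 4"
    using that by (simp add: quat_norm_def)
  have pure_p: "e (p x) $ 1 = 0" for x by (simp add: e_def p_def)
  have "quat_norm c' d' (T *v x) = quat_norm c d x" for x
  proof -
    have "e x = to_ac (x $ 1) *s quat_one + e (p x)" by (simp add: vec_eq_4 e_def p_def)
    then have "to_ac (quat_norm c' d' (T *v x)) = to_ac (quat_norm c d x)"
      unfolding e_norm Tp by (simp add: split pure pure_p norm)
    then show ?thesis by simp
  qed
  moreover have "invertible T"
    unfolding invertible_left_inverse matrix_left_invertible_ker
  proof (intro allI impI)
    fix x assume x: "T *v x = 0"
    then have eT: "to_ac (x $ 1) *s quat_one + ac_matrix A *v e (p x) = 0"
      unfolding Tp[symmetric] by (simp add: e_def vec_eq_iff)
    then have "(to_ac (x $ 1) *s quat_one + ac_matrix A *v e (p x)) $ 1 = 0" by simp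
    then have x1: "x $ 1 = 0" using pure[OF pure_p] by simp
    with eT have "ac_matrix A *v e (p x) = 0" by simp
    then have "e (p x) = 0" using BA[OF pure_p] by (metis matrix_vector_mult_0_right)
    with x1 show "x = 0" by (simp add: vec_eq_4 e_def p_def)
  qed
  ultimately show ?thesis unfolding isometric_def by blast
qed

section \<open>Normal forms of semistable points\<close>

text \<open>For x in X the matrix \<open>phi x\<close> lies in the Lie algebra of Sp_6; in terms of
  J this is the skewness stated in \<open>phi_skew\<close>.\<close>

lemma MJ_phi_symmetric:
  assumes "x \<in> X_space"
  shows "transpose (MJ ** phi x) = MJ ** phi x"
proof -
  have x: "x \<in> ext_power 3" "psi x = 0" using assms by (auto simp: X_space_def)
  show ?thesis
    unfolding vec_eq_iff forall_6 transpose_def vec_lambda_beta MJ_phi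
    by (simp add: phi_components[OF x(1)] tri_sort psi_zero_6[OF x(2)] algebra_simps)
qed

lemma phi_skew:
  assumes "x \<in> X_space"
  shows "form_J (phi x *v u) v = - form_J u (phi x *v v)"
proof -
  have "form_J u (phi x *v v) = form_J v (phi x *v u)" for u v
  proof -
    have expand: "form_J u (phi x *v v)
      = (\<Sum>p\<in>UNIV. \<Sum>q\<in>UNIV. u $ p * v $ q * (MJ ** phi x) $ p $ q)" for u v
      unfolding form_J_def matrix_vector_mul_assoc
      by (simp add: scalar_product_def matrix_vector_mult_def sum_distrib_left mult_ac)
    have sym: "(MJ ** phi x) $ p $ q = (MJ ** phi x) $ q $ p" for p q
      using arg_cong[OF MJ_phi_symmetric[OF assms], of "\<lambda>A. A $ p $ q"] by (simp add: transpose_def)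
    show ?thesis unfolding expand[of u v] expand[of v u]
    proof (subst sum.swap, intro sum.cong refl)
      fix p q
      show "u $ q * v $ p * (MJ ** phi x) $ q $ p = v $ p * u $ q * (MJ ** phi x) $ p $ q"
        unfolding sym[of q p] by (simp only: mult.commute[of "u $ q"])
    qed
  qed
  then show ?thesis using form_J_swap by metis
qed

lemma form_J_neg: "form_J (- u) w = - form_J u w" "form_J w (- u) = - form_J w u"
  by (simp_all add: form_J_6 algebra_simps)

lemma matrix_vector_mult_neg: "M *v (- v) = - (M *v v)" for M :: "'a::comm_ring_1 ^ 'n ^ 'm"
  by (simp add: matrix_vector_mult_def vec_eq_iff sum_negf)

definition trilinear_form :: "'a::comm_ring_1 ^ (6 set) \<Rightarrow> 'a ^ 6 \<Rightarrow> 'a ^ 6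
  \<Rightarrow> 'a ^ 6 \<Rightarrow> 'a" where
  "trilinear_form x u v w = form_J (contr x u *v w) v"

lemma trilinear_form_scale:
  fixes x :: "'a::field ^ (6 set)"
  shows "trilinear_form x (c *s u) q z = c * trilinear_form x u q z"
    "trilinear_form x u (c *s q) z = c * trilinear_form x u q z"
    "trilinear_form x u q (c *s z) = c * trilinear_form x u q z"
  by (simp_all add: trilinear_form_def contr_linear_left vector_scalar_commute form_J_scale)

lemma trilinear_form_swap: "trilinear_form x q u z = - trilinear_form x u q z" "trilinear_form x u z q =
  - trilinear_form x u q z"
  unfolding trilinear_form_def by (rule contr_alternating)+

section \<open>Consequences of the quadratic identity for A = \<open>phi x\<close> and B_u =
  \<open>contr x u\<close>\<close>

context
  fixes x :: "'a::field ^ (6 set)"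
  assumes x: "x \<in> X_space" and two: "(2::'a) \<noteq> 0"
begin

lemma contr_skew_self_adjoint: "form_J (contr x u *v w) v = form_J w (contr x u *v v)"
  by (subst contr_alternating(2)) (subst form_J_swap, simp)

lemma contr_twice: "2 *s (contr x u *v (contr x u *v w)) = form_J w (phi x *v u) *s u
  - form_J u (phi x *v u) *s w - form_J w u *s (phi x *v u)"
  by (rule contr_contr_mult[OF x two])

text \<open>Computing 2 B_u B_u B_u w from \<open>contr_twice\<close> in two ways gives m u = -J(w,
  u) B_u A u with m = J(w, B_u A u). Pairing with w, chosen so that J(w, u) is nonzero, yields 2 m
  J(w, u) = 0.\<close>

lemma contr_phi_self: "contr x u *v (phi x *v u) = 0"
proof (cases "u = 0")
  case True
  then show ?thesis by simp
next
  case False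
  then obtain w where "form_J u w \<noteq> 0" using form_J_nondegenerate by blast
  then have w: "form_J w u \<noteq> 0" by (subst form_J_swap) simp
  have "2 *s (contr x u *v (contr x u *v (contr x u *v w)))
    = (contr x u *v (2 *s (contr x u *v (contr x u *v w))))" by (simp add: vector_scalar_commute)
  also have "\<dots> = - form_J u (phi x *v u) *s (contr x u *v w) - form_J w u *s (contr x u *v (phi x *v u))"
    unfolding contr_twice
    by (simp add: matrix_vector_mult_diff_distrib vector_scalar_commute contr_self[OF two])
  finally have "form_J (contr x u *v w) (phi x *v u) *s u = - (form_J w u *s (contr x u *v (phi x *v u)))"
    unfolding contr_twice[of u "contr x u *v w"]
    by (simp add: contr_skew_self_adjoint contr_self[OF two])
  moreover define m where "m = form_J w (contr x u *v (phi x *v u))"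
  ultimately have eq: "m *s u = - (form_J w u *s (contr x u *v (phi x *v u)))"
    by (simp add: contr_skew_self_adjoint)
  from arg_cong[OF this, of "form_J w"] have "m * form_J w u = - (form_J w u * m)"
    by (simp add: form_J_scale m_def form_J_neg)
  then have "2 * (m * form_J w u) = 0" by (simp add: mult.commute)
  with w two have "m = 0" by simp
  with eq w show ?thesis by (simp add: vec_eq_iff)
qed

lemma phi_move: "contr x (phi x *v u) *v v = (contr x u *v (phi x *v v))"
proof -
  have "contr x (u + v) *v (phi x *v (u + v)) = 0" by (rule contr_phi_self)
  then have "(contr x v *v (phi x *v u)) + (contr x u *v (phi x *v v)) = 0"
    using contr_phi_self[of u] contr_phi_self[of v]
    by (simp add: contr_linear_left matrix_vector_right_distrib matrix_vector_mult_add_rdistrib)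
  moreover have "contr x v *v (phi x *v u) = - (contr x (phi x *v u) *v v)" by (rule contr_swap)
  ultimately show ?thesis by simp
qed

text \<open>By \<open>phi_move\<close>, A passes between the index of B and its argument; skewness
  of A and the alternation of the trilinear form carry it to the outside with a sign.\<close>

lemma phi_contr_anticommute: "phi x *v (contr x u *v w) = - (contr x u *v (phi x *v w))"
proof -
  have "form_J ((phi x *v (contr x u *v w)) + (contr x u *v (phi x *v w))) v = 0" for v
  proof -
    have "form_J (phi x *v (contr x u *v w)) v = - form_J (contr x u *v w) (phi x *v v)" by (rule phi_skew[OF x])
    also have "\<dots> = form_J (contr x (phi x *v u) *v v) w"
      using contr_alternating(2)[of x u w "phi x *v v"] by (simp add: phi_move)
    also have "\<dots> = - form_J (contr x u *v (phi x *v w)) v"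
      using contr_alternating(2)[of x "phi x *v u" v w] by (simp add: phi_move)
    finally show ?thesis by (simp add: form_J_add)
  qed
  then have "(phi x *v (contr x u *v w)) + (contr x u *v (phi x *v w)) = 0" by (rule form_J_nondegenerate)
  then show ?thesis by (simp add: eq_neg_iff_add_eq_0)
qed

text \<open>Moving A gives B_{Av} B_{Av} = -B_v B_v A A, and expanding both sides by
  \<open>contr_twice\<close> gives \<open>main\<close>. For w = v it shows that v is an eigenvector
  of A A with eigenvalue c; substituting this back makes A A equal to c on every w.\<close>

lemma phi_twice:
  assumes s: "form_J v (phi x *v v) \<noteq> 0"
  obtains c where "\<And>w. (phi x *v (phi x *v w)) = c *s w"
proof -
  define s where "s = form_J v (phi x *v v)"
  define c where "c = - form_J (phi x *v v) (phi x *v (phi x *v v)) / s"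
  have s0: "s \<noteq> 0" using assms by (simp add: s_def)
  have skew: "form_J (phi x *v u) w = - form_J u (phi x *v w)" for u w by (rule phi_skew[OF x])
  have main: "s *s (phi x *v (phi x *v w)) - form_J (phi x *v (phi x *v w)) (phi x *v v) *s v =
      - form_J (phi x *v v) (phi x *v (phi x *v v)) *s w - form_J w (phi x *v v) *s (phi x *v (phi x *v v))" for w
  proof -
    have "2 *s (contr x (phi x *v v) *v (contr x (phi x *v v) *v w)) =
      - (2 *s (contr x v *v (contr x v *v (phi x *v (phi x *v w)))))"
      by (simp add: phi_move phi_contr_anticommute[of v] matrix_vector_mult_neg)
    then have "form_J w (phi x *v (phi x *v v)) *s (phi x *v v) - form_J (phi x *v v)
      (phi x *v (phi x *v v)) *s w - form_J w (phi x *v v) *s (phi x *v (phi x *v v))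
      = - (form_J (phi x *v (phi x *v w)) (phi x *v v) *s v - form_J v (phi x *v v) *s (phi x *v (phi x *v w))
        - form_J (phi x *v (phi x *v w)) v *s (phi x *v v))"
      unfolding contr_twice .
    moreover have "form_J (phi x *v (phi x *v w)) v = form_J w (phi x *v (phi x *v v))" by (simp add: skew)
    ultimately show ?thesis unfolding s_def by (simp add: vec_eq_iff algebra_simps)
  qed
  have swap: "form_J (phi x *v (phi x *v v)) (phi x *v v) = - form_J (phi x *v v) (phi x *v (phi x *v v))"
    by (rule form_J_swap)
  have "2 *s (s *s (phi x *v (phi x *v v))) = 2 *s (- form_J (phi x *v v) (phi x *v (phi x *v v)) *s v)"
    using main[of v] unfolding s_def[symmetric] swap
    by (simp add: vec_eq_iff algebra_simps eq_neg_iff_add_eq_0)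
  then have "s *s (phi x *v (phi x *v v)) = - form_J (phi x *v v) (phi x *v (phi x *v v)) *s v" using two
    by (simp only: vector_mul_lcancel) simp
  then have v: "phi x *v (phi x *v v) = c *s v" using s0 by (simp add: c_def vec_eq_iff field_simps)
  have "phi x *v (phi x *v w) = c *s w" for w
  proof -
    have "form_J (phi x *v (phi x *v w)) (phi x *v v) = c * form_J w (phi x *v v)"
      by (simp add: skew v vector_scalar_commute form_J_scale)
    moreover have "form_J (phi x *v v) (phi x *v (phi x *v v)) = - (c * s)" using s0 by (simp add: c_def)
    ultimately have "s *s (phi x *v (phi x *v w)) = s *s (c *s w)"
      using main[of w] unfolding v by (simp add: vec_eq_iff algebra_simps)
    with s0 show ?thesis by (simp only: vector_mul_lcancel) simp
  qed
  then show thesis by (rule that)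
qed

text \<open>If B_v B_v were zero, then s w = J(w, a) v - J(w, v) a for all w, with a = A v. Read off
  at e_1, e_2, e_3, this makes each of the three summands of s = J(v, a) equal to s, so 3 s =
  s.\<close>

lemma contr_nonzero:
  assumes s: "form_J v (phi x *v v) \<noteq> 0"
  shows "\<exists>w. (contr x v *v (contr x v *v w)) \<noteq> 0"
proof (rule ccontr)
  define s where "s = form_J v (phi x *v v)"
  define a where "a = (phi x *v v)"
  assume "\<not> ?thesis"
  then have "form_J w a *s v - s *s w - form_J w v *s a = 0" for w
    using contr_twice[of v w] by (simp add: s_def a_def)
  then have eq: "form_J w a * v $ i - s * w $ i - form_J w v * a $ i = 0" for w i
    unfolding vec_eq_iff by simp
  have 0: "v$0 * a$3 - v$3 * a$0 = s" using eq[of "axis 0 1" 0] by (simp add: form_J_6 axis_def algebra_simps)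
  have 1: "v$1 * a$4 - v$4 * a$1 = s" using eq[of "axis 1 1" 1] by (simp add: form_J_6 axis_def algebra_simps)
  have 2: "v$2 * a$5 - v$5 * a$2 = s" using eq[of "axis 2 1" 2] by (simp add: form_J_6 axis_def algebra_simps)
  have "s = (v$0 * a$3 - v$3 * a$0) + (v$1 * a$4 - v$4 * a$1) + (v$2 * a$5 - v$5 * a$2)"
    unfolding s_def a_def[symmetric] by (simp add: form_J_6)
  then have "s + (s + s) = s + 0" unfolding 0 1 2 by (simp only: add.assoc add_0_right)
  then have "2 * s = 0" by (simp only: add_left_cancel mult_2)
  with two assms show False by (simp add: s_def)
qed

text \<open>If J(u, A u) vanished on the image of B_v, polarization would give B_v A B_v = 0, hence
  A B_v B_v = 0. As A is invertible, this contradicts \<open>contr_nonzero\<close>.\<close>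

lemma exists_anisotropic:
  assumes s: "form_J v (phi x *v v) \<noteq> 0" and c: "\<And>w. (phi x *v (phi x *v w)) = c *s w" "c \<noteq> 0"
  shows "\<exists>u. form_J (contr x v *v u) (phi x *v (contr x v *v u)) \<noteq> 0"
proof (rule ccontr)
  assume "\<not> ?thesis"
  then have iso: "form_J (contr x v *v u) (phi x *v (contr x v *v u)) = 0" for u by blast
  have "contr x v *v (contr x v *v w) = 0" for w
  proof -
    have "form_J (phi x *v (contr x v *v (contr x v *v w))) u = 0" for u
    proof -
      have "form_J (contr x v *v w) (phi x *v (contr x v *v u)) = form_J (contr x v *v u) (phi x *v (contr x v *v w))"
        using phi_skew[OF x, of "contr x v *v w" "contr x v *v u"] form_J_swap[of "phi x *v (contr x v *v w)"
          "contr x v *v u"] by simp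
      moreover have "form_J (contr x v *v u) (phi x *v (contr x v *v w)) + form_J (contr x v *v w)
        (phi x *v (contr x v *v u)) = 0"
        using iso[of "u + w"] iso[of u] iso[of w]
        by (simp add: matrix_vector_right_distrib form_J_add add.commute)
      ultimately have "2 * form_J (contr x v *v u) (phi x *v (contr x v *v w)) = 0" by simp
      then have "form_J u (contr x v *v (phi x *v (contr x v *v w))) = 0"
        using two by (simp flip: contr_skew_self_adjoint)
      then show ?thesis
        using form_J_swap[of "contr x v *v (phi x *v (contr x v *v w))" u]
        by (simp add: phi_contr_anticommute[of v "contr x v *v w"] form_J_neg)
    qed
    then have "phi x *v (contr x v *v (contr x v *v w)) = 0" by (rule form_J_nondegenerate)
    then have "c *s (contr x v *v (contr x v *v w)) = 0" using c(1)[of "contr x v *v (contr x v *v w)"] by simp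
    with c(2) show ?thesis by simp
  qed
  with contr_nonzero[OF s] show False by blast
qed

text \<open>A can be shifted between the slots, so a value on three given vectors with copies of A
  inserted depends only on the number of copies.\<close>

lemma trilinear_form_phi: "trilinear_form x (phi x *v u) q z = trilinear_form x u q (phi x *v z)"
  "trilinear_form x u (phi x *v q) z = trilinear_form x u q (phi x *v z)"
proof -
  show "trilinear_form x (phi x *v u) q z = trilinear_form x u q (phi x *v z)"
    by (simp add: trilinear_form_def phi_move)
  have "form_J (contr x u *v (phi x *v z)) q = - form_J (phi x *v (contr x u *v z)) q"
    by (simp add: phi_contr_anticommute form_J_neg)
  then show "trilinear_form x u (phi x *v q) z = trilinear_form x u q (phi x *v z)"
    by (simp add: trilinear_form_def phi_skew[OF x])
qed

lemma trilinear_form_line: "trilinear_form x u (phi x *v u) z = 0" "trilinear_form x (phi x *v u) u z = 0"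
  "trilinear_form x u z (phi x *v u) = 0" "trilinear_form x (phi x *v u) z u = 0"
    "trilinear_form x z u (phi x *v u) = 0" "trilinear_form x z (phi x *v u) u = 0"
proof -
  show 1: "trilinear_form x u z (phi x *v u) = 0" for u z by (simp add: trilinear_form_def contr_phi_self)
  show 2: "trilinear_form x u (phi x *v u) z = 0" for u z using trilinear_form_swap(2)[of x u "phi x *v u" z] 1 by simp
  show 3: "trilinear_form x (phi x *v u) u z = 0" for u z using trilinear_form_swap(1)[of x "phi x *v u" u z] 2 by simp
  show 4: "trilinear_form x (phi x *v u) z u = 0" for u z using trilinear_form_swap(2)[of x "phi x *v u" u z] 3 by simp
  show "trilinear_form x z u (phi x *v u) = 0" for u z using trilinear_form_swap(1)[of x z u "phi x *v u"] 1 by simp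
  show "trilinear_form x z (phi x *v u) u = 0" for u z using trilinear_form_swap(1)[of x z "phi x *v u" u] 4 by simp
qed

end

text \<open>
  In the indexing from 1, this is
  \<open>a e\<^sub>1e\<^sub>2e\<^sub>3 + b e\<^sub>1e\<^sub>5e\<^sub>6 + c e\<^sub>2e\<^sub>4e\<^sub>6
    + d e\<^sub>3e\<^sub>4e\<^sub>5\<close>.
\<close>

definition normal_form :: "'a::comm_ring_1 \<Rightarrow> 'a \<Rightarrow> 'a \<Rightarrow> 'a
  \<Rightarrow> 'a ^ (6 set)" where
  "normal_form a b c d = a *s axis {0, 1, 2} 1 + b *s axis {0, 4, 5} 1 + c *s axis {1, 3, 5} 1 + d *s axis {2, 3, 4} 1"

lemma set_6_eq: "(S :: 6 set) = T \<longleftrightarrow> (\<forall>i. i \<in> S \<longleftrightarrow> i \<in> T)"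
  by (rule set_eq_iff)

lemma normal_form_ext_power: "normal_form a b c d \<in> ext_power 3"
  by (auto simp: ext_power_def normal_form_def axis_def split: if_splits)

lemma tri_normal_form:
  "tri (normal_form a b c d) 0 1 2 = a" "tri (normal_form a b c d) 0 4 5 = b"
  "tri (normal_form a b c d) 1 3 5 = c" "tri (normal_form a b c d) 2 3 4 = d"
  "tri (normal_form a b c d) 0 1 3 = 0" "tri (normal_form a b c d) 0 1 4 = 0"
  "tri (normal_form a b c d) 0 1 5 = 0" "tri (normal_form a b c d) 0 2 3 = 0"
  "tri (normal_form a b c d) 0 2 4 = 0" "tri (normal_form a b c d) 0 2 5 = 0"
  "tri (normal_form a b c d) 0 3 4 = 0" "tri (normal_form a b c d) 0 3 5 = 0"
  "tri (normal_form a b c d) 1 2 3 = 0" "tri (normal_form a b c d) 1 2 4 = 0"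
  "tri (normal_form a b c d) 1 2 5 = 0" "tri (normal_form a b c d) 1 3 4 = 0"
  "tri (normal_form a b c d) 1 4 5 = 0" "tri (normal_form a b c d) 2 3 5 = 0"
  "tri (normal_form a b c d) 2 4 5 = 0" "tri (normal_form a b c d) 3 4 5 = 0"
  by (simp_all add: tri_sorted normal_form_def axis_def set_6_eq forall_6)

lemma ext_power_3_eq_normal_form:
  assumes "w \<in> ext_power 3" "tri w 0 1 2 = a" "tri w 0 4 5 = b" "tri w 1 3 5 = c" "tri w 2 3 4 = d"
    "tri w 0 1 3 = 0" "tri w 0 1 4 = 0" "tri w 0 1 5 = 0" "tri w 0 2 3 = 0" "tri w 0 2 4 = 0" "tri w 0 2 5 = 0"
    "tri w 0 3 4 = 0" "tri w 0 3 5 = 0" "tri w 1 2 3 = 0" "tri w 1 2 4 = 0" "tri w 1 2 5 = 0"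
    "tri w 1 3 4 = 0" "tri w 1 4 5 = 0" "tri w 2 3 5 = 0" "tri w 2 4 5 = 0" "tri w 3 4 5 = 0"
  shows "w = normal_form a b c d"
proof (rule ext_power_3_eqI[OF assms(1) normal_form_ext_power])
  have "\<forall>i j l. i < j \<and> j < l \<longrightarrow> tri w i j l = tri (normal_form a b c d) i j l"
    unfolding forall_6 by (simp add: assms tri_normal_form)
  then show "i < j \<Longrightarrow> j < l
    \<Longrightarrow> tri w i j l = tri (normal_form a b c d) i j l" for i j l by blast
qed

lemma Sp6_iff_form_J:
  fixes g :: "'a::field ^ 6 ^ 6"
  shows "g \<in> Sp6 \<longleftrightarrow> (\<forall>i j. form_J (g *v axis i 1) (g *v axis j 1) = MJ $ i $ j)"
proof -
  have "scalar_product (axis i 1) (M *v axis j 1) = M $ i $ j" for M :: "'a ^ 6 ^ 6" and i j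
  proof -
    have "axis i 1 $ p * (\<Sum>q\<in>UNIV. M $ p $ q * axis j 1 $ q) = (if p = i then M $ i $ j else 0)" for p
      by (simp add: axis_def if_distrib cong: if_cong)
    then show ?thesis by (simp add: scalar_product_def matrix_vector_mult_def)
  qed
  then show ?thesis unfolding Sp6_transpose form_J_matrix by (simp add: vec_eq_iff)
qed

lemma Sp6_inverse:
  fixes g :: "'a::field ^ 6 ^ 6"
  assumes "g \<in> Sp6"
  obtains h where "h \<in> Sp6" "h ** g = mat 1" "g ** h = mat 1"
proof -
  from assms obtain h where h: "g ** h = mat 1" "h ** g = mat 1"
    by (auto simp: Sp6_def invertible_def)
  have gh: "g *v (h *v u) = u" for u by (simp add: matrix_vector_mul_assoc h)
  have "form_J (h *v u) (h *v v) = form_J u v" for u v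
    using form_J_Sp6[OF assms, of "h *v u" "h *v v"] by (simp only: gh)
  moreover have "\<forall>i j. form_J (axis i 1) (axis j 1) = (MJ $ i $ j :: 'a)"
    unfolding forall_6 by (simp add: form_J_6 MJ_entry axis_def)
  ultimately have "h \<in> Sp6" by (simp add: Sp6_iff_form_J)
  then show thesis using h that by blast
qed

lemma Sp6_mult: "g \<in> Sp6 \<Longrightarrow> h \<in> Sp6 \<Longrightarrow> g ** h \<in> Sp6" for g h ::
  "'a::field ^ 6 ^ 6"
  unfolding Sp6_iff_form_J by (simp add: form_J_Sp6 Sp6_iff_form_J flip: matrix_vector_mul_assoc)

lemma f2_form_J: "f2 (x, v) = - (1/2) * form_J v (phi x *v v)"
  by (simp add: f2_def form_J_def matrix_vector_mul_assoc)

lemma f_quartic_eq: "phi x ** phi x = mat c \<Longrightarrow> f_quartic x = c" for c :: "'a::field"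
  unfolding f_quartic_def
proof (rule the_equality)
  fix d assume "phi x ** phi x = mat c" "phi x ** phi x = mat d"
  then have "(mat d :: 'a ^ 6 ^ 6) $ 0 $ 0 = (mat c :: 'a ^ 6 ^ 6) $ 0 $ 0" by simp
  then show "d = c" by (simp add: mat_def)
qed

lemma neg_MJ_axis:
  "- (MJ *v axis 0 1) = axis 3 1" "- (MJ *v axis 1 1) = axis 4 1" "- (MJ *v axis 2 1) = axis 5 1"
  "- (MJ *v axis 3 1) = (- 1) *s axis 0 1" "- (MJ *v axis 4 1) = (- 1) *s axis 1 1" "- (MJ *v axis 5 1)
    = (- 1) *s axis 2 1"
  by (simp_all add: vec_eq_iff forall_6 axis_def)

text \<open>The coefficients of \<open>x\<close> are the values of the trilinear form at the basis
  that is J-dual to the standard one, namely the vectors \<open>- (MJ *v axis i 1)\<close>.\<close>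

lemma tri_trilinear_form:
  "tri x i j l = trilinear_form x (- (MJ *v axis i 1)) (- (MJ *v axis j 1)) (- (MJ *v axis l 1))"
  unfolding trilinear_form_def form_J_contr by (simp only: matrix_vector_mult_neg MJ_MJ minus_minus tri_sum_axis)

lemma trilinear_form_ext3_act:
  fixes g :: "'a::field ^ 6 ^ 6"
  assumes "g \<in> Sp6"
  shows "trilinear_form (ext3_act g x) (g *v u) (g *v q) (g *v z) = trilinear_form x u q z"
  by (simp add: trilinear_form_def contr_ext3_act[OF assms] form_J_Sp6[OF assms])

text \<open>Coefficients in the new basis are values at its dual basis, which up to scaling is Av,
  Aw, Az in slots 0, 1, 2 and v, w, z in slots 3, 4, 5. Values with an even number of copies of A
  are multiples of the value at v, w, z, which is zero, and values with a vector next to its image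
  under A vanish. Only 012, 045, 135 and 234 remain.\<close>

lemma Vss_normal_form:
  fixes y :: "'a::field rep"
  assumes y: "y \<in> Vss" and two: "(2::'a) \<noteq> 0"
  obtains g a b c d where "g \<in> Sp6" "a \<noteq> 0" "b \<noteq> 0" "c \<noteq> 0" "d \<noteq> 0"
    "y = rep_act g (normal_form a b c d, axis 0 1)"
proof -
  obtain x v where y_eq: "y = (x, v)" by (cases y)
  with y have x: "x \<in> X_space" and f1: "f1 x \<noteq> 0" and f2: "f2 (x, v) \<noteq> 0" by (auto simp: Vss_def)
  let ?A = "\<lambda>v. phi x *v v" and ?B = "\<lambda>u v. contr x u *v v"
  define s where "s = form_J v (?A v)"
  have s: "s \<noteq> 0" using f2 by (auto simp: f2_form_J s_def)
  from phi_twice[OF x two] s obtain k where k: "\<And>w. ?A (?A w) = k *s w" unfolding s_def by blast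
  have "phi x ** phi x = mat k"
    unfolding matrix_eq
  proof
    fix w :: "'a ^ 6"
    have "mat k *v w = k *s w"
      by (simp add: vec_eq_iff matrix_vector_mult_def mat_def if_distrib if_distribR cong: if_cong)
    then show "(phi x ** phi x) *v w = mat k *v w" using k by (simp flip: matrix_vector_mul_assoc)
  qed
  then have "f1 x = - (1/4) * k" by (simp add: f1_def f_quartic_eq)
  with f1 have k0: "k \<noteq> 0" by auto
  from exists_anisotropic[OF x two] s k k0 obtain u where
    u: "form_J (?B v u) (?A (?B v u)) \<noteq> 0" unfolding s_def by blast
  define w where "w = ?B v u"
  define z where "z = ?B v w"
  define r where "r = form_J w (?A w)"
  have r: "r \<noteq> 0" using u by (simp add: r_def w_def)
  \<comment> \<open>As w is J-orthogonal to v and Av, \<open>contr_twice\<close> reduces to 2 B_v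
    B_v w = -s w, that is B_v z = \<beta> w.\<close>
  define \<beta> where "\<beta> = - s / 2"
  have \<beta>: "\<beta> \<noteq> 0" using s two by (simp add: \<beta>_def)
  note sa = contr_skew_self_adjoint[OF x two, of v]
  note skew = phi_skew[OF x]
  note phi_self = contr_phi_self[OF x two]
  have wv: "form_J w v = 0" unfolding w_def sa by (simp add: contr_self[OF two])
  have wAv: "form_J w (?A v) = 0" unfolding w_def sa by (simp add: phi_self)
  have zv: "form_J z v = 0" unfolding z_def sa by (simp add: contr_self[OF two])
  have zAv: "form_J z (?A v) = 0" unfolding z_def sa by (simp add: phi_self)
  have Bz: "?B v z = \<beta> *s w"
  proof -
    have "2 *s ?B v z = - s *s w"
      using contr_twice[OF x two, of v w] by (simp add: z_def wv wAv s_def vec_eq_iff)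
    then show ?thesis using two by (simp add: \<beta>_def vec_eq_iff field_simps)
  qed
  \<comment> \<open>The basic value with one copy of A. It equals -J(z, Az) and also \<beta> r, so z
    is anisotropic like w.\<close>
  define Z where "Z = trilinear_form x v w (?A z)"
  have Z: "Z = \<beta> * r"
  proof -
    have "?B v (?A z) = - (\<beta> *s ?A w)"
      using phi_contr_anticommute[OF x two, of v z] unfolding Bz by (simp add: vector_scalar_commute)
    then have "Z = - (\<beta> * form_J (?A w) w)"
      by (simp add: Z_def trilinear_form_def form_J_neg form_J_scale)
    then show ?thesis using form_J_swap[of "?A w" w] by (simp add: r_def)
  qed
  have Z0: "Z \<noteq> 0" using \<beta> r by (simp add: Z)
  note mv = trilinear_form_phi[OF x two] and ln = trilinear_form_line[OF x two]
  have T0: "trilinear_form x v w z = 0" by (simp add: trilinear_form_def Bz form_J_scale)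
  have F1: "trilinear_form x (?A v) (?A w) (?A z) = k * Z"
    by (simp add: mv k trilinear_form_scale vector_scalar_commute Z_def)
  have F2: "trilinear_form x (?A v) (?A w) z = 0" by (simp add: mv k trilinear_form_scale T0)
  have F3: "trilinear_form x (?A v) (?A z) w = 0"
    unfolding trilinear_form_swap(2)[of x "?A v" "?A z" w] by (simp add: mv k trilinear_form_scale T0)
  have F4: "trilinear_form x (?A v) w z = Z" by (simp add: mv Z_def)
  have F6: "trilinear_form x (?A w) v z = - Z"
    unfolding trilinear_form_swap(1)[of x "?A w" v z] by (simp add: mv Z_def)
  have F7: "trilinear_form x (?A z) v w = Z"
    unfolding trilinear_form_swap(1)[of x "?A z" v w] trilinear_form_swap(2)[of x v "?A z" w] by (simp add: Z_def)
  have F5: "trilinear_form x (?A w) (?A z) v = 0"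
  proof -
    have "trilinear_form x w z v = 0"
      unfolding trilinear_form_swap(2)[of x w z v] trilinear_form_swap(1)[of x w v z] by (simp add: T0)
    then show ?thesis by (simp add: mv k trilinear_form_scale)
  qed
  have wz: "form_J w z = 0"
  proof -
    have "form_J z w = form_J w z" unfolding z_def by (simp add: sa)
    then have "2 * form_J w z = 0" using form_J_swap[of z w] by simp
    with two show ?thesis by simp
  qed
  have zAw: "form_J z (?A w) = 0" using ln(6)[of v w] by (simp add: trilinear_form_def z_def)
  have Awz: "form_J (?A w) z = 0" using zAw form_J_swap[of "?A w" z] by simp
  have zAz: "form_J z (?A z) = - Z" using trilinear_form_swap(2)[of x v "?A z" w]
    by (simp add: Z_def trilinear_form_def z_def)
  \<comment> \<open>The scalars make the pairs dual: J(v, Av) = s, J(w, Aw) = r and J(z, Az) =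
    -Z.\<close>
  define col where "col = mk6 v w z ((1/s) *s ?A v) ((1/r) *s ?A w) ((1 / - Z) *s ?A z)"
  define g where "g = (\<chi> i j. col $ j $ i)"
  have g_axis: "g *v axis j 1 = col $ j" for j
    by (simp add: g_def matrix_vector_mult_def axis_def vec_eq_iff if_distrib cong: if_cong)
  have J0: "form_J v w = 0" "form_J v z = 0" "form_J z w = 0"
    "form_J (?A v) w = 0" "form_J (?A v) z = 0" "form_J (?A w) v = 0" "form_J (?A z) v = 0"
    using wv zv wz wAv zAv skew[of v w] skew[of v z] skew[of w v] skew[of z v]
      form_J_swap[of v w] form_J_swap[of v z] form_J_swap[of z w] form_J_swap[of "?A v" w]
      form_J_swap[of "?A v" z] by simp_all
  have J1: "form_J v (?A w) = 0" "form_J v (?A z) = 0" "form_J w (?A z) = 0" "form_J (?A z) w = 0"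
    using J0 Awz form_J_swap[of v "?A w"] form_J_swap[of v "?A z"] skew[of w z] form_J_swap[of "?A z" w] by simp_all
  have J2: "form_J (?A a) (?A b) = - k * form_J a b" for a b
    by (simp add: skew k form_J_scale)
  have J3: "form_J (?A v) v = - s" "form_J (?A w) w = - r" "form_J (?A z) z = Z"
    using form_J_swap[of "?A v" v] form_J_swap[of "?A w" w] form_J_swap[of "?A z" z] zAz
    by (simp_all add: s_def r_def)
  have "\<forall>i j. form_J (col $ i) (col $ j) = MJ $ i $ j"
    unfolding forall_6 col_def mk6_nth form_J_scale J2
    using s r Z0 by (simp add: J0 J1 J3 wv zv wAv zAv wz zAw Awz zAz s_def[symmetric] r_def[symmetric] MJ_entry axis_def)
  then have g: "g \<in> Sp6" by (simp add: Sp6_iff_form_J g_axis)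
  obtain h where h: "h \<in> Sp6" "h ** g = mat 1" "g ** h = mat 1" using Sp6_inverse[OF g] by blast
  have hg: "h *v (g *v u) = u" for u by (simp add: matrix_vector_mul_assoc h)
  have tri: "tri (ext3_act h x) i j l = trilinear_form x (g *v (- (MJ *v axis i 1)))
    (g *v (- (MJ *v axis j 1))) (g *v (- (MJ *v axis l 1)))" for i j l
    using trilinear_form_ext3_act[OF h(1), of x "g *v (- (MJ *v axis i 1))" "g *v (- (MJ *v axis j 1))"
      "g *v (- (MJ *v axis l 1))"]
    by (simp only: hg tri_trilinear_form)
  have dual: "g *v (- (MJ *v axis 0 1)) = (1/s) *s ?A v" "g *v (- (MJ *v axis 1 1)) = (1/r) *s ?A w"
    "g *v (- (MJ *v axis 2 1)) = (1 / - Z) *s ?A z" "g *v (- (MJ *v axis 3 1)) = (- 1) *s v"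
    "g *v (- (MJ *v axis 4 1)) = (- 1) *s w" "g *v (- (MJ *v axis 5 1)) = (- 1) *s z"
    by (simp_all only: neg_MJ_axis vector_scalar_commute g_axis col_def mk6_nth)
  have "ext3_act h x = normal_form ((1/s) * ((1/r) * ((1 / - Z) * (k * Z)))) ((1/s) * Z) (- (1/r) * Z) (- 1)"
    by (rule ext_power_3_eq_normal_form[OF ext3_act_ext_power])
      (unfold tri dual trilinear_form_scale ln F1 F2 F3 F4 F5 F6 F7 T0, use Z0 in simp_all)
  moreover have "ext3_act g (ext3_act h x) = x"
    using x by (simp add: ext3_act_compose h ext3_act_one X_space_def)
  ultimately have "y = rep_act g (normal_form ((1/s) * ((1/r) * ((1 / - Z) * (k * Z)))) ((1/s) * Z)
    (- (1/r) * Z) (- 1), axis 0 1)"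
    unfolding y_eq rep_act_def by (simp add: g_axis col_def)
  then show thesis
    by (rule that[OF g, rotated -1]) (use s r Z0 k0 in simp_all)
qed

lemma phi_normal_form:
  "phi (normal_form a b c d) = mk6 (mk6 0 0 0 (2*a*b) 0 0) (mk6 0 0 0 0 (- 2*a*c) 0) (mk6 0 0 0 0 0 (2*a*d))
    (mk6 (- 2*c*d) 0 0 0 0 0) (mk6 0 (2*b*d) 0 0 0 0) (mk6 0 0 (- 2*b*c) 0 0 0)"
  by (simp add: vec_eq_iff forall_6 phi_components[OF normal_form_ext_power] tri_sort tri_normal_form)

lemma normal_form_Vss:
  fixes a b c d :: "'a::field"
  assumes nz: "a \<noteq> 0" "b \<noteq> 0" "c \<noteq> 0" "d \<noteq> 0" and two: "(2::'a) \<noteq> 0"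
  shows "(normal_form a b c d, axis 0 1) \<in> Vss"
proof -
  have four: "(4::'a) \<noteq> 0" using two mult_eq_0_iff[of "2::'a" 2] by simp
  have "phi (normal_form a b c d) ** phi (normal_form a b c d) = mat (- 4 * (a * b * c * d))"
    unfolding phi_normal_form
    by (simp add: vec_eq_iff forall_6 matrix_matrix_mult_def sum_6 mat_def algebra_simps)
  then have "f1 (normal_form a b c d) = a * b * c * d"
    using four by (simp add: f1_def f_quartic_eq)
  moreover have "f2 (normal_form a b c d, axis 0 1) = c * d"
    unfolding f2_form_J phi_normal_form using two
    by (simp add: form_J_6 matrix_vector_mult_def sum_6 axis_def)
  moreover have "normal_form a b c d \<in> X_space"
  proof -
    have "\<forall>i. psi (normal_form a b c d) $ i = 0"
      unfolding psi_component forall_6 by (simp add: tri_sort tri_normal_form)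
    then show ?thesis by (simp add: X_space_def normal_form_ext_power vec_eq_iff)
  qed
  ultimately show ?thesis using nz by (simp add: Vss_def)
qed

section \<open>The stabilizer of a normal form\<close>

text \<open>
  With \<open>i = contr x e\<^sub>1\<close>, \<open>j = contr x e\<^sub>4\<close> for the normal form \<open>x\<close>, the span of \<open>e\<^sub>2, e\<^sub>3, e\<^sub>5, e\<^sub>6\<close> has the
  basis \<open>e\<^sub>2, i e\<^sub>2, j e\<^sub>2, ij e\<^sub>2\<close>,
    and \<open>stab_matrix q\<close> maps \<open>z e\<^sub>2\<close> to \<open>z q\<^sup>* e\<^sub>2\<close> with \<open>q\<^sup>*\<close> the conjugate of \<open>q\<close>.
\<close>

definition stab_matrix :: "'a::comm_ring_1 \<Rightarrow> 'a \<Rightarrow> 'a \<Rightarrow> 'a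
  \<Rightarrow> 'a ^ 4 \<Rightarrow> 'a ^ 6 ^ 6" where
  "stab_matrix a b c d q = mk6
     (mk6 1 0 0 0 0 0)
     (mk6 0 (q$1) (c * q$2) 0 (- (a * c * q$4)) (- (a * q$3)))
     (mk6 0 (d * q$2) (q$1) 0 (- (a * q$3)) (- (a * d * q$4)))
     (mk6 0 0 0 1 0 0)
     (mk6 0 (b * d * q$4) (- (b * q$3)) 0 (q$1) (- (d * q$2)))
     (mk6 0 (- (b * q$3)) (b * c * q$4) 0 (- (c * q$2)) (q$1))"

text \<open>Right multiplication by the conjugate preserves the order of the factors, because
  conjugation reverses products.\<close>

lemma stab_matrix_mult:
  "stab_matrix a b c d p ** stab_matrix a b c d q = stab_matrix a b c d (quat_mult (c * d) (a * b) p q)"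
  by (simp add: vec_eq_iff forall_6 stab_matrix_def matrix_matrix_mult_def sum_6 algebra_simps)

lemma stab_matrix_Sp6:
  fixes q :: "'a::field ^ 4"
  assumes "quat_norm (c * d) (a * b) q = 1"
  shows "stab_matrix a b c d q \<in> Sp6"
proof -
  let ?N = "quat_norm (c * d) (a * b) q"
  let ?M = "stab_matrix a b c d q"
  have "\<forall>i j. (transpose ?M ** (MJ ** ?M)) $ i $ j = (mk6 (mk6 0 0 0 1 0 0) (mk6 0 0 0 0 ?N 0)
    (mk6 0 0 0 0 0 ?N)
    (mk6 (- 1) 0 0 0 0 0) (mk6 0 (- ?N) 0 0 0 0) (mk6 0 0 (- ?N) 0 0 0)) $ i $ j"
    unfolding forall_6 matrix_matrix_mult_def[of "transpose ?M"] vec_lambda_beta sum_6 MJ_phi mk6_nth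
    by (simp add: transpose_def stab_matrix_def quat_norm_def power2_eq_square algebra_simps)
  then have "transpose ?M ** (MJ ** ?M) = mk6 (mk6 0 0 0 1 0 0) (mk6 0 0 0 0 ?N 0) (mk6 0 0 0 0 0 ?N)
    (mk6 (- 1) 0 0 0 0 0) (mk6 0 (- ?N) 0 0 0 0) (mk6 0 0 (- ?N) 0 0 0)"
    by (simp add: vec_eq_iff)
  also have "\<dots> = MJ"
    unfolding assms by (simp add: vec_eq_iff forall_6 MJ_entry axis_def)
  finally show ?thesis by (simp add: Sp6_transpose matrix_mul_assoc)
qed

lemma tri_ext3_act_normal_form:
  fixes g :: "'a::field ^ 6 ^ 6"
  shows "tri (ext3_act g (normal_form a b c d)) i j l =
    a * (g$i$0 * (g$j$1 * g$l$2 - g$j$2 * g$l$1) - g$i$1 * (g$j$0 * g$l$2 - g$j$2 * g$l$0)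
      + g$i$2 * (g$j$0 * g$l$1 - g$j$1 * g$l$0))
    + b * (g$i$0 * (g$j$4 * g$l$5 - g$j$5 * g$l$4) - g$i$4 * (g$j$0 * g$l$5 - g$j$5 * g$l$0)
      + g$i$5 * (g$j$0 * g$l$4 - g$j$4 * g$l$0))
    + c * (g$i$1 * (g$j$3 * g$l$5 - g$j$5 * g$l$3) - g$i$3 * (g$j$1 * g$l$5 - g$j$5 * g$l$1)
      + g$i$5 * (g$j$1 * g$l$3 - g$j$3 * g$l$1))
    + d * (g$i$2 * (g$j$3 * g$l$4 - g$j$4 * g$l$3) - g$i$3 * (g$j$2 * g$l$4 - g$j$4 * g$l$2)
      + g$i$4 * (g$j$2 * g$l$3 - g$j$3 * g$l$2))"
proof -
  have col: "(g *v axis i 1) $ a = g$a$i" for a i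
    by (simp add: matrix_vector_mult_def axis_def if_distrib cong: if_cong)
  have lin: "linear_ext3 h (normal_form a b c d) = a *s h 0 1 2 + b *s h 0 4 5 + c *s h 1 3 5 + d *s h 2 3 4"
    for h :: "6 \<Rightarrow> 6 \<Rightarrow> 6 \<Rightarrow> 'a ^ (6 set)"
    unfolding linear_ext3_def sum_triples_6 using tri_normal_form[of a b c d]
    by (simp add: tri_sorted)
  show ?thesis
    unfolding ext3_act_def lin tri_add tri_scale tri_wedge3 col by (simp add: algebra_simps)
qed

text \<open>The matrix scales the four coefficients of the normal form by the norm of
  \<open>q\<close> and keeps the others zero.\<close>

lemma stab_matrix_normal_form:
  fixes q :: "'a::field ^ 4"
  assumes N: "quat_norm (c * d) (a * b) q = 1"
  shows "ext3_act (stab_matrix a b c d q) (normal_form a b c d) = normal_form a b c d"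
proof -
  have "tri (ext3_act (stab_matrix a b c d q) (normal_form a b c d)) 0 1 2 = a * quat_norm (c * d) (a * b) q"
    "tri (ext3_act (stab_matrix a b c d q) (normal_form a b c d)) 0 4 5 = b * quat_norm (c * d) (a * b) q"
    "tri (ext3_act (stab_matrix a b c d q) (normal_form a b c d)) 1 3 5 = c * quat_norm (c * d) (a * b) q"
    "tri (ext3_act (stab_matrix a b c d q) (normal_form a b c d)) 2 3 4 = d * quat_norm (c * d) (a * b) q"
    unfolding tri_ext3_act_normal_form
    by (simp_all add: stab_matrix_def quat_norm_def power2_eq_square algebra_simps)
  note main = this[unfolded N mult_1_right]
  show ?thesis
    by (rule ext_power_3_eq_normal_form[OF ext3_act_ext_power main])
      (unfold tri_ext3_act_normal_form, simp_all add: stab_matrix_def algebra_simps)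
qed

lemma contr_normal_form:
  "contr (normal_form a b c d) (axis 0 1) *v u = mk6 0 (- (c * u$2)) (- (d * u$1)) 0 (- (d * u$5)) (- (c * u$4))"
  "contr (normal_form a b c d) (axis 3 1) *v u = mk6 0 (a * u$5) (- (a * u$4)) 0 (- (b * u$2)) (b * u$1)"
  unfolding vec_eq_iff forall_6 contr_mult sum_6 MJ_mult_components mk6_nth
  by (simp_all add: axis_def tri_sort tri_normal_form)

text \<open>An element g of the stabilizer commutes with \<open>?B\<close>, whose kernel is spanned
  by e_1 and e_4; since J(e_1, g e_4) = 1, this leaves g e_4 = e_4 + t e_1. Once t = 0, g also
  commutes with \<open>?C\<close> and is determined by the image p of e_2, which generates the span
  of e_2, e_3, e_5, e_6 under the two operators.\<close>

lemma stabilizer_normal_form: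
  fixes a b c d :: "'a::field"
  assumes nz: "a \<noteq> 0" "b \<noteq> 0" "c \<noteq> 0" "d \<noteq> 0" and two: "(2::'a) \<noteq> 0"
  shows "stabilizer (normal_form a b c d, axis 0 1) = stab_matrix a b c d ` SL1 (c * d) (a * b)"
proof (intro equalityI subsetI)
  fix g assume "g \<in> stab_matrix a b c d ` SL1 (c * d) (a * b)"
  then obtain q where q: "g = stab_matrix a b c d q" "quat_norm (c * d) (a * b) q = 1"
    by (auto simp: SL1_def)
  have "stab_matrix a b c d q *v axis 0 1 = axis 0 1"
    by (simp add: vec_eq_iff forall_6 matrix_vector_mult_def sum_6 stab_matrix_def axis_def)
  then show "g \<in> stabilizer (normal_form a b c d, axis 0 1)"
    by (simp add: stabilizer_def rep_act_def q stab_matrix_Sp6 stab_matrix_normal_form)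
next
  fix g assume "g \<in> stabilizer (normal_form a b c d, axis 0 1)"
  then have g: "g \<in> Sp6" and gx: "ext3_act g (normal_form a b c d) = normal_form a b c d"
    and g0: "g *v axis 0 1 = axis 0 1" by (auto simp: stabilizer_def rep_act_def)
  let ?B = "\<lambda>u. contr (normal_form a b c d) (axis 0 1) *v u"
  let ?C = "\<lambda>u. contr (normal_form a b c d) (axis 3 1) *v u"
  define G where "G j = g *v axis j 1" for j
  have B: "?B u = mk6 0 (- (c * u$2)) (- (d * u$1)) 0 (- (d * u$5)) (- (c * u$4))" for u
    by (rule contr_normal_form)
  have C: "?C u = mk6 0 (a * u$5) (- (a * u$4)) 0 (- (b * u$2)) (b * u$1)" for u
    by (rule contr_normal_form)
  have gB: "?B (g *v u) = g *v ?B u" for u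
    using contr_ext3_act[OF g, of "normal_form a b c d" "axis 0 1" u] by (simp add: gx g0)
  have J: "form_J (g *v u) (g *v v) = form_J u v" for u v by (rule form_J_Sp6[OF g])
  have mult0: "g *v 0 = 0" by simp
  have "?B (axis 3 1) = 0"
    unfolding B vec_eq_iff forall_6 mk6_nth by (simp add: axis_def)
  then have "?B (G 3) = 0" unfolding G_def gB by simp
  then have "G 3 $ 1 = 0" "G 3 $ 2 = 0" "G 3 $ 4 = 0" "G 3 $ 5 = 0"
    using nz by (simp_all add: B vec_eq_iff forall_6)
  moreover have "G 3 $ 3 = 1"
    using J[of "axis 0 1" "axis 3 1"] unfolding g0 G_def by (simp add: form_J_6 axis_def)
  ultimately have G3: "G 3 = G 3 $ 0 *s axis 0 1 + axis 3 1"
    by (simp add: vec_eq_iff forall_6 axis_def)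
  define t where "t = G 3 $ 0"
  have gC: "t *s ?B (g *v u) + ?C (g *v u) = g *v ?C u" for u
  proof -
    have "contr (normal_form a b c d) (G 3) *v (g *v u) = g *v ?C u"
      using contr_ext3_act[OF g, of "normal_form a b c d" "axis 3 1" u] by (simp add: gx G_def)
    then show ?thesis
      by (subst (asm) G3) (simp add: contr_linear_left matrix_vector_mult_add_rdistrib t_def)
  qed
  have anti: "?B (?C u) + ?C (?B u) = 0" for u
    by (simp add: B C vec_eq_iff forall_6 mult_ac)
  \<comment> \<open>\<open>?B\<close> and \<open>?C\<close> anticommute. Conjugation by g fixes
    \<open>?B\<close> and turns \<open>?C\<close> into \<open>?C + t ?B\<close>; these still
    anticommute only if 2 t c d = 0.\<close>
  have "t = 0"
  proof -
    obtain h where h: "g ** h = mat 1" using Sp6_inverse[OF g] by blast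
    define u where "u = h *v axis 1 1"
    have u: "g *v u = axis 1 1" by (simp add: u_def matrix_vector_mul_assoc h)
    have "t *s ?B (?B (g *v u)) + ?C (?B (g *v u)) = g *v ?C (?B u)"
      using gC[of "?B u"] by (simp add: gB)
    moreover have "t *s ?B (?B (g *v u)) + ?B (?C (g *v u)) = g *v ?B (?C u)"
      unfolding gB[of "?C u", symmetric] gC[of u, symmetric]
      by (simp add: matrix_vector_right_distrib vector_scalar_commute)
    ultimately have "(t *s ?B (?B (g *v u)) + ?C (?B (g *v u))) + (t *s ?B (?B (g *v u)) + ?B (?C (g *v u)))
       = g *v (?B (?C u) + ?C (?B u))"
      by (simp only: matrix_vector_right_distrib add.commute)
    then have "(t *s ?B (?B (g *v u)) + ?C (?B (g *v u))) + (t *s ?B (?B (g *v u)) + ?B (?C (g *v u))) = 0"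
      unfolding anti by simp
    then have "t *s ?B (?B (g *v u)) + t *s ?B (?B (g *v u)) + (?B (?C (g *v u)) + ?C (?B (g *v u))) = 0"
      by (simp only: ac_simps)
    then have sum: "(t *s ?B (?B (axis 1 1)) + t *s ?B (?B (axis 1 1))) $ 1 = 0"
      unfolding anti u by simp
    have "?B (?B (axis 1 1)) = (c * d) *s axis 1 1"
      unfolding B mk6_nth vec_eq_iff forall_6 by (simp add: axis_def)
    then have "2 * (t * (c * d)) = 0"
      using sum by (simp add: axis_def flip: mult_2)
    with nz two show ?thesis by simp
  qed
  then have G3: "G 3 = axis 3 1" using G3 by (simp add: t_def)
  have gC: "?C (g *v u) = g *v ?C u" for u using gC[of u] \<open>t = 0\<close> by simp
  define p where "p = G 1"
  have p3: "p $ 3 = 0"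
    using J[of "axis 0 1" "axis 1 1"] unfolding g0 p_def G_def by (simp add: form_J_6 axis_def)
  have p0: "p $ 0 = 0"
    using J[of "axis 3 1" "axis 1 1"] G3 unfolding p_def G_def by (simp add: form_J_6 axis_def)
  have G2: "?B p = - d *s G 2"
  proof -
    have "?B (axis 1 1) = - d *s axis 2 1"
      unfolding B vec_eq_iff forall_6 mk6_nth by (simp add: axis_def)
    then show ?thesis unfolding p_def G_def gB by (simp add: vector_scalar_commute matrix_vector_mult_neg)
  qed
  have G5: "?C p = b *s G 5"
  proof -
    have "?C (axis 1 1) = b *s axis 5 1"
      unfolding C vec_eq_iff forall_6 mk6_nth by (simp add: axis_def)
    then show ?thesis unfolding p_def G_def gC by (simp add: vector_scalar_commute matrix_vector_mult_neg)
  qed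
  have G4: "?B (G 5) = - d *s G 4"
  proof -
    have "?B (axis 5 1) = - d *s axis 4 1"
      unfolding B vec_eq_iff forall_6 mk6_nth by (simp add: axis_def)
    then show ?thesis unfolding G_def gB by (simp add: vector_scalar_commute matrix_vector_mult_neg)
  qed
  have c2: "G 2 = mk6 0 (c * p$2 / d) (p$1) 0 (p$5) (c * p$4 / d)"
  proof -
    have "G 2 = (- 1 / d) *s ?B p" unfolding G2 using nz by (simp add: vec_eq_iff)
    then show ?thesis unfolding B using nz by (simp add: vec_eq_iff forall_6)
  qed
  have c5: "G 5 = mk6 0 (a * p$5 / b) (- (a * p$4 / b)) 0 (- p$2) (p$1)"
  proof -
    have "G 5 = (1 / b) *s ?C p" unfolding G5 using nz by (simp add: vec_eq_iff)
    then show ?thesis unfolding C using nz by (simp add: vec_eq_iff forall_6)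
  qed
  have c4: "G 4 = mk6 0 (- (a * c * p$4 / (b * d))) (a * p$5 / b) 0 (p$1) (- (c * p$2 / d))"
  proof -
    have "G 4 = (- 1 / d) *s ?B (G 5)" unfolding G4 using nz by (simp add: vec_eq_iff)
    then show ?thesis unfolding B c5 mk6_nth using nz by (simp add: vec_eq_iff forall_6 field_simps)
  qed
  \<comment> \<open>Chosen so that p is the second column of \<open>stab_matrix a b c d q\<close>.
    The relation J(p, g e_5) = 1 then becomes the norm condition on q.\<close>
  define q :: "'a ^ 4" where "q = vector [p$1, p$2 / d, - p$5 / b, p$4 / (b * d)]"
  have "form_J p (G 4) = 1"
    using J[of "axis 1 1" "axis 4 1"] unfolding p_def G_def by (simp add: form_J_6 axis_def)
  moreover have "quat_norm (c * d) (a * b) q = form_J p (G 4)"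
    using nz by (simp add: form_J_6 c4 p0 p3 quat_norm_def q_def power2_eq_square field_simps)
  ultimately have "quat_norm (c * d) (a * b) q = 1" by simp
  moreover have "g = stab_matrix a b c d q"
  proof -
    have col: "g $ i $ j = G j $ i" for i j
      by (simp add: G_def matrix_vector_mult_def axis_def if_distrib cong: if_cong)
    have c0: "G 0 = axis 0 1" by (simp add: G_def g0)
    have c1: "G 1 = p" by (simp add: p_def)
    show ?thesis
      unfolding vec_eq_iff forall_6 col c0 c1 c2 G3 c4 c5 using nz
      by (simp add: stab_matrix_def q_def p0 p3 axis_def)
  qed
  ultimately show "g \<in> stab_matrix a b c d ` SL1 (c * d) (a * b)" by (auto simp: SL1_def)
qed

section \<open>Quadratic forms and reduced Freudenthal algebras\<close>

definition dbil :: "'a::comm_ring_1 ^ 'n \<Rightarrow> 'a ^ 'n \<Rightarrow> 'a ^ 'n \<Rightarrow> 'a" where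
  "dbil a x y = (\<Sum>i\<in>UNIV. a $ i * x $ i * y $ i)"

lemma dbil_linear:
  "dbil a (x + y) z = dbil a x z + dbil a y z" "dbil a z (x + y) = dbil a z x + dbil a z y"
  "dbil a (x - y) z = dbil a x z - dbil a y z" "dbil a z (x - y) = dbil a z x - dbil a z y"
  "dbil a (c *s x) z = c * dbil a x z" "dbil a z (c *s x) = c * dbil a z x"
  "dbil a (- x) z = - dbil a x z" "dbil a z (- x) = - dbil a z x"
  by (simp_all add: dbil_def sum.distrib sum_subtractf sum_distrib_left sum_negf algebra_simps)

lemma dbil_commute: "dbil a x y = dbil a y x"
  by (simp add: dbil_def mult_ac)

lemma diag_form_dbil: "diag_form a x = dbil a x x"
  by (simp add: diag_form_def dbil_def power2_eq_square mult_ac)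

lemma isometry_dbil:
  fixes a :: "'a::field ^ 'n" and b :: "'a ^ 'm"
  assumes iso: "\<And>x. diag_form b (f x) = diag_form a x" and add: "\<And>x y. f (x + y) = f x + f y"
    and two: "(2::'a) \<noteq> 0"
  shows "dbil b (f x) (f y) = dbil a x y"
proof -
  have "2 * dbil b (f x) (f y) = diag_form b (f (x + y)) - diag_form b (f x) - diag_form b (f y)"
    unfolding add diag_form_dbil by (simp add: dbil_linear dbil_commute[of b "f y" "f x"])
  also have "\<dots> = 2 * dbil a x y"
    unfolding iso unfolding diag_form_dbil by (simp add: dbil_linear dbil_commute[of a y x])
  finally show ?thesis using two by simp
qed

definition reflect :: "'a::field ^ 'n \<Rightarrow> 'a ^ 'n \<Rightarrow> 'a ^ 'n \<Rightarrow> 'a ^ 'n" where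
  "reflect a w x = x - (2 * dbil a x w / dbil a w w) *s w"

lemma reflect_isometry:
  assumes "dbil a w w \<noteq> 0"
  shows "dbil a (reflect a w x) (reflect a w y) = dbil a x y"
  using assms by (simp add: reflect_def dbil_linear dbil_commute[of a w x] dbil_commute[of a w y] field_simps)

text \<open>One of the reflections along \<open>u - e\<close> and \<open>u + e\<close> exists and maps \<open>u\<close> to \<open>e\<close> up to sign.\<close>

lemma isometry_moving_vector:
  fixes a :: "'a::field ^ 'n"
  assumes u: "dbil a u u = dbil a e e" and e: "dbil a e e \<noteq> 0" and two: "(2::'a) \<noteq> 0"
  obtains f :: "'a ^ 'n \<Rightarrow> 'a ^ 'n" where "\<And>x y. dbil a (f x) (f y) = dbil a x y" "f u = e"
proof (cases "dbil a (u - e) (u - e) = 0")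
  case False
  have "dbil a (u - e) (u - e) = 2 * dbil a u (u - e)"
    by (simp add: dbil_linear u dbil_commute[of a e u])
  then have "2 * dbil a u (u - e) / dbil a (u - e) (u - e) = 1" using False by simp
  then have "reflect a (u - e) u = e" by (simp only: reflect_def) simp
  then show ?thesis using that reflect_isometry[OF False] by blast
next
  case True
  have "dbil a (u - e) (u - e) + dbil a (u + e) (u + e) = 2 * 2 * dbil a e e"
    by (simp add: dbil_linear u dbil_commute[of a e u])
  moreover have "2 * 2 * dbil a e e \<noteq> 0" using e two by (simp only: mult_eq_0_iff) simp
  ultimately have w: "dbil a (u + e) (u + e) \<noteq> 0" using True by auto
  have "dbil a (u + e) (u + e) = 2 * dbil a u (u + e)"
    by (simp add: dbil_linear u dbil_commute[of a e u])
  then have "2 * dbil a u (u + e) / dbil a (u + e) (u + e) = 1" using w by simp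
  then have "- reflect a (u + e) u = e" by (simp only: reflect_def) simp
  moreover have "dbil a (- reflect a (u + e) x) (- reflect a (u + e) y) = dbil a x y" for x y
    by (simp only: dbil_linear minus_minus reflect_isometry[OF w])
  ultimately show ?thesis using that[of "\<lambda>x. - reflect a (u + e) x"] by blast
qed

text \<open>Places the indices of a ternary form at the last three positions of a quaternary
  one.\<close>

definition succ4 :: "3 \<Rightarrow> 4" where
  "succ4 i = (if i = 1 then 2 else if i = 2 then 3 else 4)"

lemma succ4_simps [simp]: "succ4 1 = 2" "succ4 2 = 3" "succ4 3 = 4"
  by (simp_all add: succ4_def)

text \<open>Witt cancellation of the summand 1: after the image of e_1 has been moved back to e_1,
  first coordinates are preserved, so the images of the other basis vectors have none. The
  conclusion concerns only the Gram matrix of these images, for which \<open>h\<close> has to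
  preserve the bilinear form but need not be shown linear.\<close>

lemma isometric_cancel_one:
  fixes a b :: "'a::field ^ 3"
  assumes iso: "isometric (diag_form (vector [1, a$1, a$2, a$3] :: 'a ^ 4))
    (diag_form (vector [1, b$1, b$2, b$3] :: 'a ^ 4))"
    and two: "(2::'a) \<noteq> 0"
  obtains P :: "'a ^ 3 ^ 3" where
    "\<And>i j. (\<Sum>l\<in>UNIV. b $ l * P $ l $ i * P $ l $ j) = (if i = j then a $ i else 0)"
proof -
  let ?a = "vector [1, a$1, a$2, a$3] :: 'a ^ 4" and ?b = "vector [1, b$1, b$2, b$3] :: 'a ^ 4"
  let ?e = "axis 1 1 :: 'a ^ 4"
  obtain T :: "'a ^ 4 ^ 4" where T: "\<And>x. diag_form ?b (T *v x) = diag_form ?a x"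
    using iso by (auto simp: isometric_def)
  have T': "dbil ?b (T *v x) (T *v y) = dbil ?a x y" for x y
    by (rule isometry_dbil[OF T _ two]) (rule matrix_vector_right_distrib)
  have e: "dbil ?a ?e x = x $ 1" "dbil ?b ?e x = x $ 1" for x
    by (simp_all add: dbil_def sum_4 axis_def)
  have "dbil ?b (T *v ?e) (T *v ?e) = dbil ?b ?e ?e" unfolding T' e ..
  then obtain f where f: "\<And>x y. dbil ?b (f x) (f y) = dbil ?b x y" "f (T *v ?e) = ?e"
    using isometry_moving_vector[of ?b "T *v ?e" ?e] two by (auto simp: e)
  define h where "h x = f (T *v x)" for x
  have h: "dbil ?b (h x) (h y) = dbil ?a x y" for x y by (simp add: h_def f T')
  have h1: "h x $ 1 = x $ 1" for x
    using h[of ?e x] by (simp add: h_def f(2) e)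
  define P :: "'a ^ 3 ^ 3" where "P = (\<chi> l i. h (axis (succ4 i) 1) $ succ4 l)"
  have "(\<Sum>l\<in>UNIV. b $ l * P $ l $ i * P $ l $ j) = (if i = j then a $ i else 0)" for i j
  proof -
    have ne: "succ4 i \<noteq> 1" for i by (simp add: succ4_def)
    have "(\<Sum>l\<in>UNIV. b $ l * P $ l $ i * P $ l $ j) = dbil ?b (h (axis (succ4 i) 1)) (h (axis (succ4 j) 1))"
      unfolding dbil_def sum_4 sum_3 h1 using ne[of i] by (simp add: P_def axis_def)
    also have "\<dots> = dbil ?a (axis (succ4 i) 1) (axis (succ4 j) 1)" by (rule h)
    also have "\<dots> = (if i = j then a $ i else 0)"
      using exhaust_3[of i] exhaust_3[of j] by (auto simp: dbil_def sum_4 axis_def)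
    finally show ?thesis .
  qed
  then show thesis by (rule that)
qed

section \<open>Isomorphisms between the algebras H3(k, Gamma)\<close>

lemma alg_iso_trans:
  assumes "alg_iso A B" "alg_iso B C"
  shows "alg_iso A C"
proof -
  from assms obtain h k where h: "bij_betw h (acarrier A) (acarrier B)"
    "\<And>x y. x \<in> acarrier A \<Longrightarrow> y \<in> acarrier A \<Longrightarrow> h (x + y) = h x
      + h y \<and> h (amult A x y) = amult B (h x) (h y)"
    "\<And>a x. x \<in> acarrier A \<Longrightarrow> h (ascale A a x) = ascale B a (h x)"
    and k: "bij_betw k (acarrier B) (acarrier C)"
    "\<And>x y. x \<in> acarrier B \<Longrightarrow> y \<in> acarrier B \<Longrightarrow> k (x + y) = k x
      + k y \<and> k (amult B x y) = amult C (k x) (k y)"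
    "\<And>a x. x \<in> acarrier B \<Longrightarrow> k (ascale B a x) = ascale C a (k x)"
    unfolding alg_iso_def by blast
  have mem: "h x \<in> acarrier B" if "x \<in> acarrier A" for x using h(1) that by (rule bij_betw_apply)
  show ?thesis unfolding alg_iso_def
    by (rule exI[of _ "k \<circ> h"]) (use h k mem in \<open>auto intro: bij_betw_trans\<close>)
qed

text \<open>The inverse map respects an operation only where the result stays in the carrier; hence
  the closure assumptions.\<close>

lemma alg_iso_sym:
  assumes iso: "alg_iso A B"
    and closed: "\<And>x y. x \<in> acarrier A \<Longrightarrow> y \<in> acarrier A \<Longrightarrow> x
      + y \<in> acarrier A \<and> amult A x y \<in> acarrier A"
    "\<And>a x. x \<in> acarrier A \<Longrightarrow> ascale A a x \<in> acarrier A"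
  shows "alg_iso B A"
proof -
  from iso obtain h where bij: "bij_betw h (acarrier A) (acarrier B)"
    and h: "\<And>x y. x \<in> acarrier A \<Longrightarrow> y \<in> acarrier A \<Longrightarrow> h (x
      + y) = h x + h y \<and> h (amult A x y) = amult B (h x) (h y)"
    "\<And>a x. x \<in> acarrier A \<Longrightarrow> h (ascale A a x) = ascale B a (h x)"
    unfolding alg_iso_def by blast
  let ?k = "inv_into (acarrier A) h"
  have k: "?k y \<in> acarrier A" "h (?k y) = y" if "y \<in> acarrier B" for y
    using bij that by (auto simp: bij_betw_def inv_into_into f_inv_into_f)
  have inv: "?k (h x) = x" if "x \<in> acarrier A" for x using bij that by (simp add: bij_betw_def)
  show ?thesis unfolding alg_iso_def
  proof (intro exI[of _ ?k] conjI ballI allI)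
    show "bij_betw ?k (acarrier B) (acarrier A)" by (rule bij_betw_inv_into[OF bij])
    fix x y a assume x: "x \<in> acarrier B"
    show "?k (ascale B a x) = ascale A a (?k x)"
      using inv[OF closed(2)[OF k(1)[OF x], of a]] h(2)[OF k(1)[OF x], of a] k(2)[OF x] by simp
    assume y: "y \<in> acarrier B"
    show "?k (x + y) = ?k x + ?k y" "?k (amult B x y) = amult A (?k x) (?k y)"
      using inv[of "?k x + ?k y"] inv[of "amult A (?k x) (?k y)"] closed(1)[OF k(1)[OF x] k(1)[OF y]]
        h(1)[OF k(1)[OF x] k(1)[OF y]] k(2)[OF x] k(2)[OF y] by simp_all
  qed
qed

definition diag_matrix :: "'a::zero ^ 'n \<Rightarrow> 'a ^ 'n ^ 'n" where
  "diag_matrix g = (\<chi> i j. if i = j then g $ i else 0)"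

lemma diag_matrix_mult: "diag_matrix g ** Y = (\<chi> i j. g $ i * Y $ i $ j)"
  for g :: "'a::comm_ring_1 ^ 'n"
proof -
  have "(if i = l then g $ i else 0) * Y $ l $ j = (if i = l then g $ i * Y $ i $ j else 0)" for i l j by simp
  then show ?thesis by (simp add: matrix_matrix_mult_def diag_matrix_def vec_eq_iff)
qed

text \<open>Conjugation is trivial on the base field, so membership says that Gamma Y is symmetric,
  that is, Y is self-adjoint for the form Gamma.\<close>

lemma H3_base:
  fixes g :: "'a::field ^ 3"
  assumes g: "\<And>i. g $ i \<noteq> 0"
  shows "acarrier (H3 base_comp_alg g) = {Y. transpose (diag_matrix g ** Y) = diag_matrix g ** Y}"
    and "ascale (H3 base_comp_alg g) = (\<lambda>a Y. \<chi> i j. a * Y $ i $ j)"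
    and "amult (H3 base_comp_alg g) = (\<lambda>Y Z. \<chi> i j. 1/2 * (Y ** Z + Z ** Y) $ i $ j)"
proof -
  have conj: "cconj base_comp_alg x = (x :: 'a)" for x
    by (simp add: cconj_def cpolar_def base_comp_alg_def power2_eq_square algebra_simps)
  have "(Y $ i $ j = inverse (g $ i) * g $ j * Y $ j $ i) = (g $ j * Y $ j $ i = g $ i * Y $ i $ j)" for Y ::
    "'a ^ 3 ^ 3" and i j
    using g[of i] by (auto simp: field_simps)
  then show "acarrier (H3 base_comp_alg g) = {Y. transpose (diag_matrix g ** Y) = diag_matrix g ** Y}"
    unfolding H3_def by (simp add: conj diag_matrix_mult transpose_def vec_eq_iff) (simp add: base_comp_alg_def)
  show "ascale (H3 base_comp_alg g) = (\<lambda>a Y. \<chi> i j. a * Y $ i $ j)"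
    by (simp add: H3_def mat3_scale_def base_comp_alg_def fun_eq_iff)
  show "amult (H3 base_comp_alg g) = (\<lambda>Y Z. \<chi> i j. 1/2 * (Y ** Z + Z ** Y) $ i $ j)"
    by (simp add: H3_def mat3_scale_def mat3_mult_def base_comp_alg_def fun_eq_iff matrix_matrix_mult_def)
qed

lemma H3_base_closed:
  fixes g :: "'a::field ^ 3"
  assumes g: "\<And>i. g $ i \<noteq> 0"
    and "x \<in> acarrier (H3 base_comp_alg g)" "y \<in> acarrier (H3 base_comp_alg g)"
  shows "x + y \<in> acarrier (H3 base_comp_alg g)" "amult (H3 base_comp_alg g) x y \<in> acarrier (H3 base_comp_alg g)"
    "ascale (H3 base_comp_alg g) a x \<in> acarrier (H3 base_comp_alg g)"
proof -
  have x: "g $ j * x $ j $ i = g $ i * x $ i $ j" and y: "g $ j * y $ j $ i = g $ i * y $ i $ j" for i j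
    using assms(2,3) unfolding H3_base(1)[OF g] by (simp_all add: diag_matrix_mult transpose_def vec_eq_iff)
  show "x + y \<in> acarrier (H3 base_comp_alg g)" "ascale (H3 base_comp_alg g) a x \<in> acarrier (H3 base_comp_alg g)"
    unfolding H3_base[OF g] using x y
    by (simp_all add: diag_matrix_mult transpose_def vec_eq_iff distrib_left mult.left_commute)
  have swap: "g $ j * (u $ j $ l * v $ l $ i) = g $ i * (v $ i $ l * u $ l $ j)"
    if u: "\<And>i j. g $ j * u $ j $ i = g $ i * u $ i $ j" and v: "\<And>i j. g $ j * v $ j $ i = g $ i * v $ i $ j"
    for u v :: "'a ^ 3 ^ 3" and i j l
  proof -
    have "g $ j * (u $ j $ l * v $ l $ i) = u $ l $ j * (g $ l * v $ l $ i)"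
      unfolding mult.assoc[symmetric] u[of j l] by (simp only: mult_ac)
    then show ?thesis unfolding v[of l i] by (simp only: mult_ac)
  qed
  have "g $ j * (x ** y) $ j $ i = g $ i * (y ** x) $ i $ j"
    "g $ j * (y ** x) $ j $ i = g $ i * (x ** y) $ i $ j" for i j
    unfolding matrix_matrix_mult_def vec_lambda_beta sum_distrib_left
    by (rule sum.cong[OF refl], rule swap[OF x y]) (rule sum.cong[OF refl], rule swap[OF y x])
  then have "g $ j * ((x ** y) $ j $ i + (y ** x) $ j $ i) = g $ i * ((x ** y) $ i $ j + (y ** x) $ i $ j)" for i j
    by (simp only: distrib_left add.commute)
  then show "amult (H3 base_comp_alg g) x y \<in> acarrier (H3 base_comp_alg g)"
    unfolding H3_base[OF g] by (simp add: diag_matrix_mult transpose_def vec_eq_iff mult.left_commute)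
qed

text \<open>Only the ratios of the entries of Gamma enter the definition, so similar forms can be
  treated as isometric ones.\<close>

lemma H3_scale:
  assumes "m \<noteq> 0"
  shows "H3 C (m *s g) = H3 C (g :: 'a::field ^ 3)"
proof -
  have "inverse (m * g $ i) * (m * g $ j) = inverse (g $ i) * g $ j" for i j
    using assms by (simp add: field_simps)
  then show ?thesis unfolding H3_def by (simp only: vector_smult_component)
qed

text \<open>An isometry Q between the two diagonal forms conjugates the self-adjoint endomorphisms
  of one into those of the other. Its inverse R is explicit, since Q^t diag(h) Q = diag(g).\<close>

lemma H3_base_congruent:
  fixes g h :: "'a::field ^ 3"
  assumes g: "\<And>i. g $ i \<noteq> 0" and h: "\<And>i. h $ i \<noteq> 0"
    and Q: "\<And>i j. (\<Sum>l\<in>UNIV. h $ l * Q $ l $ i * Q $ l $ j) = (if i = j then g $ i else 0)"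
  shows "alg_iso (H3 base_comp_alg g) (H3 base_comp_alg h)"
proof -
  let ?g = "diag_matrix g" and ?h = "diag_matrix h"
  define R where "R = diag_matrix (\<chi> i. inverse (g $ i)) ** (transpose Q ** ?h)"
  have tr_diag: "transpose (diag_matrix k) = diag_matrix k" for k :: "'a ^ 3"
    by (simp add: transpose_def diag_matrix_def vec_eq_iff)
  have Qh: "transpose Q ** ?h ** Q = ?g"
    unfolding matrix_mul_assoc[symmetric] diag_matrix_mult
    using Q by (simp add: matrix_matrix_mult_def transpose_def vec_eq_iff diag_matrix_def mult_ac)
  have "R ** Q = diag_matrix (\<chi> i. inverse (g $ i)) ** ?g"
    unfolding R_def Qh[symmetric] by (simp add: matrix_mul_assoc)
  also have "\<dots> = mat 1"
    unfolding diag_matrix_mult using g by (simp add: diag_matrix_def mat_def vec_eq_iff)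
  finally have RQ: "R ** Q = mat 1" .
  then have QR: "Q ** R = mat 1" using matrix_left_right_inverse by blast
  have Qth: "transpose Q ** ?h = ?g ** R"
  proof -
    have "transpose Q ** ?h = transpose Q ** ?h ** (Q ** R)" unfolding QR by simp
    then show ?thesis by (simp only: matrix_mul_assoc Qh)
  qed
  then have hQ: "?h ** Q = transpose R ** ?g"
    by (metis matrix_transpose_mul tr_diag transpose_transpose)
  have mem: "Y \<in> acarrier (H3 base_comp_alg k)
    \<longleftrightarrow> transpose Y ** diag_matrix k = diag_matrix k ** Y"
    if "\<And>i. k $ i \<noteq> 0" for k :: "'a ^ 3" and Y
    unfolding H3_base(1)[OF that] by (simp add: matrix_transpose_mul tr_diag)
  have to_h: "Q ** Y ** R \<in> acarrier (H3 base_comp_alg h)" if "Y \<in> acarrier (H3 base_comp_alg g)" for Y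
  proof -
    from that have Y: "transpose Y ** ?g = ?g ** Y" by (simp add: mem[OF g])
    have "transpose (Q ** Y ** R) ** ?h = transpose R ** (transpose Y ** (transpose Q ** ?h))"
      by (simp add: matrix_transpose_mul matrix_mul_assoc)
    also have "\<dots> = transpose R ** ((transpose Y ** ?g) ** R)"
      unfolding Qth by (simp add: matrix_mul_assoc)
    also have "\<dots> = (transpose R ** ?g) ** (Y ** R)"
      unfolding Y by (simp add: matrix_mul_assoc)
    also have "\<dots> = ?h ** (Q ** Y ** R)" unfolding hQ[symmetric] by (simp add: matrix_mul_assoc)
    finally show ?thesis by (simp add: mem[OF h])
  qed
  have to_g: "R ** Y ** Q \<in> acarrier (H3 base_comp_alg g)" if "Y \<in> acarrier (H3 base_comp_alg h)" for Y
  proof -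
    from that have Y: "transpose Y ** ?h = ?h ** Y" by (simp add: mem[OF h])
    have "transpose (R ** Y ** Q) ** ?g = transpose Q ** (transpose Y ** (transpose R ** ?g))"
      by (simp add: matrix_transpose_mul matrix_mul_assoc)
    also have "\<dots> = transpose Q ** ((transpose Y ** ?h) ** Q)"
      unfolding hQ[symmetric] by (simp add: matrix_mul_assoc)
    also have "\<dots> = (transpose Q ** ?h) ** (Y ** Q)"
      unfolding Y by (simp add: matrix_mul_assoc)
    also have "\<dots> = ?g ** (R ** Y ** Q)" unfolding Qth by (simp add: matrix_mul_assoc)
    finally show ?thesis by (simp add: mem[OF g])
  qed
  have inverse: "R ** (Q ** Y ** R) ** Q = Y" "Q ** (R ** Y ** Q) ** R = Y" for Y
  proof -
    have "R ** (Q ** Y ** R) ** Q = (R ** Q) ** Y ** (R ** Q)" by (simp add: matrix_mul_assoc)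
    then show "R ** (Q ** Y ** R) ** Q = Y" by (simp add: RQ)
    have "Q ** (R ** Y ** Q) ** R = (Q ** R) ** Y ** (Q ** R)" by (simp add: matrix_mul_assoc)
    then show "Q ** (R ** Y ** Q) ** R = Y" by (simp add: QR)
  qed
  have add: "Q ** (Y + Z) ** R = Q ** Y ** R + Q ** Z ** R" for Y Z
    by (simp add: matrix_add_ldistrib matrix_matrix_mult_def vec_eq_iff sum.distrib algebra_simps)
  have scale: "Q ** (\<chi> i j. c * Y $ i $ j) ** R = (\<chi> i j. c * (Q ** Y ** R) $ i $ j)" for c Y
    by (simp add: matrix_matrix_mult_def vec_eq_iff sum_distrib_left sum_distrib_right mult_ac)
  have mult: "(Q ** Y ** R) ** (Q ** Z ** R) = Q ** (Y ** Z) ** R" for Y Z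
  proof -
    have "(Q ** Y ** R) ** (Q ** Z ** R) = Q ** Y ** (R ** Q) ** Z ** R" by (simp add: matrix_mul_assoc)
    then show ?thesis by (simp add: RQ matrix_mul_assoc)
  qed
  show ?thesis unfolding alg_iso_def
  proof (intro exI[of _ "\<lambda>Y. Q ** Y ** R"] conjI ballI allI)
    show "bij_betw (\<lambda>Y. Q ** Y ** R) (acarrier (H3 base_comp_alg g)) (acarrier (H3 base_comp_alg h))"
      by (rule bij_betw_byWitness[of _ "\<lambda>Y. R ** Y ** Q"]) (auto simp: inverse to_h to_g)
  qed (simp_all only: H3_base(2,3)[OF g] H3_base(2,3)[OF h] add scale mult)
qed

text \<open>Cancelling 1 leaves an isometry between the forms with coefficients
  \<open>dg / g $ i\<close> and \<open>dh / h $ i\<close>. Rescaling the coordinates by the entries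
  of \<open>g\<close> and \<open>h\<close> makes \<open>(dg / dh) *s g\<close> isometric to
  \<open>h\<close>, and the algebra does not change under the factor.\<close>

lemma H3_base_isometric:
  fixes g h :: "'a::field ^ 3"
  assumes g: "\<And>i. g $ i \<noteq> 0" and h: "\<And>i. h $ i \<noteq> 0" and two: "(2::'a) \<noteq> 0"
    and iso: "isometric (diag_form (vector [1, g$2 * g$3, g$1 * g$3, g$1 * g$2] :: 'a ^ 4))
      (diag_form (vector [1, h$2 * h$3, h$1 * h$3, h$1 * h$2] :: 'a ^ 4))"
  shows "alg_iso (H3 base_comp_alg g) (H3 base_comp_alg h)"
proof -
  let ?a = "vector [g$2 * g$3, g$1 * g$3, g$1 * g$2] :: 'a ^ 3"
  let ?b = "vector [h$2 * h$3, h$1 * h$3, h$1 * h$2] :: 'a ^ 3"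
  have iso': "isometric (diag_form (vector [1, ?a$1, ?a$2, ?a$3] :: 'a ^ 4))
    (diag_form (vector [1, ?b$1, ?b$2, ?b$3] :: 'a ^ 4))"
    using iso by simp
  obtain P :: "'a ^ 3 ^ 3" where
    P: "\<And>i j. (\<Sum>l\<in>UNIV. ?b $ l * P $ l $ i * P $ l $ j) = (if i = j then ?a $ i else 0)"
    using isometric_cancel_one[OF iso' two] by blast
  define dg where "dg = g$1 * g$2 * g$3"
  define dh where "dh = h$1 * h$2 * h$3"
  have d: "dg \<noteq> 0" "dh \<noteq> 0" using g h by (simp_all add: dg_def dh_def)
  have a: "?a $ i * g $ i = dg" and b: "?b $ i * h $ i = dh" for i
    using exhaust_3[of i] by (auto simp: dg_def dh_def)
  \<comment> \<open>With \<open>\<delta> = \<gamma>\<^sub>1\<gamma>\<^sub>2\<gamma>\<^sub>3\<close>, the products \<open>\<gamma>\<^sub>j\<gamma>\<^sub>l\<close> are \<open>\<delta> / \<gamma>\<^sub>i\<close>, that is \<open>\<delta> \<gamma>\<^sub>i\<close> up to squares.\<close>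
  define Q where "Q = (\<chi> l i. P $ l $ i * g $ i / h $ l)"
  have "alg_iso (H3 base_comp_alg ((dg / dh) *s g)) (H3 base_comp_alg h)"
  proof (rule H3_base_congruent)
    fix i j
    have "dh * (h $ l * Q $ l $ i * Q $ l $ j) = g $ i * g $ j * (?b $ l * P $ l $ i * P $ l $ j)" for l
      unfolding b[of l, symmetric] using h[of l] by (simp add: Q_def power2_eq_square field_simps)
    then have "dh * (\<Sum>l\<in>UNIV. h $ l * Q $ l $ i * Q $ l $ j) = g $ i * g $ j * (if i = j then ?a $ i else 0)"
      unfolding P[symmetric] sum_distrib_left by (rule sum.cong[OF refl])
    also have "\<dots> = dh * (if i = j then ((dg / dh) *s g) $ i else 0)"
      using d a[of i] by (auto simp: field_simps)
    finally show "(\<Sum>l\<in>UNIV. h $ l * Q $ l $ i * Q $ l $ j) = (if i = j then ((dg / dh) *s g) $ i else 0)"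
      using d by simp
  qed (use g h d in simp_all)
  then show ?thesis using d by (simp add: H3_scale)
qed

section \<open>Composition algebras and Freudenthal algebras of dimension six\<close>

lemma (in vector_space) independent_insert_outside:
  assumes "independent S" "finite S" "S \<subseteq> U" "subspace U" "a \<notin> U"
  shows "independent (insert a S)" "card (insert a S) = Suc (card S)"
proof -
  have "a \<notin> span S" using span_minimal[OF assms(3,4)] assms(5) by blast
  then show "independent (insert a S)" using assms(1) by (rule independent_insertI)
  have "a \<notin> S" using assms(3,5) by blast
  then show "card (insert a S) = Suc (card S)" using assms(2) by simp
qed

lemma cconj_base [simp]: "cconj base_comp_alg x = (x :: 'a::field)"
  by (simp add: cconj_def cpolar_def base_comp_alg_def power2_eq_square algebra_simps)

lemma H3_base_iff:
  "Y \<in> acarrier (H3 base_comp_alg g)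
    \<longleftrightarrow> (\<forall>i j. Y $ i $ j = inverse (g $ i) * g $ j * Y $ j $ i)"
  for g :: "'a::field ^ 3"
  unfolding H3_def by (simp add: base_comp_alg_def[THEN arg_cong[of _ _ cscale]] base_comp_alg_def[THEN arg_cong[of _ _ ccarrier]])

locale composition_alg =
  fixes C :: "('k::field, 'c::ab_group_add) comp_alg"
  assumes comp: "composition_algebra C" and two: "(2::'k) \<noteq> 0"
begin

abbreviation one where "one \<equiv> cunit C"

sublocale V: vector_space "cscale C"
  using comp by (simp add: composition_algebra_def)

lemma carrier_subspace: "V.subspace (ccarrier C)"
  using comp by (simp add: composition_algebra_def)

lemma one: "one \<in> ccarrier C" "one \<noteq> 0"
  using comp by (simp_all add: composition_algebra_def)

lemma mult_scale_one: "cmult C (cscale C s one) (cscale C t one) = cscale C (s * t) one"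
  using comp one by (simp add: composition_algebra_def V.subspace_scale[OF carrier_subspace])

lemma norm_scale: "x \<in> ccarrier C \<Longrightarrow> cnorm C (cscale C a x) = a\<^sup>2 * cnorm C x"
  using comp by (simp add: composition_algebra_def)

text \<open>Multiplicativity leaves only the values 0 and 1, and the value 0 would make the norm
  vanish on the whole carrier, against nondegeneracy.\<close>

lemma norm_one: "cnorm C one = 1"
proof -
  have mult: "cnorm C (cmult C x y) = cnorm C x * cnorm C y" if "x \<in> ccarrier C" "y \<in> ccarrier C" for x y
    using comp that by (simp add: composition_algebra_def)
  have unit: "cmult C x one = x" if "x \<in> ccarrier C" for x
    using comp that by (simp add: composition_algebra_def)
  have "cnorm C one \<noteq> 0"
  proof
    assume "cnorm C one = 0"
    then have "cnorm C x = 0" if "x \<in> ccarrier C" for x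
      using mult[OF that one(1)] unit[OF that] by simp
    then have "\<forall>y\<in>ccarrier C. cpolar C one y = 0"
      using one(1) V.subspace_add[OF carrier_subspace] by (simp add: cpolar_def)
    then show False using comp one by (auto simp: composition_algebra_def)
  qed
  with mult[OF one(1) one(1)] unit[OF one(1)] show ?thesis by simp
qed

lemma polar_scale: "x \<in> ccarrier C \<Longrightarrow> cpolar C (cscale C a x) one = a * cpolar C x one"
  using comp one by (simp add: composition_algebra_def)

lemma polar_add: "x \<in> ccarrier C \<Longrightarrow> y \<in> ccarrier C \<Longrightarrow> cpolar C (x
  + y) one = cpolar C x one + cpolar C y one"
  using comp one by (simp add: composition_algebra_def)

lemma polar_one: "cpolar C one one = 2"
proof -
  have "one + one = cscale C 2 one" using V.scale_left_distrib[of 1 1 one] by simp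
  then show ?thesis by (simp add: cpolar_def norm_scale[OF one(1)] norm_one)
qed

lemma conj_scale: "x \<in> ccarrier C \<Longrightarrow> cconj C (cscale C a x) = cscale C a (cconj C x)"
  by (simp add: cconj_def polar_scale V.scale_right_diff_distrib)

lemma conj_one: "cconj C one = one"
proof -
  have "one + one = cscale C 2 one" using V.scale_left_distrib[of 1 1 one] by simp
  then show ?thesis by (simp add: cconj_def polar_one algebra_simps)
qed

lemma conj_zero [simp]: "cconj C 0 = 0"
  using conj_scale[OF one(1), of 0] by simp

lemma conj_mem: "x \<in> ccarrier C \<Longrightarrow> cconj C x \<in> ccarrier C"
  unfolding cconj_def
  by (intro V.subspace_diff[OF carrier_subspace] V.subspace_scale[OF carrier_subspace] one)

lemma conj_conj:
  assumes x: "x \<in> ccarrier C"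
  shows "cconj C (cconj C x) = x"
proof -
  have "cpolar C (cconj C x) one = cpolar C (cscale C (cpolar C x one) one + cscale C (- 1) x) one"
    by (simp add: cconj_def)
  also have "\<dots> = cpolar C x one * 2 - cpolar C x one"
    using x one V.subspace_scale[OF carrier_subspace]
    by (subst polar_add) (simp_all only: polar_scale polar_one, simp_all)
  finally have "cpolar C (cconj C x) one = cpolar C x one" by simp
  then have "cconj C (cconj C x) = cscale C (cpolar C x one) one - cconj C x"
    by (simp only: cconj_def[of C "cconj C x"])
  then show ?thesis by (simp add: cconj_def)
qed

sublocale W: vector_space "mat3_scale C"
  by unfold_locales (simp_all add: mat3_scale_def vec_eq_iff V.scale_right_distrib V.scale_left_distrib)

text \<open>The elementary hermitian matrix with \<open>c\<close> at (i, j); its entry at (j, i) is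
  forced by Gamma.\<close>

definition hmat :: "'k ^ 3 \<Rightarrow> 3 \<Rightarrow> 3 \<Rightarrow> 'c \<Rightarrow> 'c ^ 3 ^ 3" where
  "hmat g i j c = (\<chi> p q. if p = i \<and> q = j then c
     else if p = j \<and> q = i then cscale C (inverse (g $ j) * g $ i) (cconj C c) else 0)"

lemma hmat_mem:
  assumes g: "\<And>i. g $ i \<noteq> 0" and c: "c \<in> ccarrier C" and "i = j \<Longrightarrow> cconj C c = c"
  shows "hmat g i j c \<in> acarrier (H3 C g)"
proof -
  have zero: "0 \<in> ccarrier C" by (rule V.subspace_0[OF carrier_subspace])
  have entry: "hmat g i j c $ p $ q \<in> ccarrier C" for p q
    using c zero conj_mem[OF c] V.subspace_scale[OF carrier_subspace] by (simp add: hmat_def)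
  have symmetric: "hmat g i j c $ p $ q = cscale C (inverse (g $ p) * g $ q) (cconj C (hmat g i j c $ q $ p))" for p q
  proof (cases "p = i \<and> q = j")
    case True
    show ?thesis
    proof (cases "i = j")
      case eq: True
      with True assms(3) g[of i] show ?thesis by (simp add: hmat_def)
    next
      case False
      have "inverse (g $ i) * g $ j * (inverse (g $ j) * g $ i) = 1" using g[of i] g[of j] by (simp add: field_simps)
      with True False show ?thesis
        by (simp only: hmat_def vec_lambda_beta conj_scale[OF conj_mem[OF c]] conj_conj[OF c] simp_thms
            if_True if_False V.scale_scale V.scale_one)
    qed
  next
    case False
    show ?thesis
    proof (cases "p = j \<and> q = i")
      case True
      then have "hmat g i j c $ q $ p = c" by (simp only: hmat_def vec_lambda_beta simp_thms if_True)
      moreover have "hmat g i j c $ p $ q = cscale C (inverse (g $ j) * g $ i) (cconj C c)"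
        by (simp only: hmat_def vec_lambda_beta if_not_P[OF False] if_P[OF True])
      ultimately show ?thesis using True by simp
    next
      case other: False
      have "hmat g i j c $ p $ q = 0" by (simp only: hmat_def vec_lambda_beta False other if_False)
      moreover have "\<not> (q = i \<and> p = j)" "\<not> (q = j \<and> p = i)" using False other by blast+
      then have "hmat g i j c $ q $ p = 0" by (simp only: hmat_def vec_lambda_beta if_False)
      ultimately show ?thesis by simp
    qed
  qed
  show ?thesis unfolding H3_def algebra.select_convs mem_Collect_eq
    using entry symmetric by blast
qed

lemma H3_entry:
  assumes "Y \<in> acarrier (H3 C g)"
  shows "Y $ i $ j \<in> ccarrier C" "Y $ i $ j = cscale C (inverse (g $ i) * g $ j) (cconj C (Y $ j $ i))"
  using assms unfolding H3_def algebra.select_convs mem_Collect_eq by blast+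

definition hbasis :: "'k ^ 3 \<Rightarrow> ('c ^ 3 ^ 3) set" where
  "hbasis g = {hmat g 2 3 one, hmat g 1 3 one, hmat g 1 2 one, hmat g 3 3 one, hmat g 2 2 one, hmat g 1 1 one}"

lemma zero_entry_subspace: "W.subspace {Y. Y $ i $ j = 0}"
  by (simp add: W.subspace_def mat3_scale_def)

text \<open>Each new matrix has a nonzero entry at a position where all the previous ones vanish, so
  it lies outside a subspace that contains them.\<close>

lemma hbasis_independent: "W.independent (hbasis g)" "card (hbasis g) = 6"
proof -
  note step = W.independent_insert_outside[OF _ _ _ zero_entry_subspace]
  let ?h = "\<lambda>i j. hmat g i j one"
  have 1: "W.independent {?h 1 1}" "card {?h 1 1} = 1"
    using step[of "{}" 1 1 "?h 1 1"] one(2) by (simp_all add: hmat_def W.independent_empty)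
  have 2: "W.independent {?h 2 2, ?h 1 1}" "card {?h 2 2, ?h 1 1} = 2"
    using step[of "{?h 1 1}" 2 2 "?h 2 2"] 1 one(2) by (simp_all add: hmat_def)
  have 3: "W.independent {?h 3 3, ?h 2 2, ?h 1 1}" "card {?h 3 3, ?h 2 2, ?h 1 1} = 3"
    using step[of "{?h 2 2, ?h 1 1}" 3 3 "?h 3 3"] 2 one(2) by (simp_all add: hmat_def)
  have 4: "W.independent {?h 1 2, ?h 3 3, ?h 2 2, ?h 1 1}" "card {?h 1 2, ?h 3 3, ?h 2 2, ?h 1 1} = 4"
    using step[of "{?h 3 3, ?h 2 2, ?h 1 1}" 1 2 "?h 1 2"] 3 one(2) by (simp_all add: hmat_def)
  have 5: "W.independent {?h 1 3, ?h 1 2, ?h 3 3, ?h 2 2, ?h 1 1}" "card {?h 1 3, ?h 1 2, ?h 3 3, ?h 2 2, ?h 1 1} = 5"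
    using step[of "{?h 1 2, ?h 3 3, ?h 2 2, ?h 1 1}" 1 3 "?h 1 3"] 4 one(2) by (simp_all add: hmat_def)
  show "W.independent (hbasis g)" "card (hbasis g) = 6"
    unfolding hbasis_def
    using step[of "{?h 1 3, ?h 1 2, ?h 3 3, ?h 2 2, ?h 1 1}" 2 3 "?h 2 3"] 5 one(2) by (simp_all add: hmat_def)
qed

lemma hbasis_subset:
  assumes "\<And>i. g $ i \<noteq> 0"
  shows "hbasis g \<subseteq> acarrier (H3 C g)"
  unfolding hbasis_def using assms one(1) conj_one by (auto intro!: hmat_mem)

text \<open>An element c outside the line of the unit would give a seventh independent matrix, with
  c at (1, 2): the six basis matrices all have a multiple of the unit there.\<close>

lemma carrier_of_dim_6:
  assumes g: "\<And>i. g $ i \<noteq> 0" and dim: "W.dim (acarrier (H3 C g)) = 6" and c: "c \<in> ccarrier C"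
  shows "\<exists>s. c = cscale C s one"
proof (rule ccontr)
  assume out: "\<nexists>s. c = cscale C s one"
  define U :: "('c ^ 3 ^ 3) set" where "U = {Y. \<exists>s. Y $ 1 $ 2 = cscale C s one}"
  have "W.subspace U"
    unfolding W.subspace_def U_def mat3_scale_def
    by (auto intro: exI[of _ 0] simp flip: V.scale_left_distrib)
  moreover have "hbasis g \<subseteq> U"
    by (auto simp: hbasis_def U_def hmat_def intro: exI[of _ 0] exI[of _ 1])
  moreover have "hmat g 1 2 c \<notin> U" using out by (simp add: U_def hmat_def)
  moreover have "finite (hbasis g)" by (simp add: hbasis_def)
  ultimately have ind: "W.independent (insert (hmat g 1 2 c) (hbasis g))" "card (insert (hmat g 1 2 c) (hbasis g)) = 7"
    using W.independent_insert_outside[of "hbasis g" U "hmat g 1 2 c"] hbasis_independent[of g] by simp_all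
  obtain B where B: "B \<subseteq> acarrier (H3 C g)" "W.independent B"
    "acarrier (H3 C g) \<subseteq> W.span B" "card B = W.dim (acarrier (H3 C g))"
    by (rule W.basis_exists)
  \<comment> \<open>\<open>card\<close> is 0 on infinite sets, so the value 6 forces
    finiteness.\<close>
  have "finite B" using B(4) dim card.infinite by fastforce
  moreover have "insert (hmat g 1 2 c) (hbasis g) \<subseteq> W.span B"
    using B(3) hbasis_subset[OF g] hmat_mem[OF g c, of 1 2] by auto
  ultimately have "card (insert (hmat g 1 2 c) (hbasis g)) \<le> card B"
    using W.independent_span_bound ind(1) by blast
  with ind(2) B(4) dim show False by simp
qed

lemma dim_H3:
  assumes g: "\<And>i. g $ i \<noteq> 0" and C: "\<And>c. c \<in> ccarrier C
    \<Longrightarrow> \<exists>s. c = cscale C s one"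
  shows "W.dim (acarrier (H3 C g)) = 6"
proof (rule W.dim_unique[OF hbasis_subset[OF g] _ hbasis_independent])
  show "acarrier (H3 C g) \<subseteq> W.span (hbasis g)"
  proof
    fix Y assume Y: "Y \<in> acarrier (H3 C g)"
    note mem = H3_entry(1)[OF Y] and eq = H3_entry(2)[OF Y]
    have "\<forall>i j. \<exists>s. Y $ i $ j = cscale C s one" using C mem by blast
    then obtain s where s: "\<And>i j. Y $ i $ j = cscale C (s i j) one" by metis
    let ?h = "\<lambda>i j. hmat g i j one"
    let ?t = "\<lambda>i j. mat3_scale C (s i j) (?h i j)"
    have s': "Y $ i $ j = cscale C (inverse (g $ i) * g $ j * s j i) one" for i j
      unfolding eq[of i j] s[of j i] by (simp add: conj_scale[OF one(1)] conj_one)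
    have "?h i j \<in> W.span (hbasis g)" if "?h i j \<in> hbasis g" for i j using that by (rule W.span_base)
    then have "?t 1 1 + ?t 2 2 + ?t 3 3 + ?t 1 2 + ?t 1 3 + ?t 2 3 \<in> W.span (hbasis g)"
      by (intro W.span_add W.span_scale) (simp_all add: hbasis_def)
    also have "?t 1 1 + ?t 2 2 + ?t 3 3 + ?t 1 2 + ?t 1 3 + ?t 2 3 = Y"
      by (simp add: vec_eq_iff forall_3 mat3_scale_def hmat_def conj_one mult_ac s[of 1 1] s[of 2 2] s[of 3 3]
          s[of 1 2] s[of 1 3] s[of 2 3] s'[of 2 1] s'[of 3 1] s'[of 3 2])
    finally show "Y \<in> W.span (hbasis g)" .
  qed
qed

lemma H3_base_iso:
  assumes g: "\<And>i. g $ i \<noteq> 0" and C: "\<And>c. c \<in> ccarrier C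
    \<Longrightarrow> \<exists>s. c = cscale C s one"
  shows "alg_iso (H3 base_comp_alg g) (H3 C g)"
proof -
  define h where "h M = (\<chi> i j. cscale C (M $ i $ j) one)" for M :: "'k ^ 3 ^ 3"
  have carrier: "cscale C s one \<in> ccarrier C" for s by (rule V.subspace_scale[OF carrier_subspace one(1)])
  have inj: "cscale C s one = cscale C t one \<longleftrightarrow> s = t" for s t
    using one(2) by (simp add: V.scale_cancel_right)
  have mem: "h M \<in> acarrier (H3 C g) \<longleftrightarrow> M \<in> acarrier (H3 base_comp_alg g)" for M
    unfolding H3_base_iff
    by (simp add: H3_def h_def carrier conj_scale[OF one(1)] conj_one inj one(2))
  have mult: "mat3_mult C (h M) (h N) = h (M ** N)" for M N
    by (simp add: mat3_mult_def h_def mult_scale_one matrix_matrix_mult_def V.scale_sum_left vec_eq_iff)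
  show ?thesis unfolding alg_iso_def
  proof (intro exI[of _ h] conjI ballI allI)
    show "bij_betw h (acarrier (H3 base_comp_alg g)) (acarrier (H3 C g))"
      unfolding bij_betw_def
    proof
      show "inj_on h (acarrier (H3 base_comp_alg g))"
        by (rule inj_onI) (simp add: h_def vec_eq_iff inj one(2))
      show "h ` acarrier (H3 base_comp_alg g) = acarrier (H3 C g)"
      proof
        show "acarrier (H3 C g) \<subseteq> h ` acarrier (H3 base_comp_alg g)"
        proof
          fix Y assume Y: "Y \<in> acarrier (H3 C g)"
          have "\<forall>i j. \<exists>s. Y $ i $ j = cscale C s one" using C H3_entry(1)[OF Y] by blast
          then obtain s where s: "\<And>i j. Y $ i $ j = cscale C (s i j) one" by metis
          then have "Y = h (\<chi> i j. s i j)" by (simp add: h_def vec_eq_iff)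
          with Y mem show "Y \<in> h ` acarrier (H3 base_comp_alg g)" by auto
        qed
      qed (auto simp: mem)
    qed
    fix x y a
    show "h (x + y) = h x + h y" by (simp add: h_def vec_eq_iff V.scale_left_distrib)
    show "h (amult (H3 base_comp_alg g) x y) = amult (H3 C g) (h x) (h y)"
      unfolding H3_base(3)[OF g] by (simp add: H3_def mult)
        (simp add: h_def mat3_scale_def vec_eq_iff V.scale_left_distrib V.scale_right_distrib add_divide_distrib)
    show "h (ascale (H3 base_comp_alg g) a x) = ascale (H3 C g) a (h x)"
      unfolding H3_base(2)[OF g] by (simp add: H3_def h_def mat3_scale_def vec_eq_iff)
  qed
qed

end

text \<open>The base field, realized on functions supported at 0, because the isomorphism classes
  are formed over the ambient type of functions on \<open>nat\<close>.\<close>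

definition nat_base_comp_alg :: "('k::field, nat \<Rightarrow> 'k) comp_alg" where
  "nat_base_comp_alg = \<lparr>ccarrier = {f. \<forall>n>0. f n = 0}, cscale = (\<lambda>a f n. a * f n),
     cmult = (\<lambda>f g n. f n * g n), cunit = (\<lambda>n. of_bool (n = 0)), cnorm
       = (\<lambda>f. (f 0)\<^sup>2)\<rparr>"

lemma nat_base_composition_algebra:
  assumes two: "(2::'k::field) \<noteq> 0"
  shows "composition_algebra (nat_base_comp_alg :: ('k, nat \<Rightarrow> 'k) comp_alg)"
proof -
  interpret V: vector_space "\<lambda>a (f :: nat \<Rightarrow> 'k) n. a * f n"
    by unfold_locales (simp_all add: fun_eq_iff algebra_simps)
  have polar: "cpolar nat_base_comp_alg f g = 2 * f 0 * g 0" for f g :: "nat \<Rightarrow> 'k"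
    by (simp add: cpolar_def nat_base_comp_alg_def power2_eq_square algebra_simps)
  have vs: "vector_space (\<lambda>a (f :: nat \<Rightarrow> 'k) n. a * f n)" ..
  have sub: "V.subspace {f. \<forall>n>0. f n = 0}" by (simp add: V.subspace_def)
  have nondeg: "f = 0" if "\<forall>n>0. f n = 0" "\<forall>g\<in>{g :: nat
    \<Rightarrow> 'k. \<forall>n>0. g n = 0}. 2 * f 0 * g 0 = 0" for f :: "nat \<Rightarrow> 'k"
  proof -
    have "(\<lambda>n. of_bool (n = 0)) \<in> {f :: nat \<Rightarrow> 'k. \<forall>n>0. f n = 0}" by auto
    from bspec[OF that(2) this] have "f 0 = 0" using two by simp
    then show "f = 0" using that(1) by (intro ext) (metis gr0I zero_fun_apply)
  qed
  note sel = nat_base_comp_alg_def comp_alg.select_convs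
  show ?thesis
    unfolding composition_algebra_def polar
  proof (intro conjI, goal_cases)
    case 1 show ?case unfolding sel by (rule vs)
  next
    case 2 show ?case unfolding sel by (rule sub)
  next
    case 10 show ?case unfolding sel using nondeg by blast
  qed (auto simp: nat_base_comp_alg_def fun_eq_iff algebra_simps power2_eq_square)
qed

lemma reduced_freudenthal6_iso_base:
  fixes A :: "'a::field freudenthal"
  assumes "A \<in> reduced_freudenthal6" and two: "(2::'a) \<noteq> 0"
  obtains g :: "'a ^ 3" where "\<And>i. g $ i \<noteq> 0" "alg_iso (H3 base_comp_alg g) A"
    "alg_iso A (H3 base_comp_alg g)"
proof -
  from assms(1) obtain C and g :: "'a ^ 3" where A: "A = H3 C g" "composition_algebra C" and g:
    "\<And>i. g $ i \<noteq> 0"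
    and dim: "vector_space.dim (ascale A) (acarrier A) = 6"
    by (auto simp: reduced_freudenthal6_def reduced_freudenthal_def)
  interpret composition_alg C using A(2) two by unfold_locales
  have "W.dim (acarrier (H3 C g)) = 6" using dim by (simp add: A(1) H3_def)
  then have "alg_iso (H3 base_comp_alg g) A"
    unfolding A(1) using H3_base_iso[OF g] carrier_of_dim_6[OF g] by blast
  moreover from this have "alg_iso A (H3 base_comp_alg g)"
    by (rule alg_iso_sym) (simp_all add: H3_base_closed[OF g])
  ultimately show thesis using g that by blast
qed

lemma H3_base_iso_reduced_freudenthal6:
  fixes g :: "'a::field ^ 3"
  assumes g: "\<And>i. g $ i \<noteq> 0" and two: "(2::'a) \<noteq> 0"
  obtains A :: "'a freudenthal" where "A \<in> reduced_freudenthal6" "alg_iso (H3 base_comp_alg g) A"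
    "alg_iso A (H3 base_comp_alg g)"
proof -
  let ?C = "nat_base_comp_alg :: ('a, nat \<Rightarrow> 'a) comp_alg"
  interpret composition_alg ?C using nat_base_composition_algebra[OF two] two by unfold_locales
  have C: "\<exists>s. c = cscale ?C s (cunit ?C)" if "c \<in> ccarrier ?C" for c
    by (rule exI[of _ "c 0"]) (use that in \<open>auto simp: nat_base_comp_alg_def fun_eq_iff\<close>)
  have "ascale (H3 ?C g) = mat3_scale ?C" by (simp add: H3_def)
  then have "vector_space.dim (ascale (H3 ?C g)) (acarrier (H3 ?C g)) = 6"
    using dim_H3[OF g C] by simp
  then have "H3 ?C g \<in> reduced_freudenthal6"
    using g comp by (auto simp: reduced_freudenthal6_def reduced_freudenthal_def)
  moreover have iso: "alg_iso (H3 base_comp_alg g) (H3 ?C g)" by (rule H3_base_iso[OF g C])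
  moreover from iso have "alg_iso (H3 ?C g) (H3 base_comp_alg g)"
    by (rule alg_iso_sym) (simp_all add: H3_base_closed[OF g])
  ultimately show thesis by (rule that)
qed

section \<open>Orbits and isomorphism classes\<close>

lemma k_polynomial_uminus: "k_polynomial U p \<Longrightarrow> k_polynomial U (\<lambda>x. - p x)"
  using k_polynomial.mult[OF k_polynomial.const[of U "- 1"], of p] by simp

lemma k_polynomial_zero: "k_polynomial U (\<lambda>x. 0)" and k_polynomial_one: "k_polynomial U (\<lambda>x. 1)"
  using k_polynomial.const[of U 0] k_polynomial.const[of U 1] by simp_all

lemma k_polynomial_sum: "(\<And>i. i \<in> I \<Longrightarrow> k_polynomial U (p i))
  \<Longrightarrow> k_polynomial U (\<lambda>x. \<Sum>i\<in>I. p i x)"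
  by (induction I rule: infinite_finite_induct) (simp_all add: k_polynomial_zero k_polynomial.add)

lemma k_polynomial_vector_coord: "k_polynomial vector_coords (\<lambda>v. v $ i)"
  by (rule k_polynomial.coord) (auto simp: vector_coords_def)

lemma k_polynomial_matrix_coord: "k_polynomial matrix_coords (\<lambda>g. g $ i $ j)"
  by (rule k_polynomial.coord) (auto simp: matrix_coords_def)

lemma k_polynomial_subst:
  assumes "k_polynomial cy p" and "\<And>c. c \<in> cy
    \<Longrightarrow> \<exists>q. k_polynomial cx q \<and> (\<forall>g\<in>G. c (F g) = q g)"
  shows "\<exists>q. k_polynomial cx q \<and> (\<forall>g\<in>G. p (F g) = q g)"
  using assms(1)
proof (induction rule: k_polynomial.induct)
  case (const c)
  show ?case by (rule exI[of _ "\<lambda>x. to_ac c"]) (simp add: k_polynomial.const)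
next
  case (coord c)
  then show ?case by (rule assms(2))
next
  case (add p q)
  then obtain p' q' where "k_polynomial cx p'" "\<forall>g\<in>G. p (F g) = p' g" "k_polynomial cx q'"
    "\<forall>g\<in>G. q (F g) = q' g"
    by blast
  then show ?case by (intro exI[of _ "\<lambda>x. p' x + q' x"]) (simp add: k_polynomial.add)
next
  case (mult p q)
  then obtain p' q' where "k_polynomial cx p'" "\<forall>g\<in>G. p (F g) = p' g" "k_polynomial cx q'"
    "\<forall>g\<in>G. q (F g) = q' g"
    by blast
  then show ?case by (intro exI[of _ "\<lambda>x. p' x * q' x"]) (simp add: k_polynomial.mult)
qed

lemma k_morphism_compose:
  assumes F: "k_morphism cx G cy H F" and K: "k_morphism cy H cz L K"
  shows "k_morphism cx G cz L (K \<circ> F)"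
  unfolding k_morphism_def
proof (intro conjI ballI)
  show "(K \<circ> F) ` G \<subseteq> L" using F K by (auto simp: k_morphism_def image_subset_iff)
  fix c assume "c \<in> cz"
  then obtain p where p: "k_polynomial cy p" "\<forall>h\<in>H. c (K h) = p h"
    using K by (auto simp: k_morphism_def image_subset_iff)
  have "\<exists>q. k_polynomial cx q \<and> (\<forall>g\<in>G. p (F g) = q g)"
    using F by (intro k_polynomial_subst[OF p(1)]) (auto simp: k_morphism_def image_subset_iff)
  moreover have "c ((K \<circ> F) g) = p (F g)" if "g \<in> G" for g
    using F p(2) that by (auto simp: k_morphism_def image_subset_iff)
  ultimately show "\<exists>q. k_polynomial cx q \<and> (\<forall>g\<in>G. c ((K \<circ> F) g) = q g)" by auto
qed

lemma k_morphism_cong: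
  assumes "k_morphism cx G cy H F" "\<And>g. g \<in> G \<Longrightarrow> F g = F' g"
  shows "k_morphism cx G cy H F'"
proof -
  have "F ` G = F' ` G" using assms(2) by (auto simp: image_iff)
  then show ?thesis using assms unfolding k_morphism_def by simp
qed

text \<open>An explicit inverse \<open>K\<close> agrees with \<open>inv_into G F\<close> on
  \<open>H\<close>, and a morphism depends only on values there.\<close>

lemma k_isomorphicI:
  assumes "\<And>g. g \<in> G \<Longrightarrow> K (F g) = g" "\<And>h. h \<in> H \<Longrightarrow> F (K h) = h"
    and "\<And>g h. g \<in> G \<Longrightarrow> h \<in> G \<Longrightarrow> F (mx g h) = my (F g) (F h)"
    and F: "k_morphism cx G cy H F" and K: "k_morphism cy H cx G K"
  shows "k_isomorphic cx mx G cy my H"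
  unfolding k_isomorphic_def
proof (intro exI[of _ F] conjI ballI)
  show bij: "bij_betw F G H"
    using assms by (intro bij_betw_byWitness[of _ K]) (auto simp: k_morphism_def image_subset_iff)
  have "inv_into G F h = K h" if "h \<in> H" for h
    using assms(1,2) K bij that by (metis bij_betw_def image_subset_iff inv_into_f_f k_morphism_def)
  then show "k_morphism cy H cx G (inv_into G F)"
    by (intro k_morphism_cong[OF K]) simp
qed (use assms in auto)

lemma k_isomorphicD:
  assumes "k_isomorphic cx mx G cy my H"
  shows "\<exists>F K. (\<forall>g\<in>G. K (F g) = g) \<and> (\<forall>h\<in>H. F (K h) = h) \<and>
    (\<forall>g\<in>G. \<forall>h\<in>G. F (mx g h) = my (F g) (F h)) \<and>
    k_morphism cx G cy H F \<and> k_morphism cy H cx G K"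
proof -
  from assms obtain F where bij: "bij_betw F G H"
    and F: "\<forall>g\<in>G. \<forall>h\<in>G. F (mx g h) = my (F g) (F h)"
      "k_morphism cx G cy H F" "k_morphism cy H cx G (inv_into G F)"
    unfolding k_isomorphic_def by blast
  show ?thesis
    by (intro exI[of _ F] exI[of _ "inv_into G F"] conjI F)
      (use bij in \<open>auto simp: bij_betw_def f_inv_into_f\<close>)
qed

lemma k_isomorphic_trans:
  assumes "k_isomorphic cx mx G cy my H" "k_isomorphic cy my H cz mz L"
  shows "k_isomorphic cx mx G cz mz L"
proof -
  from k_isomorphicD[OF assms(1)] obtain F K where F0: "\<forall>g\<in>G. K (F g) = g" "\<forall>h\<in>H. F (K h) = h"
    "\<forall>g\<in>G. \<forall>h\<in>G. F (mx g h) = my (F g) (F h)"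
    "k_morphism cx G cy H F" "k_morphism cy H cx G K" by (elim exE conjE)
  note F = F0[rule_format]
  from k_isomorphicD[OF assms(2)] obtain F' K' where F'0: "\<forall>g\<in>H. K' (F' g) = g"
    "\<forall>h\<in>L. F' (K' h) = h"
    "\<forall>g\<in>H. \<forall>h\<in>H. F' (my g h) = mz (F' g) (F' h)"
    "k_morphism cy H cz L F'" "k_morphism cz L cy H K'" by (elim exE conjE)
  note F' = F'0[rule_format]
  have "F g \<in> H" if "g \<in> G" for g using F(4) that by (auto simp: k_morphism_def image_subset_iff)
  moreover have "K' h \<in> H" if "h \<in> L" for h using F'(5) that by (auto simp: k_morphism_def image_subset_iff)
  ultimately show ?thesis
    by (intro k_isomorphicI[of G "K \<circ> K'"
      "F' \<circ> F"] k_morphism_compose[OF F(4) F'(4)] k_morphism_compose[OF F'(5) F(5)])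
      (simp_all add: F(1-3) F'(1-3))
qed

lemma k_isomorphic_sym:
  assumes "k_isomorphic cx mx G cy my H" and closed: "\<And>g h. g \<in> G \<Longrightarrow> h \<in> G
    \<Longrightarrow> mx g h \<in> G"
  shows "k_isomorphic cy my H cx mx G"
proof -
  from k_isomorphicD[OF assms(1)] obtain F K where F0: "\<forall>g\<in>G. K (F g) = g" "\<forall>h\<in>H. F (K h) = h"
    "\<forall>g\<in>G. \<forall>h\<in>G. F (mx g h) = my (F g) (F h)"
    "k_morphism cx G cy H F" "k_morphism cy H cx G K" by (elim exE conjE)
  note F = F0[rule_format]
  have K: "K h \<in> G" if "h \<in> H" for h using F(5) that by (auto simp: k_morphism_def image_subset_iff)
  have "K (my g h) = mx (K g) (K h)" if "g \<in> H" "h \<in> H" for g h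
    using F(1)[OF closed[OF K K], OF that] F(3)[OF K K, OF that] F(2) that by simp
  then show ?thesis
    by (intro k_isomorphicI[of H F K]) (simp_all add: F)
qed

lemma stabilizer_mult:
  fixes y :: "'a::field rep"
  assumes "g \<in> stabilizer y" "h \<in> stabilizer y"
  shows "g ** h \<in> stabilizer y"
  using assms rep_act_compose[of g h y] by (simp add: stabilizer_def Sp6_mult)

lemma ac_matrix_mult: "ac_matrix (g ** h) = ac_matrix g ** ac_matrix h"
  by (simp add: ac_matrix_def matrix_matrix_mult_def vec_eq_iff to_ac_sum)

lemma ac_matrix_one: "ac_matrix (mat 1) = mat 1"
  by (simp add: ac_matrix_def mat_def vec_eq_iff)

lemma ac_matrix_Sp6:
  assumes "g \<in> Sp6"
  shows "ac_matrix g \<in> Sp6"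
proof -
  have "ac_matrix (transpose g) = transpose (ac_matrix g)" by (simp add: ac_matrix_def transpose_def vec_eq_iff)
  moreover have "ac_matrix MJ = MJ" by (simp add: ac_matrix_def MJ_def vec_eq_iff)
  ultimately show ?thesis using assms unfolding Sp6_transpose by (metis ac_matrix_mult)
qed

lemma rep_to_ac_rep_act: "rep_to_ac (rep_act g y) = rep_act (ac_matrix g) (rep_to_ac y)"
proof -
  obtain x v where y: "y = (x, v)" by (cases y)
  let ?e = "\<lambda>w. \<chi> S. to_ac (w $ S)"
  have tri: "tri (?e w) a b c = to_ac (tri w a b c)" for w :: "'a ^ (6 set)" and a b c
    by (simp add: tri_def sgn3_def)
  have "?e (ext3_act g x) = ext3_act (ac_matrix g) (?e x)"
  proof (rule ext_power_3_eqI)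
    show "?e (ext3_act g x) \<in> ext_power 3"
      using ext3_act_ext_power[of g x] by (simp add: ext_power_def)
    show "tri (?e (ext3_act g x)) a b c = tri (ext3_act (ac_matrix g) (?e x)) a b c" for a b c
      unfolding tri tri_ext3_act by (simp add: to_ac_sum ac_matrix_def)
  qed (rule ext3_act_ext_power)
  moreover have "(\<chi> i. to_ac ((g *v v) $ i)) = ac_matrix g *v (\<chi> i. to_ac (v $ i))"
    by (simp add: matrix_vector_mult_def ac_matrix_def to_ac_sum vec_eq_iff)
  ultimately show ?thesis by (simp add: y rep_to_ac_def rep_act_def)
qed

text \<open>Conjugation by \<open>g\<close> is defined over k in both directions, as
  \<open>g\<close> and its inverse have entries in k. It identifies the stabilizers of the points of
  one orbit.\<close>

lemma k_isomorphic_stabilizer: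
  fixes y :: "'a::field rep"
  assumes g: "g \<in> Sp6" and y: "fst y \<in> ext_power 3"
  shows "k_isomorphic matrix_coords (**) (stabilizer (rep_to_ac y))
    matrix_coords (**) (stabilizer (rep_to_ac (rep_act g y)))"
proof -
  obtain h where h: "h \<in> Sp6" "h ** g = mat 1" "g ** h = mat 1" using Sp6_inverse[OF g] by blast
  let ?g = "ac_matrix g" and ?h = "ac_matrix h"
  have gh: "?g ** ?h = mat 1" "?h ** ?g = mat 1" by (simp_all add: h ac_matrix_one flip: ac_matrix_mult)
  have gh': "?g ** (?h ** m) = m" "?h ** (?g ** m) = m" for m :: "'a alg_closure ^ 6 ^ 6"
    by (simp_all add: matrix_mul_assoc gh)
  have gS: "?g \<in> Sp6" "?h \<in> Sp6" using g h by (simp_all add: ac_matrix_Sp6)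
  have Y: "fst (rep_to_ac y) \<in> ext_power 3" using y by (cases y) (auto simp: rep_to_ac_def ext_power_def)
  have act: "rep_act ?h (rep_act ?g (rep_to_ac y)) = rep_to_ac y"
    by (simp add: rep_act_compose gh rep_act_one[OF Y])
  have poly: "k_morphism matrix_coords A matrix_coords B (\<lambda>s. ac_matrix a ** s ** ac_matrix b)"
    if "(\<lambda>s. ac_matrix a ** s ** ac_matrix b) ` A \<subseteq> B" for A B and a b :: "'a ^ 6 ^ 6"
  proof -
    have "k_polynomial matrix_coords (\<lambda>s :: 'a alg_closure ^ 6 ^ 6. (ac_matrix a ** s ** ac_matrix b) $ i $ j)" for i j
      unfolding matrix_matrix_mult_def ac_matrix_def vec_lambda_beta
      by (intro k_polynomial_sum k_polynomial.mult k_polynomial.const k_polynomial_matrix_coord)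
    then show ?thesis using that unfolding k_morphism_def matrix_coords_def by blast
  qed
  have push: "?g ** s ** ?h \<in> stabilizer (rep_act ?g (rep_to_ac y))" if "s \<in> stabilizer (rep_to_ac y)" for s
  proof -
    have "rep_act (?g ** s ** ?h)
      (rep_act ?g (rep_to_ac y)) = rep_act ?g (rep_act s (rep_act ?h (rep_act ?g (rep_to_ac y))))"
      by (simp add: rep_act_compose matrix_mul_assoc)
    then show ?thesis using that gS by (simp add: stabilizer_def act Sp6_mult)
  qed
  have pull: "?h ** s ** ?g \<in> stabilizer (rep_to_ac y)" if "s \<in> stabilizer (rep_act ?g (rep_to_ac y))" for s
  proof -
    have "rep_act (?h ** s ** ?g) (rep_to_ac y) = rep_act ?h (rep_act s (rep_act ?g (rep_to_ac y)))"
      by (simp add: rep_act_compose matrix_mul_assoc)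
    then show ?thesis using that gS by (simp add: stabilizer_def act Sp6_mult)
  qed
  show ?thesis unfolding rep_to_ac_rep_act
  proof (rule k_isomorphicI[of _ "\<lambda>s. ?h ** s ** ?g" "\<lambda>s. ?g ** s ** ?h"])
    show "k_morphism matrix_coords (stabilizer (rep_to_ac y)) matrix_coords
        (stabilizer (rep_act ?g (rep_to_ac y))) (\<lambda>s. ?g ** s ** ?h)"
      by (rule poly) (use push in blast)
    show "k_morphism matrix_coords (stabilizer (rep_act ?g (rep_to_ac y))) matrix_coords
        (stabilizer (rep_to_ac y)) (\<lambda>s. ?h ** s ** ?g)"
      by (rule poly) (use pull in blast)
  qed (simp_all add: matrix_mul_assoc[symmetric] gh gh')
qed

lemma stabilizer_normal_form_SL1:
  fixes a b c d :: "'a::field"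
  assumes nz: "a \<noteq> 0" "b \<noteq> 0" "c \<noteq> 0" "d \<noteq> 0" and two: "(2::'a) \<noteq> 0"
  shows "stabilizer_is_SL1 (normal_form a b c d, axis 0 1) (c * d) (a * b)"
proof -
  let ?a = "to_ac a" and ?b = "to_ac b" and ?c = "to_ac c" and ?d = "to_ac d"
  let ?M = "stab_matrix ?a ?b ?c ?d"
  let ?S = "SL1 (?c * ?d) (?a * ?b)"
  have ac: "rep_to_ac (normal_form a b c d, axis 0 1) = (normal_form ?a ?b ?c ?d, axis 0 1)"
    by (simp add: rep_to_ac_def normal_form_def vec_eq_iff axis_def)
  have two': "(2::'a alg_closure) \<noteq> 0" using two to_ac_eq_0_iff[of "2::'a"] by simp
  have stab: "stabilizer (rep_to_ac (normal_form a b c d, axis 0 1)) = ?M ` ?S"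
    unfolding ac using nz two' by (intro stabilizer_normal_form) simp_all
  \<comment> \<open>Reads q off the second column of \<open>stab_matrix\<close>. The constants 1/d,
    -1/b and 1/(b d) lie in k, so the inverse morphism is defined over k.\<close>
  define F :: "'a alg_closure ^ 6 ^ 6 \<Rightarrow> 'a alg_closure ^ 4" where
    "F g = vector [g$1$1, to_ac (inverse d) * g$2$1, to_ac (- inverse b) * g$5$1, to_ac (inverse (b * d)) * g$4$1]" for g
  have FM: "F (?M q) = q" for q
    using nz by (simp add: F_def stab_matrix_def vec_eq_4 field_simps)
  have "k_isomorphic matrix_coords (**) (?M ` ?S) vector_coords (quat_mult (?c * ?d) (?a * ?b)) ?S"
  proof (rule k_isomorphicI[of _ ?M F])
    show "F (g ** h) = quat_mult (?c * ?d) (?a * ?b) (F g) (F h)" if "g \<in> ?M ` ?S" "h \<in> ?M ` ?S" for g h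
      using that by (auto simp: stab_matrix_mult FM)
    have "\<forall>i. k_polynomial matrix_coords (\<lambda>g. F g $ i)"
      unfolding forall_4 F_def vector_4
      by (intro conjI k_polynomial.mult k_polynomial.const k_polynomial_matrix_coord)
    then show "k_morphism matrix_coords (?M ` ?S) vector_coords ?S F"
      unfolding k_morphism_def vector_coords_def by (auto simp: FM)
    have "\<forall>i j. k_polynomial vector_coords (\<lambda>q. ?M q $ i $ j)"
      unfolding forall_6 stab_matrix_def mk6_nth
      by (intro conjI k_polynomial_zero k_polynomial_one k_polynomial_uminus k_polynomial.mult
          k_polynomial.const k_polynomial_vector_coord)
    then show "k_morphism vector_coords ?S matrix_coords (?M ` ?S) ?M"
      unfolding k_morphism_def matrix_coords_def by blast
  qed (auto simp: FM)
  then show ?thesis by (simp add: stabilizer_is_SL1_def stab)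
qed

section \<open>From norm forms to isomorphism classes\<close>

lemma isometric_sym: "isometric p q \<Longrightarrow> isometric q p"
proof -
  assume "isometric p q"
  then obtain T where T: "invertible T" "\<And>x. q (T *v x) = p x" by (auto simp: isometric_def)
  then obtain S where S: "T ** S = mat 1" "S ** T = mat 1" by (auto simp: invertible_def)
  have "p (S *v x) = q x" for x
    using T(2)[of "S *v x"] by (simp add: matrix_vector_mul_assoc S)
  moreover have "invertible S" using S by (auto simp: invertible_def)
  ultimately show ?thesis by (auto simp: isometric_def)
qed

lemma isometric_trans: "isometric p q \<Longrightarrow> isometric q r \<Longrightarrow> isometric p r"
proof -
  assume "isometric p q" "isometric q r"
  then obtain T S where T: "invertible T" "\<And>x. q (T *v x) = p x" and S: "invertible S" "\<And>x. r (S *v x) = q x"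
    by (auto simp: isometric_def)
  have "r ((S ** T) *v x) = p x" for x using T(2)[of x] S(2)[of "T *v x"] by (simp flip: matrix_vector_mul_assoc)
  then show ?thesis unfolding isometric_def using invertible_mult[OF S(1) T(1)] by blast
qed

text \<open>For c = -\<gamma>2 \<gamma>3 and d = -\<gamma>1 \<gamma>3 the product c d is \<gamma>1
  \<gamma>2 \<gamma>3^2, so only the last coordinate has to be rescaled, by 1/\<gamma>3.\<close>

lemma diag_form_gamma_isometric:
  fixes g :: "'a::field ^ 3"
  assumes "\<And>i. g $ i \<noteq> 0"
  shows "isometric (diag_form (vector [1, g$2 * g$3, g$1 * g$3, g$1 * g$2] :: 'a ^ 4))
    (quat_norm (- (g$2 * g$3)) (- (g$1 * g$3)))"
proof -
  define T where "T = diag_matrix (vector [1, 1, 1, inverse (g$3)] :: 'a ^ 4)"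
  define S where "S = diag_matrix (vector [1, 1, 1, g$3] :: 'a ^ 4)"
  have T: "T *v x = vector [x$1, x$2, x$3, inverse (g$3) * x$4]" for x
    by (simp add: T_def diag_matrix_def matrix_vector_mult_def vec_eq_4 sum_4)
  have "S ** T = mat 1"
    unfolding S_def T_def diag_matrix_mult using assms
    by (simp add: vec_eq_iff forall_4 diag_matrix_def mat_def)
  then have "invertible T" unfolding invertible_left_inverse by blast
  moreover have "quat_norm (- (g$2 * g$3)) (- (g$1 * g$3)) (T *v x) =
      diag_form (vector [1, g$2 * g$3, g$1 * g$3, g$1 * g$2] :: 'a ^ 4) x" for x
    unfolding T using assms[of 3] by (simp add: quat_norm_def diag_form_def sum_4 power2_eq_square field_simps)
  ultimately show ?thesis unfolding isometric_def by blast
qed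

text \<open>\<open>alg_iso_sym\<close> asks for a source with closed carrier, which
  \<open>H3_base_closed\<close> gives over the base field; hence the detour through
  \<open>H3 base_comp_alg g\<close>.\<close>

lemma alg_iso_reduced_freudenthal6_sym:
  assumes two: "(2::'a::field) \<noteq> 0" and "U \<in> (reduced_freudenthal6 :: 'a freudenthal set)" "alg_iso U Y"
  shows "alg_iso Y U"
proof -
  obtain g :: "'a ^ 3" where g: "\<And>i. g $ i \<noteq> 0" "alg_iso (H3 base_comp_alg g) U"
    "alg_iso U (H3 base_comp_alg g)"
    using reduced_freudenthal6_iso_base[OF assms(2) two] by blast
  have "alg_iso Y (H3 base_comp_alg g)"
    using alg_iso_trans[OF g(2) assms(3)] by (rule alg_iso_sym) (simp_all add: H3_base_closed[OF g(1)])
  then show ?thesis using g(2) by (rule alg_iso_trans)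
qed

lemma freudenthal6_iso_equiv:
  assumes two: "(2::'a::field) \<noteq> 0"
  shows "equiv reduced_freudenthal6 (freudenthal6_iso :: ('a freudenthal \<times> 'a freudenthal) set)"
proof (rule equivI)
  show "freudenthal6_iso \<subseteq> reduced_freudenthal6 \<times> (reduced_freudenthal6 :: 'a freudenthal set)"
    by (auto simp: freudenthal6_iso_def)
  show "refl_on reduced_freudenthal6 (freudenthal6_iso :: ('a freudenthal \<times> 'a freudenthal) set)"
  proof (rule refl_onI)
    fix U :: "'a freudenthal" assume U: "U \<in> reduced_freudenthal6"
    then obtain g :: "'a ^ 3" where "alg_iso (H3 base_comp_alg g) U" "alg_iso U (H3 base_comp_alg g)"
      using reduced_freudenthal6_iso_base[OF U two] by blast
    then show "(U, U) \<in> freudenthal6_iso" using U alg_iso_trans by (auto simp: freudenthal6_iso_def)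
  qed
  show "sym (freudenthal6_iso :: ('a freudenthal \<times> 'a freudenthal) set)"
    by (rule symI) (auto simp: freudenthal6_iso_def intro: alg_iso_reduced_freudenthal6_sym[OF two])
  show "trans (freudenthal6_iso :: ('a freudenthal \<times> 'a freudenthal) set)"
    by (rule transI) (auto simp: freudenthal6_iso_def intro: alg_iso_trans)
qed

lemma represents_normal_form:
  fixes a b c d :: "'a::field" and g :: "'a ^ 3"
  assumes nz: "a \<noteq> 0" "b \<noteq> 0" "c \<noteq> 0" "d \<noteq> 0" and g: "\<And>i. g $ i \<noteq> 0"
    and two: "(2::'a) \<noteq> 0"
    and orb: "(normal_form a b c d, axis 0 1) \<in> orb"
    and U: "U \<in> reduced_freudenthal6" "alg_iso U (H3 base_comp_alg g)"
    and eq: "- (g$2 * g$3) = c * d" "- (g$1 * g$3) = a * b"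
  shows "represents orb (freudenthal6_iso `` {U})"
  unfolding represents_def
proof (rule bexI[OF _ orb], rule exI[of _ "c * d"], rule exI[of _ "a * b"], rule exI[of _ g], intro conjI allI)
  have "U \<in> freudenthal6_iso `` {U}" using freudenthal6_iso_equiv[OF two] U(1) by (rule equiv_class_self)
  then show "\<exists>U\<in>freudenthal6_iso `` {U}. alg_iso U (H3 base_comp_alg g)" using U(2) by blast
  show "isometric (diag_form (vector [1, g$2 * g$3, g$1 * g$3, g$1 * g$2] :: 'a ^ 4)) (quat_norm (c * d) (a * b))"
    using diag_form_gamma_isometric[OF g] by (simp only: eq)
qed (use nz g two in \<open>simp_all add: stabilizer_normal_form_SL1\<close>)

text \<open>The two chosen points have stabilizers conjugate to that of \<open>y\<close>, so the two
  groups SL_1 are isomorphic over k. Their norm forms are then isometric, and with them the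
  quaternary forms of both matrices Gamma.\<close>

lemma represents_unique:
  fixes y :: "'a::field rep"
  assumes two: "(2::'a) \<noteq> 0" and y: "y \<in> Vss"
    and K: "K \<in> reduced_freudenthal6 // freudenthal6_iso" "represents {rep_act g y | g. g \<in> Sp6} K"
    and L: "L \<in> reduced_freudenthal6 // freudenthal6_iso" "represents {rep_act g y | g. g \<in> Sp6} L"
  shows "K = L"
proof -
  have ext: "fst (rep_act g y) \<in> ext_power 3" for g
    by (cases y) (simp add: rep_act_def ext3_act_ext_power)
  from K(2) obtain g c d \<gamma> U where g: "g \<in> Sp6" and cd: "c \<noteq> 0" "d \<noteq> 0"
    and S: "stabilizer_is_SL1 (rep_act g y) c d" and \<gamma>: "\<And>i. \<gamma> $ i \<noteq> 0"
    and U: "U \<in> K" "alg_iso U (H3 base_comp_alg \<gamma>)"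
    and I: "isometric (diag_form (vector [1, \<gamma>$2 * \<gamma>$3, \<gamma>$1 * \<gamma>$3, \<gamma>$1 * \<gamma>$2] :: 'a ^ 4)) (quat_norm c d)"
    unfolding represents_def by blast
  from L(2) obtain g' c' d' \<gamma>' U' where g': "g' \<in> Sp6" and cd': "c' \<noteq> 0" "d' \<noteq> 0"
    and S': "stabilizer_is_SL1 (rep_act g' y) c' d'" and \<gamma>': "\<And>i. \<gamma>' $ i \<noteq> 0"
    and U': "U' \<in> L" "alg_iso U' (H3 base_comp_alg \<gamma>')"
    and I': "isometric (diag_form (vector [1, \<gamma>'$2 * \<gamma>'$3, \<gamma>'$1 * \<gamma>'$3, \<gamma>'$1 * \<gamma>'$2] :: 'a ^ 4)) (quat_norm c' d')"
    unfolding represents_def by blast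
  have yext: "fst y \<in> ext_power 3" using y by (auto simp: Vss_def X_space_def)
  note G = k_isomorphic_stabilizer[OF g yext] and G' = k_isomorphic_stabilizer[OF g' yext]
  have "k_isomorphic vector_coords (quat_mult (to_ac c) (to_ac d)) (SL1 (to_ac c) (to_ac d))
      matrix_coords (**) (stabilizer (rep_to_ac (rep_act g y)))"
    using S unfolding stabilizer_is_SL1_def by (rule k_isomorphic_sym) (rule stabilizer_mult)
  moreover have "k_isomorphic matrix_coords (**) (stabilizer (rep_to_ac (rep_act g y)))
      matrix_coords (**) (stabilizer (rep_to_ac y))"
    using G by (rule k_isomorphic_sym) (rule stabilizer_mult)
  ultimately have "k_isomorphic vector_coords (quat_mult (to_ac c) (to_ac d)) (SL1 (to_ac c) (to_ac d))
      vector_coords (quat_mult (to_ac c') (to_ac d')) (SL1 (to_ac c') (to_ac d'))"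
    using G' S' unfolding stabilizer_is_SL1_def by (blast intro: k_isomorphic_trans)
  then have "isometric (quat_norm c d) (quat_norm c' d')"
    using cd cd' two by (rule k_isomorphic_SL1_isometric)
  then have "isometric (diag_form (vector [1, \<gamma>$2 * \<gamma>$3, \<gamma>$1 * \<gamma>$3, \<gamma>$1 * \<gamma>$2] :: 'a ^ 4))
      (diag_form (vector [1, \<gamma>'$2 * \<gamma>'$3, \<gamma>'$1 * \<gamma>'$3, \<gamma>'$1 * \<gamma>'$2] :: 'a ^ 4))"
    using I isometric_sym[OF I'] isometric_trans by blast
  then have \<gamma>\<gamma>': "alg_iso (H3 base_comp_alg \<gamma>) (H3 base_comp_alg \<gamma>')"
    by (rule H3_base_isometric[OF \<gamma> \<gamma>' two])
  note equiv = freudenthal6_iso_equiv[OF two]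
  have mem: "U \<in> reduced_freudenthal6" "U' \<in> reduced_freudenthal6"
    using K(1) L(1) U(1) U'(1) equiv by (auto dest: in_quotient_imp_subset[OF equiv])
  have "alg_iso (H3 base_comp_alg \<gamma>') U'" by (rule alg_iso_reduced_freudenthal6_sym[OF two mem(2) U'(2)])
  with alg_iso_trans[OF U(2) \<gamma>\<gamma>'] have "alg_iso U U'" by (rule alg_iso_trans)
  then have "(U, U') \<in> freudenthal6_iso" using mem by (simp add: freudenthal6_iso_def)
  then show "K = L" by (rule quotient_eqI[OF equiv K(1) L(1) U(1) U'(1)])
qed

theorem theorem6p1:
  assumes "CHAR('a::field) \<noteq> 2" and "CHAR('a) \<noteq> 3"
  shows "(\<forall>orb \<in> (Vss_orbits :: 'a rep set set).
            \<exists>!K. K \<in> reduced_freudenthal6 // freudenthal6_iso \<and> represents orb K) \<and>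
         (\<forall>A \<in> (reduced_freudenthal6 :: 'a freudenthal set).
            \<exists>orb \<in> Vss_orbits. represents orb (freudenthal6_iso `` {A}))"
proof -
  have two: "(2::'a) \<noteq> 0"
  proof
    assume "(2::'a) = 0"
    then have "of_nat 2 = (0::'a)" by simp
    then have "CHAR('a) dvd 2" by (simp only: of_nat_eq_0_iff_char_dvd)
    then have "CHAR('a) = 1 \<or> CHAR('a) = 2" using prime_nat_iff two_is_prime_nat by blast
    with assms(1) show False by simp
  qed
  show ?thesis
  proof (intro conjI ballI)
    fix orb :: "'a rep set" assume "orb \<in> Vss_orbits"
    then obtain y where orb: "orb = {rep_act g y | g. g \<in> Sp6}" and y: "y \<in> Vss"
      by (auto simp: Vss_orbits_def)
    obtain g a b c d where g: "g \<in> Sp6" and nz: "a \<noteq> 0" "b \<noteq> 0" "c \<noteq> 0" "d \<noteq> 0"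
      and y_eq: "y = rep_act g (normal_form a b c d, axis 0 1)"
      using Vss_normal_form[OF y two] by blast
    obtain h where h: "h \<in> Sp6" "h ** g = mat 1" using Sp6_inverse[OF g] by blast
    have "rep_act h y = (normal_form a b c d, axis 0 1)"
      by (simp add: y_eq rep_act_compose h rep_act_one normal_form_ext_power)
    then have mem: "(normal_form a b c d, axis 0 1) \<in> orb" unfolding orb using h(1) by force
    \<comment> \<open>With third entry 1, the conditions -\<gamma>2 \<gamma>3 = c d and -\<gamma>1
      \<gamma>3 = a b determine the other two entries.\<close>
    define \<gamma> :: "'a ^ 3" where "\<gamma> = vector [- (a * b), - (c * d), 1]"
    have \<gamma>: "\<gamma> $ i \<noteq> 0" for i using exhaust_3[of i] nz by (auto simp: \<gamma>_def)
    obtain B :: "'a freudenthal" where B: "B \<in> reduced_freudenthal6" "alg_iso B (H3 base_comp_alg \<gamma>)"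
      using H3_base_iso_reduced_freudenthal6[OF \<gamma> two] by blast
    have "represents orb (freudenthal6_iso `` {B})"
      by (rule represents_normal_form[OF nz \<gamma> two mem B]) (simp_all add: \<gamma>_def)
    moreover have "freudenthal6_iso `` {B} \<in> reduced_freudenthal6 // freudenthal6_iso"
      using B(1) by (rule quotientI)
    ultimately show "\<exists>!K. K \<in> reduced_freudenthal6 // freudenthal6_iso \<and> represents orb K"
      using represents_unique[OF two y] unfolding orb by blast
  next
    fix B :: "'a freudenthal" assume B: "B \<in> reduced_freudenthal6"
    obtain \<gamma> :: "'a ^ 3" where \<gamma>: "\<And>i. \<gamma> $ i \<noteq> 0"
      "alg_iso B (H3 base_comp_alg \<gamma>)"
      using reduced_freudenthal6_iso_base[OF B two] by blast
    \<comment> \<open>Taking b = d = 1 in the normal form makes its stabilizer SL_1 of the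
      quaternion algebra (c, a), whose norm form is the one attached to \<gamma>.\<close>
    define a where "a = - (\<gamma> $ 1 * \<gamma> $ 3)"
    define c where "c = - (\<gamma> $ 2 * \<gamma> $ 3)"
    have nz: "a \<noteq> 0" "c \<noteq> 0" "(1::'a) \<noteq> 0" using \<gamma>(1) by (simp_all add: a_def c_def)
    define y :: "'a rep" where "y = (normal_form a 1 c 1, axis 0 1)"
    have "y \<in> Vss" unfolding y_def using nz two by (intro normal_form_Vss)
    then have "{rep_act g y | g. g \<in> Sp6} \<in> Vss_orbits" unfolding Vss_orbits_def by blast
    moreover have "y \<in> {rep_act g y | g. g \<in> Sp6}"
    proof -
      have "mat 1 \<in> (Sp6 :: ('a ^ 6 ^ 6) set)" by (simp add: Sp6_transpose transpose_mat)
      moreover have "y = rep_act (mat 1) y" by (simp add: rep_act_one y_def normal_form_ext_power)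
      ultimately show ?thesis by blast
    qed
    then have "represents {rep_act g y | g. g \<in> Sp6} (freudenthal6_iso `` {B})"
      unfolding y_def using nz \<gamma> two B
      by (intro represents_normal_form[of a 1 c 1 \<gamma>]) (simp_all add: a_def c_def)
    ultimately show "\<exists>orb\<in>Vss_orbits. represents orb (freudenthal6_iso `` {B})" by blast
  qed
qed

end
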